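(* Let $\xi_1,\dots,\xi_m\in\mathbb R^n$ be linearly independent unit vectors, and let $g_1,\dots,g_m:[-1,1]\times\mathbb R^n\to\mathbb R^n$ be such that $z\mapsto g_j(w,z)$ is $C^\infty$ for every $w\in[-1,1]$ and every $j$. Assume that for every $(w_1,\dots,w_m)\in[-1,1]^m$ the $m$ vector fields $z\mapsto g_j(w_j,z)$, $j=1,\dots,m$, satisfy the Chow hypothesis. Let $k\ge1$ be an integer and consider the system $$\dot z=\sum_{j=1}^m g_j\big(w_k[z\cdot\xi_j],z\big)\,u_j,\qquad w_k[\zeta](t)=\frac1k\sum_{i=1}^k h_i[\zeta](t),$$ where $h_i$ is the delayed relay with thresholds $\left(-1+\frac ik,\frac ik\right)$. Then this system is exactly controllable: for every $A,B\in\mathbb R^n$ and all initial relay states compatible with $A$, there exist $T>0$ and piecewise constant controls $u_1,\dots,u_m:[0,T]\to\mathbb R$ that steer the system from $z(0)=A$ (with those initial relay states) to $z(T)=B$.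
   Context: Chow hypothesis for smooth fields on $\mathbb R^n$: at every point of $\mathbb R^n$ the evaluations of all iterated Lie brackets (of any order, including the fields themselves) of the fields span $\mathbb R^n$. Delayed relay with thresholds $(a,b)$, $a<b$: its output takes values in $\{-1,1\}$; if the output is $1$ it stays equal to $1$ as long as the input is $\ge a$, and switches to $-1$ when the input would become $<a$; if the output is $-1$ it stays equal to $-1$ as long as the input is $\le b$, and switches to $1$ when the input would become $>b$. An initial output is compatible with an initial input value $\zeta_0$ if it is $1$ with $\zeta_0\ge a$, or $-1$ with $\zeta_0\le b$. For each $j=1,\dots,m$ there is a separate family of $k$ relays $h_1,\dots,h_k$ acting on the input $z\cdot\xi_j$, each with its own initial output; these $mk$ initial outputs are the initial relay states, and compatibility with $A$ means that each is compatible with the input value $A\cdot\xi_j$. Solutions. For given piecewise constant controls, a solution is an absolutely continuous $z(\cdot)$ together with piecewise constant relay outputs such that $z$ solves the ODE with the current relay outputs on each interval where all of them are constant, and a relay switches at a time $t$ precisely when, by continuing to move with the current relay outputs (mode), the solution would be forced to cross the corresponding threshold of that relay immediately after $t$. *)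

theory Defs
  imports "HOL-Analysis.Analysis"
begin

section \<open>Smooth vector fields, Lie brackets and the Chow hypothesis\<close>

primrec C_diff :: "nat \<Rightarrow> ('a::real_normed_vector \<Rightarrow> 'b::real_normed_vector) \<Rightarrow> bool" where
  "C_diff 0 f \<longleftrightarrow> continuous_on UNIV f"
| "C_diff (Suc r) f \<longleftrightarrow>
     (\<forall>x. f differentiable (at x)) \<and> (\<forall>v. C_diff r (\<lambda>x. frechet_derivative f (at x) v))"

definition smooth :: "('a::real_normed_vector \<Rightarrow> 'b::real_normed_vector) \<Rightarrow> bool" where
  "smooth f \<longleftrightarrow> (\<forall>r. C_diff r f)"

definition lie_bracket ::
    "('a::real_normed_vector \<Rightarrow> 'a) \<Rightarrow> ('a \<Rightarrow> 'a) \<Rightarrow> 'a \<Rightarrow> 'a" where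
  "lie_bracket X Y x = frechet_derivative Y (at x) (X x) - frechet_derivative X (at x) (Y x)"

inductive_set iterated_brackets ::
    "('a::real_normed_vector \<Rightarrow> 'a) set \<Rightarrow> ('a \<Rightarrow> 'a) set"
  for F :: "('a \<Rightarrow> 'a) set" where
  field: "X \<in> F \<Longrightarrow> X \<in> iterated_brackets F"
| bracket: "X \<in> iterated_brackets F \<Longrightarrow> Y \<in> iterated_brackets F
    \<Longrightarrow> lie_bracket X Y \<in> iterated_brackets F"

definition chow_hypothesis :: "('a::real_normed_vector \<Rightarrow> 'a) set \<Rightarrow> bool" where
  "chow_hypothesis F \<longleftrightarrow> (\<forall>x. span {X x | X. X \<in> iterated_brackets F} = UNIV)"


section \<open>Piecewise constant and absolutely continuous functions of time\<close>

text \<open>The values at the finitely many breakpoints are arbitrary.\<close>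

definition piecewise_constant_on :: "real \<Rightarrow> real \<Rightarrow> (real \<Rightarrow> 'a) \<Rightarrow> bool" where
  "piecewise_constant_on a b f \<longleftrightarrow>
     (\<exists>S. finite S \<and> (\<forall>c d. {c<..<d} \<subseteq> {a..b} - S \<longrightarrow> f constant_on {c<..<d}))"

text \<open>The usual \<open>\<epsilon>\<close>-\<open>\<delta>\<close> definition; \<open>D division_of \<Union>D\<close> says that \<open>D\<close> is a finite family of
  compact intervals with pairwise disjoint interiors.\<close>

definition abs_continuous_on :: "real \<Rightarrow> real \<Rightarrow> (real \<Rightarrow> 'a::real_normed_vector) \<Rightarrow> bool" where
  "abs_continuous_on a b f \<longleftrightarrow>
     (\<forall>\<epsilon>>0. \<exists>\<delta>>0. \<forall>D. D division_of \<Union>D \<and> \<Union>D \<subseteq> {a..b} \<and> (\<Sum>I\<in>D. Sup I - Inf I) < \<delta>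
        \<longrightarrow> (\<Sum>I\<in>D. norm (f (Sup I) - f (Inf I))) < \<epsilon>)"


section \<open>Delayed relays and the controlled system\<close>

definition relay_compatible :: "real \<Rightarrow> real \<Rightarrow> real \<Rightarrow> real \<Rightarrow> bool" where
  "relay_compatible a b s \<zeta> \<longleftrightarrow> s = 1 \<and> \<zeta> \<ge> a \<or> s = -1 \<and> \<zeta> \<le> b"

text \<open>The outputs of all relays form a mode \<open>\<sigma>\<close>: \<open>\<sigma> j i\<close> is the output of the relay \<open>h\<^sub>i\<close> acting
  on the input \<open>z \<bullet> \<xi> j\<close>. Only the indices \<open>i \<in> {1..k}\<close> are meaningful.\<close>

type_synonym 'm mode = "'m \<Rightarrow> nat \<Rightarrow> real"

definition mode_compatible ::
    "('m \<Rightarrow> 'a::real_inner) \<Rightarrow> nat \<Rightarrow> 'm mode \<Rightarrow> 'a \<Rightarrow> bool" where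
  "mode_compatible \<xi> k \<sigma> x \<longleftrightarrow>
     (\<forall>j. \<forall>i\<in>{1..k}. relay_compatible (-1 + real i / real k) (real i / real k) (\<sigma> j i) (x \<bullet> \<xi> j))"

definition relay_mean :: "nat \<Rightarrow> (nat \<Rightarrow> real) \<Rightarrow> real" where
  "relay_mean k s = (1 / real k) * (\<Sum>i=1..k. s i)"

definition mode_field ::
    "('m::finite \<Rightarrow> real \<Rightarrow> 'a \<Rightarrow> 'a::real_inner) \<Rightarrow> nat \<Rightarrow> 'm mode \<Rightarrow> ('m \<Rightarrow> real) \<Rightarrow> 'a \<Rightarrow> 'a" where
  "mode_field g k \<sigma> v x = (\<Sum>j\<in>UNIV. v j *\<^sub>R g j (relay_mean k (\<sigma> j)) x)"

text \<open>Relay \<open>(j, i)\<close> is forced to cross its threshold at the point \<open>x\<close> in the mode \<open>\<sigma>\<close> under the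
  control value \<open>v\<close>: the trajectory that starts at \<open>x\<close> and keeps moving in this mode violates the
  threshold at times arbitrarily close to the starting time.\<close>

definition forced_crossing ::
    "('m::finite \<Rightarrow> real \<Rightarrow> 'a \<Rightarrow> 'a::real_inner) \<Rightarrow> ('m \<Rightarrow> 'a) \<Rightarrow> nat
      \<Rightarrow> ('m \<Rightarrow> real) \<Rightarrow> 'a \<Rightarrow> 'm mode \<Rightarrow> 'm \<Rightarrow> nat \<Rightarrow> bool" where
  "forced_crossing g \<xi> k v x \<sigma> j i \<longleftrightarrow>
     (\<exists>\<delta>>0. \<exists>y. y 0 = x \<and>
        (\<forall>s\<in>{0..\<delta>}. (y has_vector_derivative mode_field g k \<sigma> v (y s)) (at s within {0..\<delta>})) \<and>
        (\<exists>\<^sub>F s in at_right 0. \<sigma> j i = 1 \<and> y s \<bullet> \<xi> j < -1 + real i / real k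
                            \<or> \<sigma> j i = -1 \<and> y s \<bullet> \<xi> j > real i / real k))"

definition switch_mode ::
    "('m::finite \<Rightarrow> real \<Rightarrow> 'a \<Rightarrow> 'a::real_inner) \<Rightarrow> ('m \<Rightarrow> 'a) \<Rightarrow> nat
      \<Rightarrow> ('m \<Rightarrow> real) \<Rightarrow> 'a \<Rightarrow> 'm mode \<Rightarrow> 'm mode" where
  "switch_mode g \<xi> k v x \<sigma> =
     (\<lambda>j i. if i \<in> {1..k} \<and> forced_crossing g \<xi> k v x \<sigma> j i then - \<sigma> j i else \<sigma> j i)"

text \<open>Convention: \<open>h t\<close> is the mode in which the system arrives at time \<open>t\<close>, so \<open>h\<close> is
  left-continuous and \<open>h 0\<close> is the initial mode, which may be left immediately. At time \<open>t\<close> all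
  relays that are forced to cross in the current mode switch. If this makes further relays cross in
  the new mode, then these switch as well, at the same time \<open>t\<close>, and so on; the system continues
  with the first mode in which no relay is forced to cross. Since the two thresholds of a relay
  differ, no relay switches twice at the same time. Crossings are tested with the control value
  \<open>v\<close> that is in force immediately after \<open>t\<close>.\<close>

definition relay_solution ::
    "('m::finite \<Rightarrow> real \<Rightarrow> 'a \<Rightarrow> 'a::real_inner) \<Rightarrow> ('m \<Rightarrow> 'a) \<Rightarrow> nat \<Rightarrow> real
      \<Rightarrow> ('m \<Rightarrow> real \<Rightarrow> real) \<Rightarrow> (real \<Rightarrow> 'a) \<Rightarrow> (real \<Rightarrow> 'm mode) \<Rightarrow> bool" where
  "relay_solution g \<xi> k T u z h \<longleftrightarrow>
     abs_continuous_on 0 T z \<and>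
     piecewise_constant_on 0 T h \<and>
     (\<forall>t\<in>{0<..T}. \<forall>\<^sub>F s in at_left t. h s = h t) \<and>
     (\<forall>t\<in>{0..T}. mode_compatible \<xi> k (h t) (z t)) \<and>
     (\<forall>c d. {c<..<d} \<subseteq> {0..T} \<and> h constant_on {c<..<d} \<and> (\<forall>j. u j constant_on {c<..<d}) \<longrightarrow>
        (\<forall>t\<in>{c<..<d}. (z has_vector_derivative mode_field g k (h t) (\<lambda>j. u j t) (z t)) (at t))) \<and>
     (\<forall>t\<in>{0..<T}. \<forall>v. (\<forall>\<^sub>F s in at_right t. (\<lambda>j. u j s) = v) \<longrightarrow>
        (\<exists>N \<sigma>. \<sigma> = (switch_mode g \<xi> k v (z t) ^^ N) (h t) \<and>
               switch_mode g \<xi> k v (z t) \<sigma> = \<sigma> \<and>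
               (\<forall>\<^sub>F s in at_right t. h s = \<sigma>)))"

end

theory Submission
  imports Defs
begin

text \<open>Within a fixed mode the system is driftless and symmetric, so Chow's theorem applies in the open
  convex region where no relay is at its threshold. Chow's theorem is proved without differentiating
  flows in the initial point: after a cutoff, the flow of \<open>[X, Y]\<close> is a uniform limit of \<open>N\<close>-fold
  compositions of commutators of flows of \<open>X\<close> and \<open>Y\<close>, hence by induction the flow of every iterated
  bracket is a uniform limit of continuous attainable maps; composing along a spanning set of brackets
  gives a continuous attainable map close to the identity, which covers a neighbourhood by Brouwer's
  fixed point theorem.

  If the initial point lies on the boundary of its region, a Chow path off the active face is followed
  until it leaves the face: a relay that switches there becomes inactive, because its two thresholds
  differ, and otherwise some constraint becomes strict, so the number of active constraints drops.
  Thereafter relays can be flipped one at a time: on each face of the region some field is transversal,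
  for otherwise all brackets would be tangent to the face. Once for every \<open>j\<close> all relays on the input
  \<open>z \<bullet> \<xi> j\<close> agree with the sign of \<open>B \<bullet> \<xi> j\<close>, the target \<open>B\<close> is in the interior of the current region.\<close>

section \<open>Calculus of smooth maps\<close>

text \<open>Relay outputs enter the dynamics only as constant arguments of the fields, so the Chow
  hypothesis is available for each mode separately. The obstacle is contact with thresholds: the
  fields are merely smooth, so a trajectory may touch a threshold tangentially and violate it at
  times that accumulate at the contact, and no finite set of derivatives decides what the relay
  does. Inside a region this never arises, and a face is crossed only where a single relay is at its
  threshold and the chosen field is transversal. Linear independence of the \<open>\<xi> j\<close>
  provides such faces, because the inputs can be prescribed independently. Only an initial point on
  the boundary leads to uncontrolled contacts; there a descent on the number of active constraints
  replaces their analysis.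

  The cutoff makes flows global in time and all flow estimates uniform in the point, so that errors
  of many composed steps can be added. Control values of either sign are admissible, which makes
  attainability symmetric and lets a local covering statement spread over connected sets.\<close>

lemma C_diff_SucI:
  assumes "\<And>x. (f has_derivative f' x) (at x)" and "\<And>v. C_diff r (\<lambda>x. f' x v)"
  shows "C_diff (Suc r) f"
proof -
  have "frechet_derivative f (at x) = f' x" for x
    using frechet_derivative_at[OF assms(1)] by simp
  then show ?thesis
    using assms by (auto simp: differentiable_def)
qed

lemma C_diff_has_derivative:
  "C_diff (Suc r) f \<Longrightarrow> (f has_derivative frechet_derivative f (at x)) (at x)"
  by (simp add: frechet_derivative_works[symmetric])

lemma C_diff_SucD: "C_diff (Suc r) f \<Longrightarrow> C_diff r f"
proof (induction r arbitrary: f)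
  case 0
  then show ?case
    using differentiable_imp_continuous_on[of f UNIV]
    by (auto simp: differentiable_on_def)
next
  case (Suc r)
  then show ?case by simp
qed

lemma C_diff_continuous: "C_diff r f \<Longrightarrow> continuous_on UNIV f"
  by (induction r) (use C_diff_SucD in auto)

lemma C_diff_const: "C_diff r (\<lambda>x. c)"
proof (induction r arbitrary: c)
  case (Suc r)
  show ?case by (rule C_diff_SucI[where f'="\<lambda>x v. 0"]) (auto simp: Suc)
qed simp

lemma C_diff_bounded_linear:
  assumes "bounded_linear L" shows "C_diff r L"
proof (cases r)
  case 0
  then show ?thesis using assms by (simp add: linear_continuous_on)
next
  case (Suc n)
  show ?thesis unfolding Suc
    by (rule C_diff_SucI[where f'="\<lambda>x. L"])
       (auto simp: C_diff_const bounded_linear_imp_has_derivative assms)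
qed

lemma C_diff_compose_linear:
  assumes L: "bounded_linear L" and f: "C_diff r f" shows "C_diff r (\<lambda>x. L (f x))"
  using f
proof (induction r arbitrary: f)
  case 0
  then show ?case
    using linear_continuous_on[OF L] continuous_on_compose2 by (metis C_diff.simps(1) subset_UNIV)
next
  case (Suc r)
  show ?case
    by (rule C_diff_SucI[where f'="\<lambda>x v. L (frechet_derivative f (at x) v)"])
       (use Suc in \<open>auto intro!: bounded_linear.has_derivative[OF L] C_diff_has_derivative[of r]\<close>)
qed

lemma C_diff_add:
  assumes "C_diff r f" "C_diff r g" shows "C_diff r (\<lambda>x. f x + g x)"
  using assms
proof (induction r arbitrary: f g)
  case 0
  then show ?case by (auto intro: continuous_on_add)
next
  case (Suc r)
  show ?case
    by (rule C_diff_SucI[where f'="\<lambda>x v. frechet_derivative f (at x) v + frechet_derivative g (at x) v"])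
       (use Suc in \<open>auto intro!: has_derivative_add C_diff_has_derivative[of r]\<close>)
qed

lemma C_diff_sum:
  assumes "\<And>i. i \<in> I \<Longrightarrow> C_diff r (f i)" shows "C_diff r (\<lambda>x. \<Sum>i\<in>I. f i x)"
  using assms by (induction I rule: infinite_finite_induct) (auto simp: C_diff_const C_diff_add)

lemma C_diff_scaleR:
  fixes f :: "'a::real_normed_vector \<Rightarrow> real"
  assumes "C_diff r f" "C_diff r g" shows "C_diff r (\<lambda>x. f x *\<^sub>R g x)"
  using assms
proof (induction r arbitrary: f g)
  case 0
  then show ?case by (auto intro: continuous_on_scaleR)
next
  case (Suc r)
  show ?case
    by (rule C_diff_SucI[where f'="\<lambda>x v. f x *\<^sub>R frechet_derivative g (at x) v
                                          + frechet_derivative f (at x) v *\<^sub>R g x"])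
       (use Suc.prems Suc.IH C_diff_SucD[OF Suc.prems(1)] C_diff_SucD[OF Suc.prems(2)] in
         \<open>auto intro!: has_derivative_scaleR C_diff_has_derivative[of r] C_diff_add\<close>)
qed

lemma smoothD: "smooth f \<Longrightarrow> C_diff r f"
  by (simp add: smooth_def)

lemma smooth_continuous: "smooth f \<Longrightarrow> continuous_on UNIV f"
  using smoothD C_diff_continuous by blast

lemma smooth_has_derivative:
  "smooth f \<Longrightarrow> (f has_derivative frechet_derivative f (at x)) (at x)"
  using smoothD C_diff_has_derivative by blast

lemma smooth_frechet_derivative: "smooth f \<Longrightarrow> smooth (\<lambda>x. frechet_derivative f (at x) v)"
  unfolding smooth_def using C_diff.simps(2) by blast

lemma smooth_const: "smooth (\<lambda>x. c)"
  by (simp add: smooth_def C_diff_const)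

lemma smooth_bounded_linear: "bounded_linear L \<Longrightarrow> smooth L"
  by (simp add: smooth_def C_diff_bounded_linear)

lemma smooth_compose_linear: "bounded_linear L \<Longrightarrow> smooth f \<Longrightarrow> smooth (\<lambda>x. L (f x))"
  by (simp add: smooth_def C_diff_compose_linear)

lemma smooth_add: "smooth f \<Longrightarrow> smooth g \<Longrightarrow> smooth (\<lambda>x. f x + g x)"
  by (simp add: smooth_def C_diff_add)

lemma smooth_sum: "(\<And>i. i \<in> I \<Longrightarrow> smooth (f i)) \<Longrightarrow> smooth (\<lambda>x. \<Sum>i\<in>I. f i x)"
  by (simp add: smooth_def C_diff_sum)

lemma smooth_scaleR:
  fixes f :: "'a::real_normed_vector \<Rightarrow> real"
  shows "smooth f \<Longrightarrow> smooth g \<Longrightarrow> smooth (\<lambda>x. f x *\<^sub>R g x)"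
  by (simp add: smooth_def C_diff_scaleR)

lemma smooth_diff: "smooth f \<Longrightarrow> smooth g \<Longrightarrow> smooth (\<lambda>x. f x - g x)"
  using smooth_add[of f "\<lambda>x. - g x"] smooth_compose_linear[of uminus g]
  by (simp add: bounded_linear_minus bounded_linear_ident)

section \<open>Derivatives along fields and smoothness of brackets\<close>

definition lie_deriv ::
    "('a::real_normed_vector \<Rightarrow> 'a) \<Rightarrow> ('a \<Rightarrow> 'b::real_normed_vector) \<Rightarrow> 'a \<Rightarrow> 'b" where
  "lie_deriv X f x = frechet_derivative f (at x) (X x)"

text \<open>On vector fields \<open>lie_deriv\<close> is the flat covariant derivative, not the Lie
  derivative of a field; the bracket is its antisymmetrisation. In this form the bracket appears as
  the difference of the second-order terms of two flows composed in the two orders.\<close>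

lemma lie_bracket_lie_deriv: "lie_bracket X Y = (\<lambda>x. lie_deriv X Y x - lie_deriv Y X x)"
  by (simp add: lie_bracket_def lie_deriv_def fun_eq_iff)

text \<open>The direction \<open>X x\<close> varies with the point, while \<open>smooth\<close>
  speaks of derivatives in fixed directions; expanding \<open>X x\<close> in the basis reduces one
  to the other.\<close>

lemma smooth_lie_deriv:
  fixes X :: "'a::euclidean_space \<Rightarrow> 'a"
  assumes "smooth f" "smooth X" shows "smooth (lie_deriv X f)"
proof -
  have "lie_deriv X f = (\<lambda>x. \<Sum>b\<in>Basis. (X x \<bullet> b) *\<^sub>R frechet_derivative f (at x) b)"
  proof
    fix x
    interpret D: bounded_linear "frechet_derivative f (at x)"
      using smooth_has_derivative[OF assms(1)] has_derivative_bounded_linear by blast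
    have "lie_deriv X f x = frechet_derivative f (at x) (\<Sum>b\<in>Basis. (X x \<bullet> b) *\<^sub>R b)"
      by (simp add: lie_deriv_def euclidean_representation)
    then show "lie_deriv X f x = (\<Sum>b\<in>Basis. (X x \<bullet> b) *\<^sub>R frechet_derivative f (at x) b)"
      by (simp add: D.sum D.scaleR)
  qed
  moreover have "smooth (\<lambda>x. X x \<bullet> b)" for b
    using smooth_compose_linear[OF bounded_linear_inner_left assms(2)] by simp
  ultimately show ?thesis
    by (auto intro!: smooth_sum smooth_scaleR smooth_frechet_derivative assms(1))
qed

lemma smooth_lie_bracket:
  fixes X :: "'a::euclidean_space \<Rightarrow> 'a"
  shows "smooth X \<Longrightarrow> smooth Y \<Longrightarrow> smooth (lie_bracket X Y)"
  unfolding lie_bracket_lie_deriv by (intro smooth_diff smooth_lie_deriv)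

lemma lie_bracket_cong_open:
  assumes "open S" "x \<in> S" "\<And>y. y \<in> S \<Longrightarrow> X y = X' y" "\<And>y. y \<in> S \<Longrightarrow> Y y = Y' y"
  shows "lie_bracket X Y x = lie_bracket X' Y' x"
proof -
  have eq: "frechet_derivative f (at x) = frechet_derivative f' (at x)"
    if *: "\<And>y. y \<in> S \<Longrightarrow> f y = f' y" for f f' :: "'a \<Rightarrow> 'a"
  proof -
    \<comment> \<open>The two functions have the same derivative candidates, so the choice operator
      inside \<open>frechet_derivative\<close> returns the same map even at a point where neither is
      differentiable.\<close>
    have "(f has_derivative D) (at x) = (f' has_derivative D) (at x)" for D
      using has_derivative_transform_within_open[OF _ assms(1,2), of f D UNIV f']
        has_derivative_transform_within_open[OF _ assms(1,2), of f' D UNIV f] * by auto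
    then show ?thesis by (simp add: frechet_derivative_def)
  qed
  show ?thesis
    unfolding lie_bracket_def using eq[of X X'] eq[of Y Y'] assms by simp
qed

subsection \<open>A smooth cutoff function\<close>

text \<open>Carrying the factor \<open>1 / x ^ n\<close> keeps the family closed under
  differentiation up to linear combinations: derivatives of \<open>exp (- (1 / x))\<close> only
  raise \<open>n\<close>.\<close>

definition flat_exp :: "nat \<Rightarrow> real \<Rightarrow> real" where
  "flat_exp n x = (if x > 0 then exp (- (1 / x)) / x ^ n else 0)"

lemma flat_exp_limit: "(flat_exp n \<longlongrightarrow> 0) (at 0)"
proof -
  have "((\<lambda>x. inverse x ^ n / exp (inverse x)) \<longlongrightarrow> (0::real)) (at_right 0)"
    by (rule filterlim_compose[OF tendsto_power_div_exp_0 filterlim_inverse_at_top_right])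
  then have "(flat_exp n \<longlongrightarrow> 0) (at_right 0)"
    by (rule Lim_transform_eventually)
       (auto simp: eventually_at_right_less flat_exp_def exp_minus field_simps
             intro: eventually_at_right_less[THEN eventually_mono])
  moreover have "(flat_exp n \<longlongrightarrow> 0) (at_left 0)"
    by (rule tendsto_eventually)
       (auto simp: flat_exp_def eventually_at_left_field intro: exI[of _ "-1"])
  ultimately show ?thesis by (simp add: filterlim_split_at_real)
qed

lemma flat_exp_deriv:
  "(flat_exp n has_real_derivative flat_exp (n + 2) x - real n * flat_exp (n + 1) x) (at x)"
proof -
  consider "x > 0" | "x < 0" | "x = 0" by linarith
  then show ?thesis
  proof cases
    case 1
    have "((\<lambda>x. exp (- (1 / x)) / x ^ n) has_real_derivative
        flat_exp (n + 2) x - real n * flat_exp (n + 1) x) (at x)"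
      using 1 by (auto intro!: derivative_eq_intros simp: flat_exp_def)
         (cases n; simp add: field_simps power2_eq_square)
    then show ?thesis
      by (rule has_field_derivative_transform_within_open[where S="{0<..}"])
         (use 1 in \<open>auto simp: flat_exp_def\<close>)
  next
    case 2
    have "((\<lambda>x. 0) has_real_derivative 0) (at x)" by simp
    then have "(flat_exp n has_real_derivative 0) (at x)"
      by (rule has_field_derivative_transform_within_open[where S="{..<0}"])
         (use 2 in \<open>auto simp: flat_exp_def\<close>)
    with 2 show ?thesis by (simp add: flat_exp_def)
  next
    case 3
    \<comment> \<open>The difference quotient at 0 is itself the next member of the family, which
      tends to 0.\<close>
    have "(\<lambda>h. (flat_exp n (0 + h) - flat_exp n 0) / h) = flat_exp (n + 1)"
      by (auto simp: flat_exp_def fun_eq_iff)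
    then have "(flat_exp n has_real_derivative 0) (at 0)"
      using flat_exp_limit[of "n + 1"] by (simp add: DERIV_def)
    with 3 show ?thesis by (simp add: flat_exp_def)
  qed
qed

lemma C_diff_flat_exp:
  fixes f :: "'a::real_normed_vector \<Rightarrow> real"
  assumes "C_diff r f" shows "C_diff r (\<lambda>x. flat_exp n (f x))"
  using assms
proof (induction r arbitrary: n)
  case 0
  have "continuous_on UNIV (flat_exp n)"
    using flat_exp_deriv DERIV_isCont continuous_at_imp_continuous_on by blast
  with 0 show ?case by (auto intro: continuous_on_compose2)
next
  case (Suc r)
  define d where "d x = flat_exp (n + 2) (f x) - real n * flat_exp (n + 1) (f x)" for x
  have fr: "C_diff r f" using C_diff_SucD[OF Suc.prems] .
  have 1: "C_diff r (\<lambda>x. real n * flat_exp (n + 1) (f x))"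
    by (rule C_diff_compose_linear[OF bounded_linear_mult_right Suc.IH[OF fr]])
  have 2: "C_diff r (\<lambda>x. - (real n * flat_exp (n + 1) (f x)))"
    by (rule C_diff_compose_linear[OF bounded_linear_minus[OF bounded_linear_ident] 1])
  have d: "C_diff r d"
    using C_diff_add[OF Suc.IH[OF fr, of "n + 2"] 2] unfolding d_def by simp
  show ?case
  proof (rule C_diff_SucI[where f'="\<lambda>x v. d x * frechet_derivative f (at x) v"])
    fix x
    have "(flat_exp n has_derivative (\<lambda>v. d x * v)) (at (f x))"
      using flat_exp_deriv[of n "f x"] by (simp only: has_field_derivative_def d_def)
    from has_derivative_compose[OF C_diff_has_derivative[OF Suc.prems] this]
    show "((\<lambda>x. flat_exp n (f x)) has_derivative (\<lambda>v. d x * frechet_derivative f (at x) v)) (at x)" .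
  next
    fix v
    have "C_diff r (\<lambda>x. frechet_derivative f (at x) v)" using Suc.prems by simp
    from C_diff_scaleR[OF d this]
    show "C_diff r (\<lambda>x. d x * frechet_derivative f (at x) v)" by simp
  qed
qed

lemma smooth_flat_exp:
  fixes f :: "'a::real_normed_vector \<Rightarrow> real"
  shows "smooth f \<Longrightarrow> smooth (\<lambda>x. flat_exp n (f x))"
  by (simp add: smooth_def C_diff_flat_exp)

lemma smooth_inner_self: "smooth (\<lambda>x::'a::euclidean_space. (x - a) \<bullet> (x - a))"
proof -
  have l: "smooth (\<lambda>x::'a. x - a)"
    by (intro smooth_diff smooth_const smooth_bounded_linear[OF bounded_linear_ident])
  have b: "smooth (\<lambda>x. (x - a) \<bullet> b)" for b
    using smooth_compose_linear[OF bounded_linear_inner_left l] by simp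
  have "(\<lambda>x. (x - a) \<bullet> (x - a)) = (\<lambda>x. \<Sum>b\<in>Basis. ((x - a) \<bullet> b) *\<^sub>R ((x - a) \<bullet> b))"
    by (rule ext, subst euclidean_inner) simp
  moreover have "smooth (\<lambda>x. \<Sum>b\<in>Basis. ((x - a) \<bullet> b) *\<^sub>R ((x - a) \<bullet> b))"
    by (intro smooth_sum smooth_scaleR b)
  ultimately show ?thesis by metis
qed

text \<open>The bump \<open>\<rho>\<close> is not constant on the inner ball; a second flat profile,
  applied to \<open>1 - \<rho> x / c\<close> with \<open>c\<close> the value of
  \<open>\<rho>\<close> at radius \<open>r\<close>, flattens it to 1 wherever \<open>\<rho>\<close>
  exceeds \<open>c\<close>. The factor \<open>exp 1\<close> normalises the result to 0 where
  \<open>\<rho>\<close> vanishes. Positivity on exactly the outer ball later allows division by the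
  cutoff along trajectories.\<close>

lemma smooth_cutoff_exists:
  fixes a :: "'a::euclidean_space"
  assumes "0 < r" "r < R"
  obtains \<psi> :: "'a \<Rightarrow> real" where "smooth \<psi>" "\<And>x. x \<in> ball a r \<Longrightarrow> \<psi> x = 1"
    "\<And>x. \<psi> x > 0 \<longleftrightarrow> x \<in> ball a R" "\<And>x. x \<notin> ball a R \<Longrightarrow> \<psi> x = 0"
proof -
  define \<rho> where "\<rho> x = flat_exp 0 (R\<^sup>2 - (x - a) \<bullet> (x - a))" for x
  define c where "c = flat_exp 0 (R\<^sup>2 - r\<^sup>2)"
  define \<psi> where "\<psi> x = 1 - exp 1 * flat_exp 0 (1 - \<rho> x / c)" for x
  have mono: "flat_exp 0 x < flat_exp 0 y" if "x < y" "y > 0" for x y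
    using that by (auto simp: flat_exp_def field_simps)
  have rR: "r\<^sup>2 < R\<^sup>2" using assms by (simp add: power_strict_mono)
  then have c: "c > 0" by (simp add: c_def flat_exp_def)
  have e1: "exp 1 * flat_exp 0 1 = 1" by (simp add: flat_exp_def exp_minus)
  have sq: "(x - a) \<bullet> (x - a) = (dist a x)\<^sup>2" for x
    by (simp add: dist_norm dot_square_norm norm_minus_commute)
  have "smooth \<rho>"
    unfolding \<rho>_def by (intro smooth_flat_exp smooth_diff smooth_const smooth_inner_self)
  then have "smooth (\<lambda>x. \<rho> x / c)"
    by (rule smooth_compose_linear[OF bounded_linear_divide])
  then have sm: "smooth \<psi>"
    unfolding \<psi>_def
    by (intro smooth_diff smooth_const smooth_flat_exp smooth_compose_linear[OF bounded_linear_mult_right])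
  have in_r: "\<psi> x = 1" if "x \<in> ball a r" for x
  proof -
    have "(dist a x)\<^sup>2 < r\<^sup>2" using that by (simp add: power_strict_mono)
    then have "c < \<rho> x" unfolding c_def \<rho>_def sq using rR by (intro mono) auto
    then have "1 - \<rho> x / c < 0" using c by (simp add: field_simps)
    then show ?thesis by (simp add: \<psi>_def flat_exp_def)
  qed
  have in_R: "\<psi> x > 0" if "x \<in> ball a R" for x
  proof -
    have "(dist a x)\<^sup>2 < R\<^sup>2" using that by (simp add: power_strict_mono)
    then have "0 < \<rho> x" unfolding \<rho>_def sq by (simp add: flat_exp_def)
    then have "1 - \<rho> x / c < 1" using c by (simp add: field_simps)
    then have "flat_exp 0 (1 - \<rho> x / c) < flat_exp 0 1" by (intro mono) auto
    then have "exp 1 * flat_exp 0 (1 - \<rho> x / c) < exp 1 * flat_exp 0 (1::real)" by simp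
    then show ?thesis by (simp add: \<psi>_def e1)
  qed
  have out: "\<psi> x = 0" if "x \<notin> ball a R" for x
  proof -
    have "R\<^sup>2 \<le> (dist a x)\<^sup>2" using that assms by (simp add: power_mono)
    then have "\<rho> x = 0" unfolding \<rho>_def sq by (simp add: flat_exp_def)
    then show ?thesis by (simp add: \<psi>_def e1)
  qed
  show ?thesis
    using that[of \<psi>] sm in_r in_R out by fastforce
qed

subsection \<open>Compactly supported maps\<close>

definition test_map :: "('a::euclidean_space \<Rightarrow> 'b::euclidean_space) \<Rightarrow> bool" where
  "test_map f \<longleftrightarrow> smooth f \<and> (\<exists>K. compact K \<and> (\<forall>x. x \<notin> K \<longrightarrow> f x = 0))"

lemma test_map_smooth: "test_map f \<Longrightarrow> smooth f"
  by (simp add: test_map_def)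

lemma frechet_derivative_zero_outside:
  assumes "closed K" "\<And>y. y \<notin> K \<Longrightarrow> f y = 0" "x \<notin> K"
  shows "frechet_derivative f (at x) v = 0"
proof -
  have "((\<lambda>y. 0) has_derivative (\<lambda>v. 0)) (at x)" by simp
  then have "(f has_derivative (\<lambda>v. 0)) (at x)"
    by (rule has_derivative_transform_within_open[where s="-K"]) (use assms in auto)
  then show ?thesis using frechet_derivative_at by metis
qed

lemma test_map_lie_deriv:
  assumes "test_map f" "test_map X" shows "test_map (lie_deriv X f)"
proof -
  obtain K where K: "compact K" "\<And>x. x \<notin> K \<Longrightarrow> f x = 0"
    using assms by (auto simp: test_map_def)
  have "lie_deriv X f x = 0" if "x \<notin> K" for x
    unfolding lie_deriv_def
    using frechet_derivative_zero_outside[OF compact_imp_closed[OF K(1)] K(2) that] by simp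
  then show ?thesis
    using K(1) assms smooth_lie_deriv by (auto simp: test_map_def)
qed

lemma test_map_diff:
  assumes "test_map f" "test_map g" shows "test_map (\<lambda>x. f x - g x)"
proof -
  obtain K K' where "compact K" "\<And>x. x \<notin> K \<Longrightarrow> f x = 0" "compact K'" "\<And>x. x \<notin> K' \<Longrightarrow> g x = 0"
    using assms by (auto simp: test_map_def)
  then have "compact (K \<union> K')" "\<forall>x. x \<notin> K \<union> K' \<longrightarrow> f x - g x = 0" by auto
  then show ?thesis using assms smooth_diff unfolding test_map_def by blast
qed

lemma test_map_lie_bracket: "test_map X \<Longrightarrow> test_map Y \<Longrightarrow> test_map (lie_bracket X Y)"
  unfolding lie_bracket_lie_deriv by (intro test_map_diff test_map_lie_deriv)

lemma test_map_cutoff: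
  assumes "smooth \<psi>" "\<And>x. x \<notin> ball a R \<Longrightarrow> \<psi> x = (0::real)" "smooth X"
  shows "test_map (\<lambda>x. \<psi> x *\<^sub>R X x)"
  using assms smooth_scaleR[OF assms(1,3)] unfolding test_map_def
  by (metis ball_subset_cball compact_cball in_mono scale_eq_0_iff)

lemma test_map_bounded:
  assumes "test_map f" obtains M where "M \<ge> 0" "\<And>x. norm (f x) \<le> M"
proof -
  obtain K where K: "compact K" "\<And>x. x \<notin> K \<Longrightarrow> f x = 0"
    using assms by (auto simp: test_map_def)
  have "compact (f ` K)"
    using K(1) smooth_continuous[OF test_map_smooth[OF assms]]
    by (meson compact_continuous_image continuous_on_subset subset_UNIV)
  then obtain M where M: "\<And>x. x \<in> K \<Longrightarrow> norm (f x) \<le> M"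
    using compact_imp_bounded bounded_iff by (metis imageI)
  show ?thesis
    by (rule that[of "max M 0"]) (use M K(2) in \<open>auto simp: le_max_iff_disj\<close>)
qed

text \<open>Partial derivatives are again compactly supported, hence bounded; the sum of their
  bounds over the basis bounds the operator norm, and the mean value inequality applies on the whole
  space.\<close>

lemma test_map_lipschitz:
  assumes "test_map f" obtains L where "L \<ge> 0" "\<And>x y. norm (f x - f y) \<le> L * norm (x - y)"
proof -
  have sm: "smooth f" using assms test_map_smooth by blast
  obtain K where K: "compact K" "\<And>x. x \<notin> K \<Longrightarrow> f x = 0"
    using assms by (auto simp: test_map_def)
  have tm: "test_map (\<lambda>x. frechet_derivative f (at x) b)" for b
    unfolding test_map_def
    using smooth_frechet_derivative[OF sm, of b]
      frechet_derivative_zero_outside[where f=f and v=b, OF compact_imp_closed[OF K(1)] K(2)] K(1) by auto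
  have "\<exists>M\<ge>0. \<forall>x. norm (frechet_derivative f (at x) b) \<le> M" for b
    by (rule test_map_bounded[OF tm[of b]]) auto
  then have "\<exists>M. \<forall>b. M b \<ge> 0 \<and> (\<forall>x. norm (frechet_derivative f (at x) b) \<le> M b)"
    by (intro choice) blast
  then obtain M where M: "\<And>b x. norm (frechet_derivative f (at x) b) \<le> M b" "\<And>b. M b \<ge> 0"
    by blast
  define L where "L = (\<Sum>b\<in>Basis. M b)"
  have on: "onorm (frechet_derivative f (at x)) \<le> L" for x
  proof (rule onorm_bound)
    show "0 \<le> L" unfolding L_def by (intro sum_nonneg M)
    fix v :: 'a
    interpret D: bounded_linear "frechet_derivative f (at x)"
      using smooth_has_derivative[OF sm] has_derivative_bounded_linear by blast
    have "frechet_derivative f (at x) v = frechet_derivative f (at x) (\<Sum>b\<in>Basis. (v \<bullet> b) *\<^sub>R b)"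
      by (simp add: euclidean_representation)
    also have "\<dots> = (\<Sum>b\<in>Basis. (v \<bullet> b) *\<^sub>R frechet_derivative f (at x) b)"
      by (simp add: D.sum D.scaleR)
    also have "norm \<dots> \<le> (\<Sum>b\<in>Basis. M b * norm v)"
      by (rule sum_norm_le)
         (auto intro!: mult_mono M simp: mult.commute[of "M _"] Basis_le_norm)
    finally show "norm (frechet_derivative f (at x) v) \<le> L * norm v"
      by (simp add: L_def sum_distrib_right)
  qed
  show ?thesis
  proof (rule that)
    show "0 \<le> L" unfolding L_def by (intro sum_nonneg M)
    show "norm (f x - f y) \<le> L * norm (x - y)" for x y
      by (rule differentiable_bound[OF convex_UNIV])
         (use smooth_has_derivative[OF sm] on in auto)
  qed
qed

section \<open>Flows of bounded Lipschitz fields\<close>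

text \<open>The squared distance weighted by \<open>exp (- 2 * L * t)\<close> is nonincreasing.
  Squaring avoids differentiating the norm where the trajectories meet. Only a Lipschitz bound on a
  set containing both trajectories enters, so the estimate serves globally as well as inside a
  ball.\<close>

lemma gronwall_dist:
  fixes y z :: "real \<Rightarrow> 'a::euclidean_space"
  assumes "0 \<le> T" and L: "\<And>p q. p \<in> S \<Longrightarrow> q \<in> S \<Longrightarrow> norm (X p - X q) \<le> L * norm (p - q)"
    and y: "\<And>t. t \<in> {0..T} \<Longrightarrow> (y has_vector_derivative X (y t)) (at t within {0..T})"
    and z: "\<And>t. t \<in> {0..T} \<Longrightarrow> (z has_vector_derivative X (z t)) (at t within {0..T})"
    and S: "\<And>t. t \<in> {0..T} \<Longrightarrow> y t \<in> S" "\<And>t. t \<in> {0..T} \<Longrightarrow> z t \<in> S"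
  shows "norm (y T - z T) \<le> exp (L * T) * norm (y 0 - z 0)"
proof -
  define d where "d t = y t - z t" for t
  define \<nu> where "\<nu> t = exp (- 2 * L * t) * (d t \<bullet> d t)" for t
  define d' where "d' t = X (y t) - X (z t)" for t
  have d: "(d has_vector_derivative d' t) (at t within {0..T})" if "t \<in> {0..T}" for t
    unfolding d_def d'_def by (intro has_vector_derivative_diff y z that)
  have \<nu>: "(\<nu> has_real_derivative exp (- 2 * L * t) * (2 * (d t \<bullet> d' t) - 2 * L * (d t \<bullet> d t)))
      (at t within {0..T})" if "t \<in> {0..T}" for t
  proof -
    have "((\<lambda>t. d t \<bullet> d t) has_real_derivative 2 * (d t \<bullet> d' t)) (at t within {0..T})"
      unfolding has_field_derivative_def
      by (rule has_derivative_eq_rhs[OF has_derivative_inner[OF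
          d[OF that, unfolded has_vector_derivative_def] d[OF that, unfolded has_vector_derivative_def]]])
         (auto simp: fun_eq_iff inner_commute)
    moreover have "((\<lambda>t. exp (- 2 * L * t)) has_real_derivative exp (- 2 * L * t) * (- 2 * L))
        (at t within {0..T})"
      by (auto intro!: derivative_eq_intros)
    ultimately have "(\<nu> has_real_derivative exp (- 2 * L * t) * (- 2 * L) * (d t \<bullet> d t)
        + 2 * (d t \<bullet> d' t) * exp (- 2 * L * t)) (at t within {0..T})"
      unfolding \<nu>_def by (intro DERIV_mult)
    then show ?thesis by (rule DERIV_cong) (simp add: algebra_simps)
  qed
  have "\<nu> T \<le> \<nu> 0"
  proof (rule DERIV_nonpos_imp_decreasing_open[OF \<open>0 \<le> T\<close>])
    show "continuous_on {0..T} \<nu>"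
      using DERIV_continuous_on[OF \<nu>] .
    fix t assume t: "0 < t" "t < T"
    have "d t \<bullet> d' t \<le> norm (d t) * norm (d' t)"
      by (rule norm_cauchy_schwarz)
    also have "\<dots> \<le> norm (d t) * (L * norm (d t))"
      unfolding d'_def d_def by (intro mult_left_mono L S) (use t in auto)
    also have "\<dots> = L * (d t \<bullet> d t)"
      by (simp add: dot_square_norm power2_eq_square)
    finally have "exp (- 2 * L * t) * (2 * (d t \<bullet> d' t) - 2 * L * (d t \<bullet> d t)) \<le> 0"
      by (simp add: mult_le_0_iff)
    moreover have "at t within {0..T} = at t"
      using t by (simp add: at_within_Icc_at)
    ultimately show "\<exists>c. (\<nu> has_real_derivative c) (at t) \<and> c \<le> 0"
      using \<nu>[of t] t by auto
  qed
  then have "exp (- 2 * L * T) * (d T \<bullet> d T) \<le> d 0 \<bullet> d 0"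
    by (simp add: \<nu>_def)
  then have "exp (2 * L * T) * (exp (- 2 * L * T) * (d T \<bullet> d T)) \<le> exp (2 * L * T) * (d 0 \<bullet> d 0)"
    by (intro mult_left_mono) auto
  then have "d T \<bullet> d T \<le> exp (2 * L * T) * (d 0 \<bullet> d 0)"
    by (simp add: mult.assoc[symmetric] exp_add[symmetric])
  also have "\<dots> = (exp (L * T) * norm (d 0))\<^sup>2"
    by (simp add: dot_square_norm power_mult_distrib exp_of_nat_mult[symmetric] mult.assoc[symmetric])
  finally show ?thesis
    using power2_le_imp_le[of "norm (d T)" "exp (L * T) * norm (d 0)"]
    by (simp add: d_def dot_square_norm)
qed

subsection \<open>Antiderivatives on the whole line\<close>

text \<open>\<open>integral\<close> over an empty interval is 0, so the two terms together give the
  oriented integral from 0 to \<open>t\<close> for either sign of \<open>t\<close>.\<close>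

definition antideriv :: "(real \<Rightarrow> 'a::banach) \<Rightarrow> real \<Rightarrow> 'a" where
  "antideriv f t = integral {0..t} f - integral {t..0} f"

lemma antideriv_0 [simp]: "antideriv f 0 = 0"
  by (simp add: antideriv_def)

lemma antideriv_deriv:
  fixes f :: "real \<Rightarrow> 'a::banach"
  assumes "continuous_on UNIV f"
  shows "(antideriv f has_vector_derivative f t) (at t)"
proof -
  define a b where "a = - \<bar>t\<bar> - 1" and "b = \<bar>t\<bar> + 1"
  have cont: "continuous_on {c..d} f" for c d using assms continuous_on_subset by blast
  have int: "f integrable_on {c..d}" for c d by (intro integrable_continuous_real cont)
  have eq: "integral {a..s} f - integral {a..0} f = antideriv f s" if "s \<in> {a<..<b}" for s
  proof (cases "s \<ge> 0")
    case True
    have "integral {a..0} f + integral {0..s} f = integral {a..s} f"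
      using that True by (intro Henstock_Kurzweil_Integration.integral_combine int) (auto simp: a_def)
    moreover have "integral {s..0} f = 0" using True by (cases "s = 0") auto
    ultimately show ?thesis by (simp add: antideriv_def algebra_simps)
  next
    case False
    have "integral {a..s} f + integral {s..0} f = integral {a..0} f"
      using that False by (intro Henstock_Kurzweil_Integration.integral_combine int) auto
    then show ?thesis using False by (simp add: antideriv_def algebra_simps)
  qed
  have t: "t \<in> {a<..<b}" by (auto simp: a_def b_def)
  then have "((\<lambda>u. integral {a..u} f) has_vector_derivative f t) (at t within {a..b})"
    by (intro integral_has_vector_derivative cont) auto
  then have "((\<lambda>u. integral {a..u} f) has_vector_derivative f t) (at t)"
    using t by (metis at_within_Icc_at greaterThanLessThan_iff)
  then have "((\<lambda>u. integral {a..u} f - integral {a..0} f) has_vector_derivative f t - 0) (at t)"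
    by (intro has_vector_derivative_diff has_vector_derivative_const)
  then have "((\<lambda>u. integral {a..u} f - integral {a..0} f) has_vector_derivative f t) (at t)" by simp
  then show ?thesis
    by (rule has_vector_derivative_transform_within_open[where S="{a<..<b}"]) (use t eq in auto)
qed

lemma has_vector_derivative_affine:
  assumes "(y has_vector_derivative d) (at (c * t + s))"
  shows "((\<lambda>t. y (c * t + s)) has_vector_derivative c *\<^sub>R d) (at t)"
proof -
  have "((\<lambda>t. c * t + s) has_vector_derivative c) (at t)"
    by (auto intro!: derivative_eq_intros)
  from vector_diff_chain_at[OF this assms] show ?thesis by (simp add: o_def)
qed

text \<open>Integration gains the factor \<open>1 / c\<close> against the weight
  \<open>exp (c * \<bar>t\<bar>)\<close>; this is the source of the contraction constant of the
  Picard operator. Negative times follow by reflection.\<close>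

lemma exp_growth_bound:
  fixes F :: "real \<Rightarrow> 'a::real_normed_vector"
  assumes F: "\<And>t. (F has_vector_derivative f t) (at t)" and "F 0 = 0" "0 < c" "0 \<le> A"
    and f: "\<And>t. norm (f t) \<le> A * exp (c * \<bar>t\<bar>)"
  shows "norm (F t) \<le> A / c * exp (c * \<bar>t\<bar>)"
proof -
  have *: "norm (F t) \<le> A / c * exp (c * t)"
    if F: "\<And>t. (F has_vector_derivative f t) (at t)" "F 0 = 0" "t \<ge> 0"
      and f: "\<And>t. norm (f t) \<le> A * exp (c * \<bar>t\<bar>)" for F f :: "real \<Rightarrow> 'a" and t
  proof (cases "t = 0")
    case True
    then show ?thesis using that assms(3,4) by simp
  next
    case False
    have "norm (F t - F 0) \<le> A / c * exp (c * t) - A / c * exp (c * 0)"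
    proof (rule differentiable_bound_general[where f'=f and \<phi>'="\<lambda>s. A * exp (c * s)"])
      show "0 < t" using False that by simp
      show "continuous_on {0..t} F"
        using F(1) by (meson continuous_at_imp_continuous_on has_vector_derivative_continuous)
      show "continuous_on {0..t} (\<lambda>t. A / c * exp (c * t))" by (intro continuous_intros)
      show "((\<lambda>t. A / c * exp (c * t)) has_vector_derivative A * exp (c * x)) (at x)" for x
        unfolding has_real_derivative_iff_has_vector_derivative[symmetric]
        using assms(3) by (auto intro!: derivative_eq_intros)
    qed (use F f[of _] in \<open>auto intro: f[THEN order_trans]\<close>)
    moreover have "0 \<le> A / c" using assms by simp
    ultimately show ?thesis using F(2) by simp
  qed
  show ?thesis
  proof (cases "t \<ge> 0")
    case True
    then show ?thesis using *[of F f t] F assms(2) f by simp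
  next
    case False
    have "((\<lambda>s. F (- s)) has_vector_derivative - f (- s)) (at s)" for s
      using has_vector_derivative_affine[of F "f (-s)" "-1" s 0] F by simp
    from *[of "\<lambda>s. F (- s)" "\<lambda>s. - f (- s)" "-t", OF this] False assms(2)
    have "(\<And>s. norm (- f (- s)) \<le> A * exp (c * \<bar>s\<bar>)) \<Longrightarrow> norm (F t) \<le> A / c * exp (c * - t)"
      by simp
    moreover have "norm (- f (- s)) \<le> A * exp (c * \<bar>s\<bar>)" for s
      using f[of "- s"] by simp
    ultimately show ?thesis using False by simp
  qed
qed

text \<open>One integration raises the order of vanishing by one, and Taylor remainders arise by
  repeating it. The mean value bound keeps the constant \<open>C\<close> where exact integration
  would give \<open>C / (n + 1)\<close>.\<close>

lemma has_vector_derivative_power_bound: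
  fixes e :: "real \<Rightarrow> 'a::real_normed_vector"
  assumes e: "\<And>t. (e has_vector_derivative e' t) (at t)" and "e 0 = 0" and "0 \<le> C"
    and C: "\<And>s. \<bar>s\<bar> \<le> \<bar>t\<bar> \<Longrightarrow> norm (e' s) \<le> C * \<bar>s\<bar> ^ n"
  shows "norm (e t) \<le> C * \<bar>t\<bar> ^ Suc n"
proof -
  have "norm (e t - e 0) \<le> (C * \<bar>t\<bar> ^ n) * norm (t - 0)"
  proof (rule differentiable_bound[where S="{-\<bar>t\<bar>..\<bar>t\<bar>}" and f'="\<lambda>x h. h *\<^sub>R e' x"])
    show "onorm (\<lambda>h. h *\<^sub>R e' x) \<le> C * \<bar>t\<bar> ^ n" if "x \<in> {-\<bar>t\<bar>..\<bar>t\<bar>}" for x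
    proof (rule onorm_bound)
      have "\<bar>x\<bar> ^ n \<le> \<bar>t\<bar> ^ n" using that by (intro power_mono) auto
      then have "norm (e' x) \<le> C * \<bar>t\<bar> ^ n"
        using C[of x] \<open>0 \<le> C\<close> that by (intro order_trans[OF C[of x] mult_left_mono]) auto
      then show "norm (h *\<^sub>R e' x) \<le> C * \<bar>t\<bar> ^ n * norm h" for h :: real
        by (simp add: mult.commute mult_left_mono)
    qed (use \<open>0 \<le> C\<close> in auto)
  qed (use e in \<open>auto simp: has_vector_derivative_def intro: has_derivative_at_withinI\<close>)
  then show ?thesis using assms(2) by (simp add: mult.assoc mult.commute mult.left_commute)
qed

subsection \<open>Existence\<close>

text \<open>Picard iteration in the Bielecki weighted norm: the unknown \<open>w\<close> is the
  displacement from \<open>x\<close> multiplied by \<open>exp (- c * \<bar>t\<bar>)\<close>, and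
  \<open>c = L + 1\<close> makes the contraction factor \<open>L / c\<close> less than 1 on the
  whole time line at once. Boundedness of \<open>X\<close> keeps the images under the operator
  bounded.\<close>

lemma bounded_lipschitz_solution_exists:
  fixes X :: "'a::euclidean_space \<Rightarrow> 'a"
  assumes M: "\<And>x. norm (X x) \<le> M" and L: "\<And>x y. norm (X x - X y) \<le> L * norm (x - y)" "0 \<le> L"
  shows "\<exists>y. y 0 = x \<and> (\<forall>t. (y has_vector_derivative X (y t)) (at t))"
proof -
  define c where "c = L + 1"
  have c: "c > 0" using L(2) by (simp add: c_def)
  have M0: "0 \<le> M" using M norm_ge_zero order_trans by blast
  have contX: "continuous_on UNIV X"
    by (intro lipschitz_on_continuous_on[of L] lipschitz_onI) (auto simp: dist_norm L)
  define rhs where "rhs w s = X (x + exp (c * \<bar>s\<bar>) *\<^sub>R apply_bcontfun w s)" for w :: "real \<Rightarrow>\<^sub>C 'a" and s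
  have cont: "continuous_on UNIV (rhs w)" for w
    unfolding rhs_def
    by (rule continuous_on_compose2[OF contX]) (auto intro!: continuous_intros)
  define Tf where "Tf w t = exp (- c * \<bar>t\<bar>) *\<^sub>R antideriv (rhs w) t" for w t
  have Tbound: "norm (Tf w t) \<le> M / c" for w t
  proof -
    have "norm (antideriv (rhs w) t) \<le> M / c * exp (c * \<bar>t\<bar>)"
    proof (rule exp_growth_bound[OF antideriv_deriv[OF cont]])
      show "norm (rhs w t) \<le> M * exp (c * \<bar>t\<bar>)" for t
        using M[of "x + exp (c * \<bar>t\<bar>) *\<^sub>R apply_bcontfun w t"] M0 c
          mult_left_mono[of 1 "exp (c * \<bar>t\<bar>)" M] by (simp add: rhs_def)
    qed (use c M0 in auto)
    then have "exp (- c * \<bar>t\<bar>) * norm (antideriv (rhs w) t)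
        \<le> exp (- c * \<bar>t\<bar>) * (M / c * exp (c * \<bar>t\<bar>))"
      by (intro mult_left_mono) auto
    then show ?thesis by (simp add: Tf_def exp_minus field_simps)
  qed
  have Tcont: "Tf w \<in> bcontfun" for w
  proof (rule bcontfun_normI[OF _ Tbound])
    have "continuous_on UNIV (antideriv (rhs w))"
      using antideriv_deriv[OF cont]
      by (meson continuous_at_imp_continuous_on has_vector_derivative_continuous)
    then show "continuous_on UNIV (Tf w)" unfolding Tf_def by (intro continuous_intros)
  qed
  define T where "T w = Bcontfun (Tf w)" for w
  have T: "apply_bcontfun (T w) t = Tf w t" for w t
    by (simp add: T_def Bcontfun_inverse[OF Tcont])
  have contr: "dist (T v) (T w) \<le> L / c * dist v w" for v w
  proof (rule dist_bound)
    fix t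
    let ?F = "\<lambda>t. antideriv (rhs v) t - antideriv (rhs w) t"
    have "norm (?F t) \<le> (L * dist v w) / c * exp (c * \<bar>t\<bar>)"
    proof (rule exp_growth_bound)
      show "(?F has_vector_derivative rhs v t - rhs w t) (at t)" for t
        by (intro has_vector_derivative_diff antideriv_deriv cont)
      fix t
      have "norm (rhs v t - rhs w t)
          \<le> L * norm (exp (c * \<bar>t\<bar>) *\<^sub>R (apply_bcontfun v t - apply_bcontfun w t))"
        unfolding rhs_def by (rule order_trans[OF L(1)]) (simp add: algebra_simps)
      also have "\<dots> \<le> L * (exp (c * \<bar>t\<bar>) * dist v w)"
        using dist_bounded[of v t w] L(2) by (auto intro!: mult_left_mono simp: dist_norm)
      finally show "norm (rhs v t - rhs w t) \<le> L * dist v w * exp (c * \<bar>t\<bar>)"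
        by (simp add: mult.assoc mult.commute mult.left_commute)
    qed (use c L in auto)
    then have "exp (- c * \<bar>t\<bar>) * norm (?F t)
        \<le> exp (- c * \<bar>t\<bar>) * ((L * dist v w) / c * exp (c * \<bar>t\<bar>))"
      by (intro mult_left_mono) auto
    moreover have "dist (Tf v t) (Tf w t) = exp (- c * \<bar>t\<bar>) * norm (?F t)"
      by (simp add: Tf_def dist_norm scaleR_diff_right[symmetric])
    ultimately show "dist (apply_bcontfun (T v) t) (apply_bcontfun (T w) t) \<le> L / c * dist v w"
      by (simp add: T exp_minus)
        (simp add: field_simps)
  qed
  have "\<exists>!w. T w = w"
    by (rule banach_fix_type[of "L / c"]) (use contr L(2) c in \<open>auto simp: c_def\<close>)
  then obtain w where w: "T w = w" by auto
  define y where "y t = x + exp (c * \<bar>t\<bar>) *\<^sub>R apply_bcontfun w t" for t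
  have "apply_bcontfun w t = Tf w t" for t using T[of w t] w by simp
  then have yeq: "y = (\<lambda>t. x + antideriv (rhs w) t)"
    by (simp add: y_def Tf_def exp_minus fun_eq_iff)
  have rhs: "rhs w t = X (y t)" for t by (simp add: rhs_def y_def)
  have "(y has_vector_derivative X (y t)) (at t)" for t
    using has_vector_derivative_add[OF has_vector_derivative_const[of x] antideriv_deriv[OF cont[of w], of t]]
    unfolding yeq[symmetric] rhs by simp
  moreover have "y 0 = x" by (simp add: yeq)
  ultimately show ?thesis by blast
qed

subsection \<open>The flow\<close>

definition is_flow :: "('a::real_normed_vector \<Rightarrow> 'a) \<Rightarrow> (real \<Rightarrow> 'a \<Rightarrow> 'a) \<Rightarrow> bool" where
  "is_flow X \<phi> \<longleftrightarrow> (\<forall>x. \<phi> 0 x = x \<and> (\<forall>t. ((\<lambda>t. \<phi> t x) has_vector_derivative X (\<phi> t x)) (at t)))"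

lemma is_flow_0: "is_flow X \<phi> \<Longrightarrow> \<phi> 0 x = x"
  by (simp add: is_flow_def)

lemma is_flow_deriv: "is_flow X \<phi> \<Longrightarrow> ((\<lambda>t. \<phi> t x) has_vector_derivative X (\<phi> t x)) (at t)"
  by (simp add: is_flow_def)

lemma flow_exists:
  assumes "test_map X" obtains \<phi> where "is_flow X \<phi>"
proof -
  obtain M where "\<And>x. norm (X x) \<le> M" using test_map_bounded[OF assms] by blast
  moreover obtain L where "L \<ge> 0" "\<And>x y. norm (X x - X y) \<le> L * norm (x - y)"
    using test_map_lipschitz[OF assms] by blast
  ultimately have "\<forall>x. \<exists>y. y 0 = x \<and> (\<forall>t. (y has_vector_derivative X (y t)) (at t))"
    using bounded_lipschitz_solution_exists by blast
  then obtain y where "\<And>x. y x 0 = x \<and> (\<forall>t. (y x has_vector_derivative X (y x t)) (at t))"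
    by metis
  then have "is_flow X (\<lambda>t x. y x t)" by (simp add: is_flow_def)
  then show ?thesis by (rule that)
qed

lemma solution_reflect:
  assumes "\<And>t. (y has_vector_derivative X (y t)) (at t)"
  shows "((\<lambda>t. y (- t)) has_vector_derivative - X (y (- t))) (at t)"
  using has_vector_derivative_affine[of y "X (y (-t))" "-1" t 0] assms by simp

lemma solution_shift:
  assumes "\<And>t. (y has_vector_derivative X (y t)) (at t)"
  shows "((\<lambda>t. y (t + s)) has_vector_derivative X (y (t + s))) (at t)"
  using has_vector_derivative_affine[of y "X (y (t + s))" 1 t s] assms by simp

lemma global_gronwall_dist:
  fixes y z :: "real \<Rightarrow> 'a::euclidean_space"
  assumes L: "\<And>p q. norm (X p - X q) \<le> L * norm (p - q)"
    and y: "\<And>t. (y has_vector_derivative X (y t)) (at t)"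
    and z: "\<And>t. (z has_vector_derivative X (z t)) (at t)"
  shows "norm (y t - z t) \<le> exp (L * \<bar>t\<bar>) * norm (y 0 - z 0)"
proof (cases "t \<ge> 0")
  case True
  then show ?thesis
    using gronwall_dist[of t UNIV X L y z, OF _ L has_vector_derivative_at_within[OF y]
        has_vector_derivative_at_within[OF z]] by simp
next
  case False
  have "norm (- X p - - X q) \<le> L * norm (p - q)" for p q
    using L[of q p] by (simp add: norm_minus_commute)
  from gronwall_dist[of "- t" UNIV "\<lambda>p. - X p" L "\<lambda>t. y (- t)" "\<lambda>t. z (- t)", OF _ this
      has_vector_derivative_at_within[OF solution_reflect[of y X, OF y]]
      has_vector_derivative_at_within[OF solution_reflect[of z X, OF z]]]
  show ?thesis using False by simp
qed

lemma flow_unique: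
  fixes y :: "real \<Rightarrow> 'a::euclidean_space"
  assumes "test_map X" "is_flow X \<phi>" "\<And>t. (y has_vector_derivative X (y t)) (at t)"
  shows "y t = \<phi> t (y 0)"
proof -
  obtain L where "\<And>x y. norm (X x - X y) \<le> L * norm (x - y)"
    using test_map_lipschitz[OF assms(1)] by blast
  from global_gronwall_dist[of X L y "\<lambda>t. \<phi> t (y 0)" t, OF this assms(3) is_flow_deriv[OF assms(2)]]
  show ?thesis by (simp add: is_flow_0[OF assms(2)])
qed

lemma flow_add:
  fixes X :: "'a::euclidean_space \<Rightarrow> 'a"
  assumes "test_map X" "is_flow X \<phi>" shows "\<phi> s (\<phi> t x) = \<phi> (s + t) x"
  using flow_unique[OF assms, of "\<lambda>s. \<phi> (s + t) x" s]
    solution_shift[of "\<lambda>t. \<phi> t x" X, OF is_flow_deriv[OF assms(2)]] by simp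

lemma flow_inverse:
  fixes X :: "'a::euclidean_space \<Rightarrow> 'a"
  assumes "test_map X" "is_flow X \<phi>" shows "\<phi> (- t) (\<phi> t x) = x"
  using flow_add[OF assms, of "- t" t x] is_flow_0[OF assms(2)] by simp

lemma flow_lipschitz:
  fixes X :: "'a::euclidean_space \<Rightarrow> 'a"
  assumes "test_map X" "is_flow X \<phi>"
  obtains L where "L \<ge> 0" "\<And>t x y. norm (\<phi> t x - \<phi> t y) \<le> exp (L * \<bar>t\<bar>) * norm (x - y)"
proof -
  obtain L where L: "L \<ge> 0" "\<And>x y. norm (X x - X y) \<le> L * norm (x - y)"
    using test_map_lipschitz[OF assms(1)] by blast
  have "norm (\<phi> t x - \<phi> t y) \<le> exp (L * \<bar>t\<bar>) * norm (x - y)" for t x y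
    using global_gronwall_dist[of X L "\<lambda>t. \<phi> t x" "\<lambda>t. \<phi> t y" t,
        OF L(2) is_flow_deriv[OF assms(2)] is_flow_deriv[OF assms(2)]]
    by (simp add: is_flow_0[OF assms(2)])
  with L(1) show ?thesis by (rule that)
qed

lemma flow_continuous:
  fixes X :: "'a::euclidean_space \<Rightarrow> 'a"
  assumes "test_map X" "is_flow X \<phi>"
  shows "continuous_on UNIV (\<lambda>(t, x). \<phi> t x)"
proof -
  obtain L where L: "L \<ge> 0" "\<And>t x y. norm (\<phi> t x - \<phi> t y) \<le> exp (L * \<bar>t\<bar>) * norm (x - y)"
    using flow_lipschitz[OF assms] by blast
  have "((\<lambda>(t, x). \<phi> t x) \<longlongrightarrow> \<phi> t0 x0) (at (t0, x0))" for t0 x0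
  proof -
    have c: "isCont (\<lambda>t. \<phi> t x0) t0"
      using has_vector_derivative_continuous[OF is_flow_deriv[OF assms(2)]] .
    have "((\<lambda>p. \<phi> (fst p) x0) \<longlongrightarrow> \<phi> t0 x0) (at (t0, x0))"
      by (rule isCont_tendsto_compose[OF c]) (auto intro: tendsto_eq_intros)
    moreover have "((\<lambda>p. \<phi> (fst p) (snd p) - \<phi> (fst p) x0) \<longlongrightarrow> 0) (at (t0, x0))"
    proof (rule Lim_null_comparison)
      show "\<forall>\<^sub>F p in at (t0, x0). norm (\<phi> (fst p) (snd p) - \<phi> (fst p) x0)
          \<le> exp (L * \<bar>fst p\<bar>) * norm (snd p - x0)"
        using L(2) by simp
      show "((\<lambda>p. exp (L * \<bar>fst p\<bar>) * norm (snd p - x0)) \<longlongrightarrow> 0) (at (t0, x0))"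
        by (auto intro!: tendsto_eq_intros)
    qed
    ultimately have "((\<lambda>p. (\<phi> (fst p) (snd p) - \<phi> (fst p) x0) + \<phi> (fst p) x0) \<longlongrightarrow> 0 + \<phi> t0 x0) (at (t0, x0))"
      by (intro tendsto_add)
    then show ?thesis by (simp add: case_prod_beta')
  qed
  then show ?thesis
    by (auto intro!: continuous_at_imp_continuous_on simp: isCont_def)
qed

section \<open>Commutators of flows\<close>

lemma lie_deriv_flow:
  fixes X :: "'a::euclidean_space \<Rightarrow> 'a" and f :: "'a \<Rightarrow> 'b::euclidean_space"
  assumes "test_map f" "is_flow X \<phi>"
  shows "((\<lambda>t. f (\<phi> t x)) has_vector_derivative lie_deriv X f (\<phi> t x)) (at t)"
proof -
  let ?D = "frechet_derivative f (at (\<phi> t x))"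
  have D: "(f has_derivative ?D) (at (\<phi> t x))"
    by (rule smooth_has_derivative[OF test_map_smooth[OF assms(1)]])
  have "((\<lambda>t. f (\<phi> t x)) has_derivative (\<lambda>h. ?D (h *\<^sub>R X (\<phi> t x)))) (at t)"
    by (rule has_derivative_compose[OF is_flow_deriv[OF assms(2), unfolded has_vector_derivative_def] D])
  then show ?thesis
    by (simp add: has_vector_derivative_def lie_deriv_def linear_cmul[OF has_derivative_linear[OF D]])
qed

text \<open>Compact support makes the constant uniform in \<open>x\<close> and in all real
  \<open>t\<close>. The uniformity is inherited by the higher expansions.\<close>

lemma flow_taylor_0:
  fixes X :: "'a::euclidean_space \<Rightarrow> 'a" and f :: "'a \<Rightarrow> 'b::euclidean_space"
  assumes "test_map f" "test_map X" "is_flow X \<phi>"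
  obtains C where "C \<ge> 0" "\<And>t x. norm (f (\<phi> t x) - f x) \<le> C * \<bar>t\<bar>"
proof -
  obtain C where C: "C \<ge> 0" "\<And>x. norm (lie_deriv X f x) \<le> C"
    using test_map_bounded[OF test_map_lie_deriv[OF assms(1,2)]] by blast
  have "norm (f (\<phi> t x) - f x) \<le> C * \<bar>t\<bar> ^ Suc 0" for t x
  proof (rule has_vector_derivative_power_bound)
    show "((\<lambda>t. f (\<phi> t x) - f x) has_vector_derivative lie_deriv X f (\<phi> t x)) (at t)" for t
      using has_vector_derivative_diff[OF lie_deriv_flow[OF assms(1,3)] has_vector_derivative_const[of "f x"]]
      by simp
  qed (use C is_flow_0[OF assms(3)] in auto)
  then show ?thesis using that C(1) by auto
qed

lemma flow_taylor_1:
  fixes X :: "'a::euclidean_space \<Rightarrow> 'a" and f :: "'a \<Rightarrow> 'b::euclidean_space"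
  assumes "test_map f" "test_map X" "is_flow X \<phi>"
  obtains C where "C \<ge> 0" "\<And>t x. norm (f (\<phi> t x) - f x - t *\<^sub>R lie_deriv X f x) \<le> C * \<bar>t\<bar> ^ 2"
proof -
  obtain C where C: "C \<ge> 0" "\<And>t x. norm (lie_deriv X f (\<phi> t x) - lie_deriv X f x) \<le> C * \<bar>t\<bar>"
    using flow_taylor_0[OF test_map_lie_deriv[OF assms(1,2)] assms(2,3)] by blast
  have "norm (f (\<phi> t x) - f x - t *\<^sub>R lie_deriv X f x) \<le> C * \<bar>t\<bar> ^ Suc 1" for t x
  proof (rule has_vector_derivative_power_bound)
    have "((\<lambda>t. t *\<^sub>R lie_deriv X f x) has_vector_derivative lie_deriv X f x) (at t)" for t
      by (auto intro!: derivative_eq_intros)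
    from has_vector_derivative_diff[OF has_vector_derivative_diff[OF lie_deriv_flow[OF assms(1,3)]
          has_vector_derivative_const[of "f x"]] this]
    show "((\<lambda>t. f (\<phi> t x) - f x - t *\<^sub>R lie_deriv X f x) has_vector_derivative
        lie_deriv X f (\<phi> t x) - lie_deriv X f x) (at t)" for t
      by simp
  qed (use C is_flow_0[OF assms(3)] in auto)
  then show ?thesis using that C(1) by (auto simp: numeral_2_eq_2)
qed

lemma flow_euler:
  fixes X :: "'a::euclidean_space \<Rightarrow> 'a"
  assumes "test_map X" "is_flow X \<phi>"
  obtains C where "C \<ge> 0" "\<And>t x. norm (\<phi> t x - x - t *\<^sub>R X x) \<le> C * \<bar>t\<bar> ^ 2"
proof -
  obtain C where C: "C \<ge> 0" "\<And>t x. norm (X (\<phi> t x) - X x) \<le> C * \<bar>t\<bar>"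
    using flow_taylor_0[OF assms(1) assms] by blast
  have "norm (\<phi> t x - x - t *\<^sub>R X x) \<le> C * \<bar>t\<bar> ^ Suc 1" for t x
  proof (rule has_vector_derivative_power_bound)
    have "((\<lambda>t. t *\<^sub>R X x) has_vector_derivative X x) (at t)" for t
      by (auto intro!: derivative_eq_intros)
    from has_vector_derivative_diff[OF has_vector_derivative_diff[OF is_flow_deriv[OF assms(2)]
          has_vector_derivative_const[of x]] this]
    show "((\<lambda>t. \<phi> t x - x - t *\<^sub>R X x) has_vector_derivative X (\<phi> t x) - X x) (at t)" for t
      by simp
  qed (use C is_flow_0[OF assms(2)] in auto)
  then show ?thesis using that C(1) by (auto simp: numeral_2_eq_2)
qed

text \<open>The acceleration along an integral curve is \<open>lie_deriv X X\<close>; the quadratic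
  term comes from integrating the first-order expansion of \<open>X\<close> along its own
  flow.\<close>

lemma flow_taylor_2:
  fixes X :: "'a::euclidean_space \<Rightarrow> 'a"
  assumes "test_map X" "is_flow X \<phi>"
  obtains C where "C \<ge> 0"
    "\<And>t x. norm (\<phi> t x - x - t *\<^sub>R X x - (t\<^sup>2 / 2) *\<^sub>R lie_deriv X X x) \<le> C * \<bar>t\<bar> ^ 3"
proof -
  obtain C where C: "C \<ge> 0" "\<And>t x. norm (X (\<phi> t x) - X x - t *\<^sub>R lie_deriv X X x) \<le> C * \<bar>t\<bar> ^ 2"
    using flow_taylor_1[OF assms(1) assms] by blast
  have "norm (\<phi> t x - x - t *\<^sub>R X x - (t\<^sup>2 / 2) *\<^sub>R lie_deriv X X x) \<le> C * \<bar>t\<bar> ^ Suc 2" for t x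
  proof (rule has_vector_derivative_power_bound)
    have 1: "((\<lambda>t. t *\<^sub>R X x) has_vector_derivative X x) (at t)" for t
      by (auto intro!: derivative_eq_intros)
    have 2: "((\<lambda>t. (t\<^sup>2 / 2) *\<^sub>R lie_deriv X X x) has_vector_derivative t *\<^sub>R lie_deriv X X x) (at t)" for t
      by (auto intro!: derivative_eq_intros)
    show "((\<lambda>t. \<phi> t x - x - t *\<^sub>R X x - (t\<^sup>2 / 2) *\<^sub>R lie_deriv X X x) has_vector_derivative
        X (\<phi> t x) - X x - t *\<^sub>R lie_deriv X X x) (at t)" for t
      using has_vector_derivative_diff[OF has_vector_derivative_diff[OF has_vector_derivative_diff[OF
          is_flow_deriv[OF assms(2)] has_vector_derivative_const[of x]] 1] 2] by simp
  qed (use C is_flow_0[OF assms(2)] in auto)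
  then show ?thesis using that C(1) by (auto simp: numeral_3_eq_3 numeral_2_eq_2)
qed

text \<open>The displacement of \<open>\<phi> t\<close> from the identity has Lipschitz constant
  O(t): its time derivative is a difference of values of \<open>X\<close> at two points that the
  flow separates at most exponentially. For times at most 1 the exponential is absorbed in the
  constant.\<close>

lemma flow_diff_displacement:
  fixes X :: "'a::euclidean_space \<Rightarrow> 'a"
  assumes "test_map X" "is_flow X \<phi>"
  obtains C where "C \<ge> 0"
    "\<And>t x y. \<bar>t\<bar> \<le> 1 \<Longrightarrow> norm (\<phi> t x - \<phi> t y - (x - y)) \<le> C * \<bar>t\<bar> * norm (x - y)"
proof -
  obtain K where K: "K \<ge> 0" "\<And>x y. norm (X x - X y) \<le> K * norm (x - y)"
    using test_map_lipschitz[OF assms(1)] by blast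
  obtain L where L: "L \<ge> 0" "\<And>t x y. norm (\<phi> t x - \<phi> t y) \<le> exp (L * \<bar>t\<bar>) * norm (x - y)"
    using flow_lipschitz[OF assms] by blast
  have "norm (\<phi> t x - \<phi> t y - (x - y)) \<le> K * exp L * norm (x - y) * \<bar>t\<bar> ^ Suc 0"
    if t: "\<bar>t\<bar> \<le> 1" for t x y
  proof (rule has_vector_derivative_power_bound)
    show "((\<lambda>t. \<phi> t x - \<phi> t y - (x - y)) has_vector_derivative X (\<phi> t x) - X (\<phi> t y)) (at t)" for t
      using has_vector_derivative_diff[OF has_vector_derivative_diff[OF is_flow_deriv[OF assms(2), of x]
            is_flow_deriv[OF assms(2), of y]] has_vector_derivative_const[of "x - y"]] by simp
    fix s assume s: "\<bar>s\<bar> \<le> \<bar>t\<bar>"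
    have "norm (X (\<phi> s x) - X (\<phi> s y)) \<le> K * norm (\<phi> s x - \<phi> s y)" by (rule K)
    also have "\<dots> \<le> K * (exp (L * \<bar>s\<bar>) * norm (x - y))" by (intro mult_left_mono L K)
    also have "\<dots> \<le> K * (exp L * norm (x - y))"
      using s t L(1) K(1) mult_left_mono[of "\<bar>s\<bar>" 1 L] by (intro mult_left_mono mult_right_mono) auto
    finally show "norm (X (\<phi> s x) - X (\<phi> s y)) \<le> K * exp L * norm (x - y) * \<bar>s\<bar> ^ 0"
      by (simp add: mult.assoc)
  qed (use K(1) is_flow_0[OF assms(2)] in auto)
  then show ?thesis
    using that[of "K * exp L"] K(1) by (simp add: mult.assoc mult.commute mult.left_commute)
qed

text \<open>The mixed term arises from evaluating \<open>Y\<close> at the moved point. It is the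
  only second-order term sensitive to the order of the two flows, so exchanging them isolates the
  bracket. The condition \<open>\<bar>k\<bar> = \<bar>h\<bar>\<close> leaves the sign of
  \<open>h * k\<close> free.\<close>

lemma flow_compose_taylor:
  fixes X Y :: "'a::euclidean_space \<Rightarrow> 'a"
  assumes X: "test_map X" "is_flow X \<phi>" and Y: "test_map Y" "is_flow Y \<psi>"
  obtains C where "C \<ge> 0"
    "\<And>h k x. \<bar>k\<bar> = \<bar>h\<bar> \<Longrightarrow> norm (\<psi> k (\<phi> h x) - (x + h *\<^sub>R X x + k *\<^sub>R Y x + (h\<^sup>2 / 2) *\<^sub>R lie_deriv X X x
        + (k\<^sup>2 / 2) *\<^sub>R lie_deriv Y Y x + (h * k) *\<^sub>R lie_deriv X Y x)) \<le> C * \<bar>h\<bar> ^ 3"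
proof -
  obtain C1 where C1: "C1 \<ge> 0"
    "\<And>t x. norm (\<phi> t x - x - t *\<^sub>R X x - (t\<^sup>2 / 2) *\<^sub>R lie_deriv X X x) \<le> C1 * \<bar>t\<bar> ^ 3"
    using flow_taylor_2[OF X] by blast
  obtain C2 where C2: "C2 \<ge> 0"
    "\<And>t x. norm (\<psi> t x - x - t *\<^sub>R Y x - (t\<^sup>2 / 2) *\<^sub>R lie_deriv Y Y x) \<le> C2 * \<bar>t\<bar> ^ 3"
    using flow_taylor_2[OF Y] by blast
  obtain C3 where C3: "C3 \<ge> 0" "\<And>t x. norm (Y (\<phi> t x) - Y x - t *\<^sub>R lie_deriv X Y x) \<le> C3 * \<bar>t\<bar> ^ 2"
    using flow_taylor_1[OF Y(1) X] by blast
  obtain C4 where C4: "C4 \<ge> 0" "\<And>t x. norm (lie_deriv Y Y (\<phi> t x) - lie_deriv Y Y x) \<le> C4 * \<bar>t\<bar>"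
    using flow_taylor_0[OF test_map_lie_deriv[OF Y(1) Y(1)] X] by blast
  show ?thesis
  proof (rule that[of "C2 + C1 + C3 + C4"])
    fix h k :: real and x assume hk: "\<bar>k\<bar> = \<bar>h\<bar>"
    define p where "p = \<phi> h x"
    \<comment> \<open>The remainder splits into the separate expansions of the two flows
      (\<open>A\<close> at the moved point, \<open>B\<close> at \<open>x\<close>) and the cost of
      moving the coefficients of \<open>\<psi>\<close> from \<open>p\<close> back to
      \<open>x\<close> (\<open>D\<close> and \<open>E\<close>).\<close>
    define A where "A = \<psi> k p - p - k *\<^sub>R Y p - (k\<^sup>2 / 2) *\<^sub>R lie_deriv Y Y p"
    define B where "B = p - x - h *\<^sub>R X x - (h\<^sup>2 / 2) *\<^sub>R lie_deriv X X x"
    define D where "D = k *\<^sub>R (Y p - Y x - h *\<^sub>R lie_deriv X Y x)"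
    define E where "E = (k\<^sup>2 / 2) *\<^sub>R (lie_deriv Y Y p - lie_deriv Y Y x)"
    have "norm A \<le> C2 * \<bar>h\<bar> ^ 3" unfolding A_def using C2(2)[of k p] hk by simp
    moreover have "norm B \<le> C1 * \<bar>h\<bar> ^ 3" unfolding B_def p_def by (rule C1)
    moreover have "norm D \<le> C3 * \<bar>h\<bar> ^ 3"
    proof -
      have "norm D \<le> \<bar>h\<bar> * (C3 * \<bar>h\<bar> ^ 2)"
        unfolding D_def p_def by (simp only: norm_scaleR hk) (intro mult_left_mono C3, simp)
      then show ?thesis by (simp add: power3_eq_cube power2_eq_square mult.commute mult.left_commute)
    qed
    moreover have "norm E \<le> C4 * \<bar>h\<bar> ^ 3"
    proof -
      have k2: "k\<^sup>2 = \<bar>h\<bar>\<^sup>2" using hk by (metis power2_abs)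
      have "norm E \<le> (\<bar>h\<bar>\<^sup>2 / 2) * (C4 * \<bar>h\<bar>)"
        unfolding E_def p_def k2 by (simp only: norm_scaleR) (intro mult_mono C4, auto)
      also have "\<dots> \<le> \<bar>h\<bar>\<^sup>2 * (C4 * \<bar>h\<bar>)" using C4(1) by (intro mult_right_mono) auto
      finally show ?thesis by (simp add: power3_eq_cube power2_eq_square mult.commute mult.left_commute)
    qed
    moreover have "\<psi> k (\<phi> h x) - (x + h *\<^sub>R X x + k *\<^sub>R Y x + (h\<^sup>2 / 2) *\<^sub>R lie_deriv X X x
        + (k\<^sup>2 / 2) *\<^sub>R lie_deriv Y Y x + (h * k) *\<^sub>R lie_deriv X Y x) = A + B + D + E"
      unfolding A_def B_def D_def E_def p_def
      by (simp add: algebra_simps)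
    ultimately show "norm (\<psi> k (\<phi> h x) - (x + h *\<^sub>R X x + k *\<^sub>R Y x + (h\<^sup>2 / 2) *\<^sub>R lie_deriv X X x
        + (k\<^sup>2 / 2) *\<^sub>R lie_deriv Y Y x + (h * k) *\<^sub>R lie_deriv X Y x)) \<le> (C2 + C1 + C3 + C4) * \<bar>h\<bar> ^ 3"
      using norm_triangle_ineq[of "A + B + D" E] norm_triangle_ineq[of "A + B" D] norm_triangle_ineq[of A B]
      by (simp only: distrib_right)
  qed (use C1 C2 C3 C4 in auto)
qed

definition flow_commutator :: "(real \<Rightarrow> 'a \<Rightarrow> 'a) \<Rightarrow> (real \<Rightarrow> 'a \<Rightarrow> 'a) \<Rightarrow> real \<Rightarrow> real \<Rightarrow> 'a \<Rightarrow> 'a" where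
  "flow_commutator \<phi> \<psi> h k x = \<psi> (- k) (\<phi> (- h) (\<psi> k (\<phi> h x)))"

text \<open>Comparing \<open>\<psi> k (\<phi> h x)\<close> with \<open>\<phi> h (\<psi> k x)\<close> instead of expanding all four flows needs only
  two-flow expansions: the final map \<open>\<psi> (- k) \<circ> \<phi> (- h)\<close> is \<open>O(h)\<close>-close to the identity in the
  Lipschitz sense, and the two points differ by \<open>O(h\<^sup>2)\<close>.\<close>

lemma flow_commutator_taylor:
  fixes X Y :: "'a::euclidean_space \<Rightarrow> 'a"
  assumes X: "test_map X" "is_flow X \<phi>" and Y: "test_map Y" "is_flow Y \<psi>"
  obtains C where "C \<ge> 0"
    "\<And>h k x. \<bar>h\<bar> \<le> 1 \<Longrightarrow> \<bar>k\<bar> = \<bar>h\<bar> \<Longrightarrow>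
      norm (flow_commutator \<phi> \<psi> h k x - x - (h * k) *\<^sub>R lie_bracket X Y x) \<le> C * \<bar>h\<bar> ^ 3"
proof -
  obtain Ca where Ca: "Ca \<ge> 0"
    "\<And>h k x. \<bar>k\<bar> = \<bar>h\<bar> \<Longrightarrow> norm (\<psi> k (\<phi> h x) - (x + h *\<^sub>R X x + k *\<^sub>R Y x + (h\<^sup>2 / 2) *\<^sub>R lie_deriv X X x
        + (k\<^sup>2 / 2) *\<^sub>R lie_deriv Y Y x + (h * k) *\<^sub>R lie_deriv X Y x)) \<le> Ca * \<bar>h\<bar> ^ 3"
    using flow_compose_taylor[OF X Y] by blast
  obtain Cb where Cb: "Cb \<ge> 0"
    "\<And>h k x. \<bar>k\<bar> = \<bar>h\<bar> \<Longrightarrow> norm (\<phi> k (\<psi> h x) - (x + h *\<^sub>R Y x + k *\<^sub>R X x + (h\<^sup>2 / 2) *\<^sub>R lie_deriv Y Y x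
        + (k\<^sup>2 / 2) *\<^sub>R lie_deriv X X x + (h * k) *\<^sub>R lie_deriv Y X x)) \<le> Cb * \<bar>h\<bar> ^ 3"
    using flow_compose_taylor[OF Y X] by blast
  obtain C1 where C1: "C1 \<ge> 0"
    "\<And>t x y. \<bar>t\<bar> \<le> 1 \<Longrightarrow> norm (\<phi> t x - \<phi> t y - (x - y)) \<le> C1 * \<bar>t\<bar> * norm (x - y)"
    using flow_diff_displacement[OF X] by blast
  obtain C2 where C2: "C2 \<ge> 0"
    "\<And>t x y. \<bar>t\<bar> \<le> 1 \<Longrightarrow> norm (\<psi> t x - \<psi> t y - (x - y)) \<le> C2 * \<bar>t\<bar> * norm (x - y)"
    using flow_diff_displacement[OF Y] by blast
  obtain M where M: "M \<ge> 0" "\<And>x. norm (lie_bracket X Y x) \<le> M"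
    using test_map_bounded[OF test_map_lie_bracket[OF X(1) Y(1)]] by blast
  \<comment> \<open>Displacement constant of \<open>\<psi> (- k)\<close> after
    \<open>\<phi> (- h)\<close>: \<open>C1\<close> for the inner map, and
    \<open>C2 * (1 + C1)\<close> for the outer one, whose arguments have moved apart by a factor of
    at most \<open>1 + C1\<close>.\<close>
  define K where "K = C2 * (1 + C1) + C1"
  have K: "K \<ge> 0" using C1 C2 by (simp add: K_def)
  show ?thesis
  proof (rule that[of "Ca + Cb + K * (M + Ca + Cb)"])
    show "0 \<le> Ca + Cb + K * (M + Ca + Cb)" using Ca Cb K M by simp
    fix h k :: real and x assume h: "\<bar>h\<bar> \<le> 1" and hk: "\<bar>k\<bar> = \<bar>h\<bar>"
    define a b where "a = \<psi> k (\<phi> h x)" and "b = \<phi> h (\<psi> k x)"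
    define p q where "p = \<phi> (- h) a" and "q = \<phi> (- h) b"
    have ab: "norm (a - b - (h * k) *\<^sub>R lie_bracket X Y x) \<le> (Ca + Cb) * \<bar>h\<bar> ^ 3"
    proof -
      let ?e = "x + h *\<^sub>R X x + k *\<^sub>R Y x + (h\<^sup>2 / 2) *\<^sub>R lie_deriv X X x + (k\<^sup>2 / 2) *\<^sub>R lie_deriv Y Y x"
      have "norm (a - (?e + (h * k) *\<^sub>R lie_deriv X Y x)) \<le> Ca * \<bar>h\<bar> ^ 3"
        unfolding a_def using Ca(2)[OF hk, of x] by simp
      moreover have "norm (b - (?e + (h * k) *\<^sub>R lie_deriv Y X x)) \<le> Cb * \<bar>h\<bar> ^ 3"
        unfolding b_def using Cb(2)[OF hk[symmetric], of x] hk
        by (simp add: algebra_simps)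
      moreover have "a - b - (h * k) *\<^sub>R lie_bracket X Y x
          = (a - (?e + (h * k) *\<^sub>R lie_deriv X Y x)) - (b - (?e + (h * k) *\<^sub>R lie_deriv Y X x))"
        by (simp add: lie_bracket_lie_deriv algebra_simps)
      ultimately show ?thesis
        by (simp only: distrib_right) (rule norm_triangle_le_diff, rule add_mono)
    qed
    have "norm (a - b) \<le> (M + Ca + Cb) * \<bar>h\<bar>\<^sup>2"
    proof -
      have "norm (a - b) \<le> norm (a - b - (h * k) *\<^sub>R lie_bracket X Y x) + norm ((h * k) *\<^sub>R lie_bracket X Y x)"
        using norm_triangle_ineq[of "a - b - (h * k) *\<^sub>R lie_bracket X Y x" "(h * k) *\<^sub>R lie_bracket X Y x"]
        by simp
      moreover have "norm ((h * k) *\<^sub>R lie_bracket X Y x) \<le> \<bar>h\<bar>\<^sup>2 * M"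
        using M by (simp add: abs_mult hk power2_eq_square mult_left_mono)
      moreover have "(Ca + Cb) * \<bar>h\<bar> ^ 3 \<le> (Ca + Cb) * \<bar>h\<bar>\<^sup>2"
        using h Ca Cb by (intro mult_left_mono power_decreasing) auto
      ultimately show ?thesis using ab by (simp add: algebra_simps)
    qed
    then have abh: "K * \<bar>h\<bar> * norm (a - b) \<le> K * (M + Ca + Cb) * \<bar>h\<bar> ^ 3"
      using mult_left_mono[of "norm (a - b)" "(M + Ca + Cb) * \<bar>h\<bar>\<^sup>2" "K * \<bar>h\<bar>"] K
      by (simp add: power3_eq_cube power2_eq_square mult.assoc mult.commute mult.left_commute)
    have pq: "norm (p - q - (a - b)) \<le> C1 * \<bar>h\<bar> * norm (a - b)"
      unfolding p_def q_def using C1(2)[of "- h" a b] h by simp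
    have "C1 * \<bar>h\<bar> * norm (a - b) \<le> C1 * 1 * norm (a - b)"
      using C1(1) h by (intro mult_right_mono mult_left_mono) auto
    then have npq: "norm (p - q) \<le> (1 + C1) * norm (a - b)"
      using pq norm_triangle_sub[of "p - q" "a - b"] by (simp add: algebra_simps)
    have "norm (\<psi> (- k) p - \<psi> (- k) q - (p - q)) \<le> C2 * \<bar>h\<bar> * norm (p - q)"
      using C2(2)[of "- k" p q] h hk by simp
    also have "\<dots> \<le> C2 * \<bar>h\<bar> * ((1 + C1) * norm (a - b))"
      using C2(1) npq by (intro mult_left_mono) auto
    finally have *: "norm (\<psi> (- k) p - \<psi> (- k) q - (a - b)) \<le> K * \<bar>h\<bar> * norm (a - b)"
      using pq norm_triangle_ineq[of "\<psi> (- k) p - \<psi> (- k) q - (p - q)" "p - q - (a - b)"]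
      by (simp add: K_def algebra_simps)
    have "\<psi> (- k) q = x"
      unfolding q_def b_def by (simp add: flow_inverse[OF X] flow_inverse[OF Y])
    moreover have "\<psi> (- k) p = flow_commutator \<phi> \<psi> h k x"
      by (simp add: p_def a_def flow_commutator_def)
    ultimately have "flow_commutator \<phi> \<psi> h k x - x - (h * k) *\<^sub>R lie_bracket X Y x =
      (\<psi> (- k) p - \<psi> (- k) q - (a - b)) + (a - b - (h * k) *\<^sub>R lie_bracket X Y x)"
      by simp
    then have "norm (flow_commutator \<phi> \<psi> h k x - x - (h * k) *\<^sub>R lie_bracket X Y x)
      \<le> norm (\<psi> (- k) p - \<psi> (- k) q - (a - b)) + norm (a - b - (h * k) *\<^sub>R lie_bracket X Y x)"
      by (simp only: norm_triangle_ineq)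
    with * ab abh show "norm (flow_commutator \<phi> \<psi> h k x - x - (h * k) *\<^sub>R lie_bracket X Y x)
      \<le> (Ca + Cb + K * (M + Ca + Cb)) * \<bar>h\<bar> ^ 3"
      by (simp only: distrib_right)
  qed
qed

section \<open>Approximation of flows by attainable maps\<close>

text \<open>\<open>R\<close> is an attainability relation. Only uniform approximation is asked for, so no differentiable
  dependence of flows on the initial point is ever needed.\<close>

definition reach_approx :: "('a::euclidean_space \<times> 'a) set \<Rightarrow> (real \<Rightarrow> 'a \<Rightarrow> 'a) \<Rightarrow> bool" where
  "reach_approx R \<phi> \<longleftrightarrow> (\<forall>\<delta>>0. \<exists>P. continuous_on UNIV (\<lambda>(t, x). P t x) \<and> (\<forall>t x. (x, P t x) \<in> R) \<and>
     (\<forall>t x. \<bar>t\<bar> \<le> 1 \<longrightarrow> norm (P t x - \<phi> t x) \<le> \<delta>))"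

lemma continuous_on_apply2:
  assumes "continuous_on UNIV (\<lambda>(t, x). P t x)" "continuous_on S a" "continuous_on S b"
  shows "continuous_on S (\<lambda>p. P (a p) (b p))"
  using continuous_on_compose2[OF assms(1), of S "\<lambda>p. (a p, b p)"] assms(2,3)
  by (auto intro: continuous_on_Pair)

text \<open>Discrete Gronwall argument: every step commits a fresh error of at most
  \<open>\<eta>\<close>, and earlier errors are carried by the flow, growing by at most
  \<open>exp (L * \<bar>s\<bar>)\<close> per step.\<close>

lemma euler_scheme:
  fixes \<zeta> :: "real \<Rightarrow> 'a::euclidean_space \<Rightarrow> 'a"
  assumes Z: "test_map Z" "is_flow Z \<zeta>" and "L \<ge> 0" "\<eta> \<ge> 0"
    and L: "\<And>t x y. norm (\<zeta> t x - \<zeta> t y) \<le> exp (L * \<bar>t\<bar>) * norm (x - y)"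
    and Q: "\<And>x. norm (Q x - \<zeta> s x) \<le> \<eta>"
  shows "norm ((Q ^^ n) x - \<zeta> (real n * s) x) \<le> real n * \<eta> * exp (L * (real n * \<bar>s\<bar>))"
proof (induction n)
  case 0
  then show ?case by (simp add: is_flow_0[OF Z(2)])
next
  case (Suc n)
  define y z where "y = (Q ^^ n) x" and "z = \<zeta> (real n * s) x"
  let ?E = "exp (L * (real (Suc n) * \<bar>s\<bar>))"
  have "norm (\<zeta> s y - \<zeta> s z) \<le> exp (L * \<bar>s\<bar>) * (real n * \<eta> * exp (L * (real n * \<bar>s\<bar>)))"
    using L[of s y z] Suc.IH[folded y_def z_def]
    by (meson exp_ge_zero mult_left_mono order_trans)
  also have "\<dots> = real n * \<eta> * ?E"
    by (simp add: distrib_right distrib_left exp_add mult_ac)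
  finally have "norm (\<zeta> s y - \<zeta> s z) \<le> real n * \<eta> * ?E" .
  moreover have "norm (Q y - \<zeta> s y) \<le> \<eta> * ?E"
    using Q[of y] mult_left_mono[of 1 ?E \<eta>] assms(3,4) by simp
  moreover have "norm (Q y - \<zeta> s z) \<le> norm (Q y - \<zeta> s y) + norm (\<zeta> s y - \<zeta> s z)"
    using norm_triangle_ineq[of "Q y - \<zeta> s y" "\<zeta> s y - \<zeta> s z"] by simp
  moreover have "\<zeta> s z = \<zeta> (real (Suc n) * s) x"
    unfolding z_def by (simp add: flow_add[OF Z] algebra_simps)
  moreover have "(Q ^^ Suc n) x = Q y" by (simp add: y_def)
  ultimately show ?case by (simp add: algebra_simps)
qed

text \<open>\<open>sqrt\<close> is odd on the reals, so \<open>h = sqrt \<bar>s\<bar>\<close> and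
  \<open>k = sqrt s\<close> satisfy \<open>h * k = s\<close> for both signs of \<open>s\<close>; one
  continuous formula covers positive and negative times. The cubic remainder becomes of order 3/2 in
  \<open>\<bar>s\<bar>\<close>, small enough to be summed over 1/|s| steps.\<close>

lemma flow_commutator_flow:
  fixes X Y :: "'a::euclidean_space \<Rightarrow> 'a"
  assumes X: "test_map X" "is_flow X \<phi>" and Y: "test_map Y" "is_flow Y \<psi>"
    and \<zeta>: "is_flow (lie_bracket X Y) \<zeta>"
  obtains C where "C \<ge> 0"
    "\<And>s x. \<bar>s\<bar> \<le> 1 \<Longrightarrow>
      norm (flow_commutator \<phi> \<psi> (sqrt \<bar>s\<bar>) (sqrt s) x - \<zeta> s x) \<le> C * (\<bar>s\<bar> * sqrt \<bar>s\<bar>)"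
proof -
  obtain C1 where C1: "C1 \<ge> 0"
    "\<And>h k x. \<bar>h\<bar> \<le> 1 \<Longrightarrow> \<bar>k\<bar> = \<bar>h\<bar> \<Longrightarrow>
      norm (flow_commutator \<phi> \<psi> h k x - x - (h * k) *\<^sub>R lie_bracket X Y x) \<le> C1 * \<bar>h\<bar> ^ 3"
    using flow_commutator_taylor[OF X Y] by blast
  obtain C2 where C2: "C2 \<ge> 0" "\<And>t x. norm (\<zeta> t x - x - t *\<^sub>R lie_bracket X Y x) \<le> C2 * \<bar>t\<bar> ^ 2"
    using flow_euler[OF test_map_lie_bracket[OF X(1) Y(1)] \<zeta>] by blast
  show ?thesis
  proof (rule that[of "C1 + C2"])
    fix s :: real and x assume s: "\<bar>s\<bar> \<le> 1"
    have h1: "sqrt \<bar>s\<bar> \<le> 1" using s by simp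
    have sq: "sqrt \<bar>s\<bar> * sqrt \<bar>s\<bar> = \<bar>s\<bar>" by simp
    have abs: "\<bar>sqrt s\<bar> = sqrt \<bar>s\<bar>" by (simp add: abs_if real_sqrt_minus)
    have hk: "sqrt \<bar>s\<bar> * sqrt s = s"
      using sq by (cases "s \<ge> 0") (auto simp: real_sqrt_minus abs_if)
    have "sqrt \<bar>s\<bar> ^ 3 = \<bar>s\<bar> * sqrt \<bar>s\<bar>" by (simp add: power3_eq_cube)
    then have 1: "norm (flow_commutator \<phi> \<psi> (sqrt \<bar>s\<bar>) (sqrt s) x - x - s *\<^sub>R lie_bracket X Y x)
        \<le> C1 * (\<bar>s\<bar> * sqrt \<bar>s\<bar>)"
      using C1(2)[of "sqrt \<bar>s\<bar>" "sqrt s" x] h1 abs hk by simp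
    have "\<bar>s\<bar> \<le> sqrt \<bar>s\<bar>" using mult_right_mono[OF h1, of "sqrt \<bar>s\<bar>"] sq by simp
    then have "C2 * \<bar>s\<bar> ^ 2 \<le> C2 * (\<bar>s\<bar> * sqrt \<bar>s\<bar>)"
      unfolding power2_eq_square by (intro mult_left_mono C2) auto
    then have 2: "norm (\<zeta> s x - x - s *\<^sub>R lie_bracket X Y x) \<le> C2 * (\<bar>s\<bar> * sqrt \<bar>s\<bar>)"
      using C2(2)[of s x] by linarith
    show "norm (flow_commutator \<phi> \<psi> (sqrt \<bar>s\<bar>) (sqrt s) x - \<zeta> s x) \<le> (C1 + C2) * (\<bar>s\<bar> * sqrt \<bar>s\<bar>)"
      using norm_triangle_le_diff[OF add_mono[OF 1 2]] by (simp add: distrib_right)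
  qed (use C1 C2 in auto)
qed

text \<open>Each of the four factors adds a fresh error \<open>\<delta>\<close> and stretches the
  previous error by at most \<open>E\<close>; bounding all contributions by the highest power gives
  \<open>4 * E ^ 3\<close>.\<close>

lemma flow_commutator_perturb:
  fixes \<phi> \<psi> P Q :: "real \<Rightarrow> 'a::euclidean_space \<Rightarrow> 'a"
  assumes E: "1 \<le> E" "0 \<le> \<delta>"
    and \<phi>: "\<And>t x y. \<bar>t\<bar> \<le> 1 \<Longrightarrow> norm (\<phi> t x - \<phi> t y) \<le> E * norm (x - y)"
    and \<psi>: "\<And>t x y. \<bar>t\<bar> \<le> 1 \<Longrightarrow> norm (\<psi> t x - \<psi> t y) \<le> E * norm (x - y)"
    and P: "\<And>t x. \<bar>t\<bar> \<le> 1 \<Longrightarrow> norm (P t x - \<phi> t x) \<le> \<delta>"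
    and Q: "\<And>t x. \<bar>t\<bar> \<le> 1 \<Longrightarrow> norm (Q t x - \<psi> t x) \<le> \<delta>"
    and hk: "\<bar>h\<bar> \<le> 1" "\<bar>k\<bar> \<le> 1"
  shows "norm (flow_commutator P Q h k x - flow_commutator \<phi> \<psi> h k x) \<le> 4 * E ^ 3 * \<delta>"
proof -
  have step: "norm (P' t x - \<phi>' t y) \<le> \<delta> + E * norm (x - y)"
    if "norm (P' t x - \<phi>' t x) \<le> \<delta>" "norm (\<phi>' t x - \<phi>' t y) \<le> E * norm (x - y)" for P' \<phi>' :: "real \<Rightarrow> 'a \<Rightarrow> 'a" and t x y
    using that norm_triangle_ineq[of "P' t x - \<phi>' t x" "\<phi>' t x - \<phi>' t y"] by simp
  have grow: "\<delta> + E * u \<le> c * E ^ Suc n * \<delta> + E ^ Suc n * \<delta>" if "u \<le> c * E ^ n * \<delta>" for u c n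
  proof -
    have "E * u \<le> E * (c * E ^ n * \<delta>)" using that E by (intro mult_left_mono) auto
    moreover have "1 * \<delta> \<le> E ^ Suc n * \<delta>" using E by (intro mult_right_mono one_le_power) auto
    ultimately show ?thesis by (simp add: mult_ac)
  qed
  define a a' where "a = \<phi> h x" and "a' = P h x"
  define b b' where "b = \<psi> k a" and "b' = Q k a'"
  define c c' where "c = \<phi> (- h) b" and "c' = P (- h) b'"
  have 1: "norm (a' - a) \<le> 1 * E ^ 0 * \<delta>" unfolding a_def a'_def using P hk by simp
  have "norm (b' - b) \<le> \<delta> + E * norm (a' - a)"
    unfolding b_def b'_def by (intro step Q \<psi> hk)
  with grow[OF 1] have 2: "norm (b' - b) \<le> 2 * E ^ 1 * \<delta>" by simp
  have "norm (c' - c) \<le> \<delta> + E * norm (b' - b)"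
    unfolding c_def c'_def by (intro step P \<phi>) (use hk in auto)
  with grow[OF 2] have 3: "norm (c' - c) \<le> 3 * E ^ 2 * \<delta>" by (simp add: numeral_2_eq_2)
  have "norm (Q (- k) c' - \<psi> (- k) c) \<le> \<delta> + E * norm (c' - c)"
    by (intro step Q \<psi>) (use hk in auto)
  with grow[OF 3] have 4: "norm (Q (- k) c' - \<psi> (- k) c) \<le> 4 * E ^ 3 * \<delta>"
    by (simp add: numeral_3_eq_3 numeral_2_eq_2)
  then show ?thesis
    by (simp add: flow_commutator_def a_def a'_def b_def b'_def c_def c'_def)
qed

text \<open>The order of choices matters: the step number \<open>N\<close> comes first, so that
  \<open>N\<close> commutator errors of order 3/2 in \<open>1 / N\<close> add up to at most
  \<open>\<epsilon> / 2\<close>; the accuracy \<open>\<delta>\<close> demanded of the approximations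
  of the two flows is then fitted to this \<open>N\<close>.\<close>

lemma reach_approx_lie_bracket:
  fixes X Y :: "'a::euclidean_space \<Rightarrow> 'a"
  assumes R: "refl R" "trans R"
    and X: "test_map X" "is_flow X \<phi>" "reach_approx R \<phi>"
    and Y: "test_map Y" "is_flow Y \<psi>" "reach_approx R \<psi>"
    and \<zeta>: "is_flow (lie_bracket X Y) \<zeta>"
  shows "reach_approx R \<zeta>"
  unfolding reach_approx_def
proof (intro allI impI)
  fix \<epsilon> :: real assume \<epsilon>: "\<epsilon> > 0"
  note Z = test_map_lie_bracket[OF X(1) Y(1)] \<zeta>
  obtain C where C: "C \<ge> 0" "\<And>s x. \<bar>s\<bar> \<le> 1 \<Longrightarrow>
      norm (flow_commutator \<phi> \<psi> (sqrt \<bar>s\<bar>) (sqrt s) x - \<zeta> s x) \<le> C * (\<bar>s\<bar> * sqrt \<bar>s\<bar>)"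
    using flow_commutator_flow[OF X(1,2) Y(1,2) \<zeta>] by blast
  obtain L1 where L1: "L1 \<ge> 0" "\<And>t x y. norm (\<phi> t x - \<phi> t y) \<le> exp (L1 * \<bar>t\<bar>) * norm (x - y)"
    using flow_lipschitz[OF X(1,2)] by blast
  obtain L2 where L2: "L2 \<ge> 0" "\<And>t x y. norm (\<psi> t x - \<psi> t y) \<le> exp (L2 * \<bar>t\<bar>) * norm (x - y)"
    using flow_lipschitz[OF Y(1,2)] by blast
  obtain L where L: "L \<ge> 0" "\<And>t x y. norm (\<zeta> t x - \<zeta> t y) \<le> exp (L * \<bar>t\<bar>) * norm (x - y)"
    using flow_lipschitz[OF Z] by blast
  define E where "E = exp (max L1 L2)"
  have E: "1 \<le> E" using L1(1) by (simp add: E_def le_max_iff_disj)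
  have expE: "exp (l * \<bar>t\<bar>) * norm v \<le> E * norm v"
    if "\<bar>t\<bar> \<le> 1" "l = L1 \<or> l = L2" for t l and v :: 'a
  proof -
    have "l * \<bar>t\<bar> \<le> max L1 L2 * 1"
      using that L1 L2 by (intro mult_mono) auto
    then show ?thesis unfolding E_def by (intro mult_right_mono) auto
  qed
  have LE: "norm (\<phi> t x - \<phi> t y) \<le> E * norm (x - y)" "norm (\<psi> t x - \<psi> t y) \<le> E * norm (x - y)"
    if "\<bar>t\<bar> \<le> 1" for t x y
    using L1(2)[of t x y] L2(2)[of t x y] expE[OF that, of L1 "x - y"] expE[OF that, of L2 "x - y"] by auto
  define K where "K = exp L * C"
  obtain N :: nat where N: "N > 0" "K / sqrt N \<le> \<epsilon> / 2"
  proof -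
    obtain N :: nat where N: "(2 * K / \<epsilon>)\<^sup>2 + 1 \<le> real N" using real_arch_simple by blast
    then have "2 * K / \<epsilon> \<le> sqrt N" by (intro real_le_rsqrt) auto
    moreover have "real N > 0" using N by (smt (verit) zero_le_power2)
    ultimately show ?thesis using that[of N] \<epsilon> by (simp add: field_simps)
  qed
  define \<delta> where "\<delta> = \<epsilon> / 2 / (exp L * (real N * (4 * E ^ 3)))"
  have \<delta>: "\<delta> > 0" using \<epsilon> N E by (simp add: \<delta>_def)
  obtain P where P: "continuous_on UNIV (\<lambda>(t, x). P t x)" "\<And>t x. (x, P t x) \<in> R"
      "\<And>t x. \<bar>t\<bar> \<le> 1 \<Longrightarrow> norm (P t x - \<phi> t x) \<le> \<delta>"
    using X(3) \<delta> unfolding reach_approx_def by meson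
  obtain Q where Q: "continuous_on UNIV (\<lambda>(t, x). Q t x)" "\<And>t x. (x, Q t x) \<in> R"
      "\<And>t x. \<bar>t\<bar> \<le> 1 \<Longrightarrow> norm (Q t x - \<psi> t x) \<le> \<delta>"
    using Y(3) \<delta> unfolding reach_approx_def by meson
  define G where "G s = flow_commutator P Q (sqrt \<bar>s\<bar>) (sqrt s)" for s
  define W where "W t x = (G (t / real N) ^^ N) x" for t x
  have "continuous_on UNIV (\<lambda>p. (G (fst p / real N) ^^ n) (snd p))" for n
    by (induction n)
       (use N in \<open>auto simp: G_def flow_commutator_def
         intro!: continuous_on_apply2[OF P(1)] continuous_on_apply2[OF Q(1)] continuous_intros\<close>)
  then have "continuous_on UNIV (\<lambda>(t, x). W t x)" by (simp add: W_def case_prod_beta')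
  moreover have "(x, W t x) \<in> R" for t x
  proof -
    have "(y, G s y) \<in> R" for s y
      unfolding G_def flow_commutator_def by (meson P(2) Q(2) transD[OF R(2)])
    then have "(y, (G s ^^ n) y) \<in> R" for s y n
      by (induction n) (auto intro: reflD[OF R(1)] transD[OF R(2)])
    then show ?thesis by (simp add: W_def)
  qed
  moreover have "norm (W t x - \<zeta> t x) \<le> \<epsilon>" if t: "\<bar>t\<bar> \<le> 1" for t x
  proof -
    define s where "s = t / real N"
    define \<eta> where "\<eta> = C * (\<bar>s\<bar> * sqrt \<bar>s\<bar>) + 4 * E ^ 3 * \<delta>"
    have Nt: "real N * s = t" "real N * \<bar>s\<bar> = \<bar>t\<bar>" using N by (auto simp: s_def)
    have s1: "\<bar>s\<bar> \<le> 1 / real N" using t N by (simp add: s_def divide_right_mono)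
    also have "1 / real N \<le> 1" using N by simp
    finally have s: "\<bar>s\<bar> \<le> 1" .
    have \<eta>: "0 \<le> \<eta>" using C(1) E \<delta> by (simp add: \<eta>_def)
    have "norm (G s x - \<zeta> s x) \<le> \<eta>" for x
    proof -
      have sq: "\<bar>sqrt \<bar>s\<bar>\<bar> \<le> 1" "\<bar>sqrt s\<bar> \<le> 1"
        using s by (auto simp: abs_if real_sqrt_minus[symmetric] split: if_splits)
      have "norm (G s x - flow_commutator \<phi> \<psi> (sqrt \<bar>s\<bar>) (sqrt s) x) \<le> 4 * E ^ 3 * \<delta>"
        unfolding G_def
        by (rule flow_commutator_perturb[OF E less_imp_le[OF \<delta>] LE P(3) Q(3) sq])
      then show ?thesis
        using C(2)[OF s, of x] unfolding \<eta>_def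
        using norm_triangle_ineq[of "G s x - flow_commutator \<phi> \<psi> (sqrt \<bar>s\<bar>) (sqrt s) x"
            "flow_commutator \<phi> \<psi> (sqrt \<bar>s\<bar>) (sqrt s) x - \<zeta> s x"] by simp
    qed
    from euler_scheme[OF Z L(1) \<eta> L(2) this, of N x]
    have "norm (W t x - \<zeta> t x) \<le> real N * \<eta> * exp (L * \<bar>t\<bar>)"
      by (simp add: W_def Nt s_def[symmetric])
    also have "\<dots> \<le> real N * \<eta> * exp L"
      using L(1) t \<eta> mult_left_mono[of "\<bar>t\<bar>" 1 L] by (intro mult_left_mono) auto
    also have "\<dots> = K * (real N * \<bar>s\<bar> * sqrt \<bar>s\<bar>) + exp L * (real N * (4 * E ^ 3)) * \<delta>"
      by (simp add: \<eta>_def K_def algebra_simps)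
    also have "exp L * (real N * (4 * E ^ 3)) * \<delta> = \<epsilon> / 2"
      using E N by (simp add: \<delta>_def)
    also have "K * (real N * \<bar>s\<bar> * sqrt \<bar>s\<bar>) \<le> K * (1 * sqrt (1 / real N))"
      unfolding Nt using s1 t C(1) by (intro mult_left_mono mult_mono) (auto simp: K_def)
    also have "\<dots> \<le> \<epsilon> / 2" using N by (simp add: real_sqrt_divide)
    finally show ?thesis by simp
  qed
  ultimately show "\<exists>P. continuous_on UNIV (\<lambda>(t, x). P t x) \<and> (\<forall>t x. (x, P t x) \<in> R) \<and>
     (\<forall>t x. \<bar>t\<bar> \<le> 1 \<longrightarrow> norm (P t x - \<zeta> t x) \<le> \<epsilon>)" by blast
qed

section \<open>Chow's theorem for compactly supported fields\<close>

text \<open>Flows along the \<open>Z i\<close> are composed one index at a time; at scale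
  \<open>r\<close> their linear terms dominate and the remaining flow terms are O(r^2).
  \<open>F\<close> depends on \<open>r\<close> because the attainable substitute for a flow must
  itself be accurate to order \<open>\<epsilon> * r\<close>.\<close>

lemma attainable_linear_approx:
  fixes x0 :: "'a::euclidean_space" and c :: "'i \<Rightarrow> 'a \<Rightarrow> real"
  assumes R: "refl R" "trans R" and "finite I"
    and Z: "\<And>i. i \<in> I \<Longrightarrow> test_map (Z i)" "\<And>i. i \<in> I \<Longrightarrow> is_flow (Z i) (\<phi> i)"
      "\<And>i. i \<in> I \<Longrightarrow> reach_approx R (\<phi> i)"
    and c: "\<And>i. i \<in> I \<Longrightarrow> bounded_linear (c i)"
    and "\<epsilon> > 0"
  shows "\<exists>r0>0. \<forall>r. 0 < r \<and> r \<le> r0 \<longrightarrow> (\<exists>F. continuous_on UNIV F \<and> (\<forall>y. (x0, F y) \<in> R) \<and>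
    (\<forall>y. norm y \<le> r \<longrightarrow> norm (F y - x0 - (\<Sum>i\<in>I. c i y *\<^sub>R Z i x0)) \<le> \<epsilon> * r))"
  using assms(3,4-)
proof (induction I arbitrary: \<epsilon> rule: finite_induct)
  case empty
  show ?case
    by (intro exI[of _ 1] conjI allI impI exI[of _ "\<lambda>y. x0"])
       (use empty R in \<open>auto simp: refl_on_def\<close>)
next
  case (insert i I)
  define S where "S y = (\<Sum>j\<in>I. c j y *\<^sub>R Z j x0)" for y
  have Zi: "test_map (Z i)" "is_flow (Z i) (\<phi> i)" "reach_approx R (\<phi> i)" "bounded_linear (c i)"
    using insert.prems by auto
  have "bounded_linear S" unfolding S_def
    by (intro bounded_linear_sum bounded_linear_scaleR_const) (use insert.prems in auto)
  then obtain B where B: "B \<ge> 0" "\<And>y. norm (S y) \<le> norm y * B"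
    using bounded_linear.nonneg_bounded by blast
  obtain K where K: "K \<ge> 0" "\<And>y. norm (c i y) \<le> norm y * K"
    using bounded_linear.nonneg_bounded[OF Zi(4)] by blast
  obtain C where C: "C \<ge> 0" "\<And>t x. norm (\<phi> i t x - x - t *\<^sub>R Z i x) \<le> C * \<bar>t\<bar> ^ 2"
    using flow_euler[OF Zi(1,2)] by blast
  obtain L where L: "L \<ge> 0" "\<And>x y. norm (Z i x - Z i y) \<le> L * norm (x - y)"
    using test_map_lipschitz[OF Zi(1)] by blast
  have "\<epsilon> / 4 > 0" using insert.prems by simp
  then obtain r1 where r1: "r1 > 0" "\<And>r. 0 < r \<Longrightarrow> r \<le> r1 \<Longrightarrow>
      \<exists>F. continuous_on UNIV F \<and> (\<forall>y. (x0, F y) \<in> R) \<and>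
        (\<forall>y. norm y \<le> r \<longrightarrow> norm (F y - x0 - S y) \<le> \<epsilon> / 4 * r)"
    using insert.IH[of "\<epsilon> / 4"] insert.prems unfolding S_def by auto
  \<comment> \<open>Coefficient of the quadratic error: the Euler remainder of the new flow, and the
    change of \<open>Z i\<close> between \<open>x0\<close> and \<open>F y\<close>.\<close>
  define A where "A = C * K\<^sup>2 + K * L * (\<epsilon> / 4 + B)"
  have A: "A \<ge> 0" using C K L B insert.prems by (simp add: A_def)
  \<comment> \<open>The bound \<open>1 / (K + 1)\<close> keeps the flow time \<open>c i y\<close> in
    [-1, 1], where the approximation is valid; the last bound makes \<open>A * r\<close> at most
    \<open>\<epsilon> / 2\<close>.\<close>
  define r0 where "r0 = min r1 (min (1 / (K + 1)) (\<epsilon> / 2 / (A + 1)))"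
  have r0: "r0 > 0" using r1 K A insert.prems by (simp add: r0_def)
  show ?case
  proof (intro exI[of _ r0] conjI r0 allI impI)
    fix r assume r: "0 < r \<and> r \<le> r0"
    have Kr: "r * K \<le> 1"
    proof -
      have "r * K \<le> 1 / (K + 1) * (K + 1)" using r K by (intro mult_mono) (auto simp: r0_def)
      then show ?thesis using K by simp
    qed
    have Ar: "A * r \<le> \<epsilon> / 2"
    proof -
      have "A * r \<le> (A + 1) * (\<epsilon> / 2 / (A + 1))" using r A by (intro mult_mono) (auto simp: r0_def)
      moreover have "(A + 1) * (\<epsilon> / 2 / (A + 1)) = \<epsilon> / 2" using A by (simp add: field_simps)
      ultimately show ?thesis by linarith
    qed
    obtain F where F: "continuous_on UNIV F" "\<And>y. (x0, F y) \<in> R"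
        "\<And>y. norm y \<le> r \<Longrightarrow> norm (F y - x0 - S y) \<le> \<epsilon> / 4 * r"
      using r1(2)[of r] r by (auto simp: r0_def)
    have "\<epsilon> / 4 * r > 0" using r insert.prems by simp
    then obtain P where P: "continuous_on UNIV (\<lambda>(t, x). P t x)" "\<And>t x. (x, P t x) \<in> R"
        "\<And>t x. \<bar>t\<bar> \<le> 1 \<Longrightarrow> norm (P t x - \<phi> i t x) \<le> \<epsilon> / 4 * r"
      using Zi(3) unfolding reach_approx_def by meson
    define G where "G y = P (c i y) (F y)" for y
    have "continuous_on UNIV G" unfolding G_def
      by (intro continuous_on_apply2[OF P(1)] F(1) linear_continuous_on Zi(4))
    moreover have "(x0, G y) \<in> R" for y
      unfolding G_def using transD[OF R(2) F(2) P(2)] .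
    moreover have "norm (G y - x0 - (\<Sum>j\<in>insert i I. c j y *\<^sub>R Z j x0)) \<le> \<epsilon> * r" if y: "norm y \<le> r" for y
    proof -
      define t where "t = c i y"
      have "norm y * K \<le> r * K" using y K by (intro mult_right_mono) auto
      then have t: "\<bar>t\<bar> \<le> r * K" using K(2)[of y] by (simp add: t_def)
      have FS: "norm (F y - x0) \<le> (\<epsilon> / 4 + B) * r"
      proof -
        have "norm y * B \<le> r * B" using y B by (intro mult_right_mono) auto
        then have "norm (S y) \<le> B * r" using B(2)[of y] by (simp add: mult.commute)
        then show ?thesis
          using F(3)[OF y] norm_triangle_ineq[of "F y - x0 - S y" "S y"] by (simp add: algebra_simps)
      qed
      have 1: "norm (P t (F y) - \<phi> i t (F y)) \<le> \<epsilon> / 4 * r" using P(3) t Kr by simp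
      have 2: "norm (\<phi> i t (F y) - F y - t *\<^sub>R Z i (F y)) \<le> C * (r * K)\<^sup>2"
      proof -
        have "C * \<bar>t\<bar> ^ 2 \<le> C * (r * K)\<^sup>2" using t C by (intro mult_left_mono power_mono) auto
        then show ?thesis using C(2)[of t "F y"] by linarith
      qed
      have 3: "norm (F y - x0 - S y) \<le> \<epsilon> / 4 * r" by (rule F(3)[OF y])
      have 4: "norm (t *\<^sub>R (Z i (F y) - Z i x0)) \<le> (r * K) * (L * ((\<epsilon> / 4 + B) * r))"
      proof -
        have "norm (Z i (F y) - Z i x0) \<le> L * ((\<epsilon> / 4 + B) * r)"
          using order_trans[OF L(2) mult_left_mono[OF FS L(1)]] .
        then show ?thesis using t K r by (auto intro!: mult_mono)
      qed
      have "G y - x0 - (\<Sum>j\<in>insert i I. c j y *\<^sub>R Z j x0) = (P t (F y) - \<phi> i t (F y))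
        + (\<phi> i t (F y) - F y - t *\<^sub>R Z i (F y)) + (F y - x0 - S y) + t *\<^sub>R (Z i (F y) - Z i x0)"
        using insert.hyps by (simp add: G_def S_def t_def algebra_simps)
      then have "norm (G y - x0 - (\<Sum>j\<in>insert i I. c j y *\<^sub>R Z j x0))
          \<le> \<epsilon> / 4 * r + C * (r * K)\<^sup>2 + \<epsilon> / 4 * r + (r * K) * (L * ((\<epsilon> / 4 + B) * r))"
        by (simp only:) (intro norm_triangle_mono 1 2 3 4)
      also have "\<dots> = \<epsilon> / 2 * r + (A * r) * r"
        by (simp add: A_def power2_eq_square algebra_simps)
      also have "\<dots> \<le> \<epsilon> / 2 * r + \<epsilon> / 2 * r"
        using Ar r by (intro add_mono mult_right_mono) auto
      finally show ?thesis by simp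
    qed
    ultimately show "\<exists>F. continuous_on UNIV F \<and> (\<forall>y. (x0, F y) \<in> R) \<and>
      (\<forall>y. norm y \<le> r \<longrightarrow> norm (F y - x0 - (\<Sum>j\<in>insert i I. c j y *\<^sub>R Z j x0)) \<le> \<epsilon> * r)" by blast
  qed
qed

lemma attainable_neighbourhood:
  fixes x0 :: "'a::euclidean_space"
  assumes R: "refl R" "trans R"
    and Z: "\<And>Z. Z \<in> \<Z> \<Longrightarrow> test_map Z" "\<And>Z. Z \<in> \<Z> \<Longrightarrow> \<exists>\<phi>. is_flow Z \<phi> \<and> reach_approx R \<phi>"
    and span: "span ((\<lambda>Z. Z x0) ` \<Z>) = UNIV"
  shows "\<exists>r>0. ball x0 r \<subseteq> R `` {x0}"
proof -
  obtain B where B: "B \<subseteq> (\<lambda>Z. Z x0) ` \<Z>" "independent B" "span B = UNIV"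
    using maximal_independent_subset[of "(\<lambda>Z. Z x0) ` \<Z>"] span
    by (metis span_mono span_span top.extremum_unique)
  have fin: "finite B" using B(2) independent_imp_finite by blast
  have "\<forall>b\<in>B. \<exists>Z \<phi>. Z \<in> \<Z> \<and> Z x0 = b \<and> is_flow Z \<phi> \<and> reach_approx R \<phi>"
    using B(1) Z(2) by blast
  then obtain Y \<phi> where Y: "\<And>b. b \<in> B \<Longrightarrow> Y b \<in> \<Z> \<and> Y b x0 = b \<and> is_flow (Y b) (\<phi> b) \<and> reach_approx R (\<phi> b)"
    by metis
  \<comment> \<open>Coordinates in a basis formed by values at \<open>x0\<close> serve as flow
    times, so the linear part of the composed map is the identity.\<close>
  have lin: "bounded_linear (\<lambda>y. representation B y b)" for b
    unfolding linear_conv_bounded_linear[symmetric]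
    by (rule linearI) (auto simp: representation_add[OF B(2)] representation_scale[OF B(2)] B(3))
  have repr: "(\<Sum>b\<in>B. representation B y b *\<^sub>R Y b x0) = y" for y
  proof -
    have "(\<Sum>b\<in>B. representation B y b *\<^sub>R Y b x0) = (\<Sum>b\<in>B. representation B y b *\<^sub>R b)"
      using Y by (intro sum.cong) auto
    also have "\<dots> = y" by (rule sum_representation_eq) (use B fin in auto)
    finally show ?thesis .
  qed
  obtain r where r: "r > 0" and ex: "\<exists>F. continuous_on UNIV F \<and> (\<forall>y. (x0, F y) \<in> R) \<and>
      (\<forall>y. norm y \<le> r \<longrightarrow> norm (F y - x0 - (\<Sum>b\<in>B. representation B y b *\<^sub>R Y b x0)) \<le> 1 / 2 * r)"
    using attainable_linear_approx[OF R fin, of Y \<phi> "\<lambda>b y. representation B y b" "1 / 2" x0] Y Z(1) lin by auto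
  then obtain F where F: "continuous_on UNIV F" "\<And>y. (x0, F y) \<in> R"
      "\<And>y. norm y \<le> r \<Longrightarrow> norm (F y - x0 - y) \<le> 1 / 2 * r"
    unfolding repr by blast
  have "p \<in> R `` {x0}" if p: "p \<in> ball x0 (r / 2)" for p
  proof -
    \<comment> \<open>Fixed points of \<open>f\<close> are the solutions of \<open>F y = p\<close>.
      The approximation error and the distance from \<open>p\<close> to \<open>x0\<close> are each
      at most \<open>r / 2\<close>, so \<open>f\<close> maps the ball of radius \<open>r\<close>
      into itself.\<close>
    define f where "f y = y - (F y - x0) + (p - x0)" for y
    have "continuous_on (cball 0 r) f"
      unfolding f_def by (intro continuous_intros continuous_on_subset[OF F(1)]) auto
    moreover have "f \<in> cball 0 r \<rightarrow> cball 0 r"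
    proof
      fix y :: 'a assume "y \<in> cball 0 r"
      then have "norm (F y - x0 - y) \<le> 1 / 2 * r" using F(3) by simp
      moreover have "norm (p - x0) \<le> 1 / 2 * r" using p by (simp add: dist_norm norm_minus_commute)
      moreover have "f y = (p - x0) - (F y - x0 - y)" by (simp add: f_def)
      ultimately have "norm (f y) \<le> r"
        using norm_triangle_ineq4[of "p - x0" "F y - x0 - y"] by simp
      then show "f y \<in> cball 0 r" by simp
    qed
    ultimately obtain y where "f y = y"
      using brouwer_ball[of r 0 f] r by auto
    then have "F y = p" by (simp add: f_def)
    then show ?thesis using F(2)[of y] by auto
  qed
  then show ?thesis using r by (intro exI[of _ "r / 2"]) auto
qed

section \<open>Attainability by arcs of the fields\<close>

definition attain_step :: "('a::real_normed_vector \<Rightarrow> 'a) set \<Rightarrow> 'a set \<Rightarrow> ('a \<times> 'a) set" where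
  "attain_step F W = {(p, q). \<exists>X\<in>F. \<exists>c T y. 0 \<le> T \<and> y 0 = p \<and> y T = q \<and>
     (\<forall>t\<in>{0..T}. y t \<in> W \<and> (y has_vector_derivative c *\<^sub>R X (y t)) (at t within {0..T}))}"

lemma attain_step_global:
  assumes "X \<in> F" "\<And>t. (y has_vector_derivative X (y t)) (at t)" "\<And>t. y t \<in> W"
  shows "(y 0, y T) \<in> attain_step F W"
proof -
  \<comment> \<open>Rescaling to the unit interval moves \<open>T\<close> into the scalar factor, so
    negative times are covered as well.\<close>
  have "((\<lambda>t. y (T * t + 0)) has_vector_derivative T *\<^sub>R X (y (T * t))) (at t within {0..1})" for t
    by (rule has_vector_derivative_at_within, rule has_vector_derivative_affine) (simp add: assms(2))
  then have "\<exists>X\<in>F. \<exists>c S w. 0 \<le> S \<and> w 0 = y 0 \<and> w S = y T \<and>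
     (\<forall>t\<in>{0..S}. w t \<in> W \<and> (w has_vector_derivative c *\<^sub>R X (w t)) (at t within {0..S}))"
    using assms(1,3)
    by (intro bexI[of _ X] exI[of _ T] exI[of _ 1] exI[of _ "\<lambda>t. y (T * t + 0)"]) auto
  then show ?thesis by (simp add: attain_step_def)
qed

text \<open>The scalar \<open>c\<close> may have either sign, so the reversed arc follows the same
  field with factor \<open>- c\<close>. This is where the absence of drift enters.\<close>

lemma attain_step_sym: "(p, q) \<in> attain_step F W \<Longrightarrow> (q, p) \<in> attain_step F W"
proof -
  assume "(p, q) \<in> attain_step F W"
  then obtain X c T y where *: "X \<in> F" "0 \<le> T" "y 0 = p" "y T = q"
     "\<And>t. t \<in> {0..T} \<Longrightarrow> y t \<in> W"
     "\<And>t. t \<in> {0..T} \<Longrightarrow> (y has_vector_derivative c *\<^sub>R X (y t)) (at t within {0..T})"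
    unfolding attain_step_def by fastforce
  have "((\<lambda>t. y (T - t)) has_vector_derivative (- c) *\<^sub>R X (y (T - t))) (at t within {0..T})"
    if "t \<in> {0..T}" for t
  proof -
    have "((\<lambda>t. T - t) has_vector_derivative - 1) (at t within {0..T})"
      by (auto intro!: derivative_eq_intros)
    moreover have "(\<lambda>t. T - t) ` {0..T} = {0..T}" by simp
    ultimately show ?thesis
      using vector_diff_chain_within[of "\<lambda>t. T - t" "- 1" t "{0..T}" y "c *\<^sub>R X (y (T - t))"]
        *(6)[of "T - t"] that by (simp add: o_def)
  qed
  then show ?thesis
    unfolding attain_step_def using *(1-5)
    by (intro CollectI case_prodI bexI[of _ X] exI[of _ "- c"] exI[of _ T] exI[of _ "\<lambda>t. y (T - t)"]) auto
qed

lemma reach_approx_flow: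
  fixes F :: "('a::euclidean_space \<Rightarrow> 'a) set"
  assumes "test_map X" "X \<in> F" "is_flow X \<phi>"
  shows "reach_approx ((attain_step F UNIV)\<^sup>*) \<phi>"
proof -
  have "(x, \<phi> t x) \<in> attain_step F UNIV" for t x
    using attain_step_global[OF assms(2) is_flow_deriv[OF assms(3)], of x UNIV t]
    by (simp add: is_flow_0[OF assms(3)])
  then show ?thesis
    unfolding reach_approx_def
    using flow_continuous[OF assms(1,3)] by (auto intro!: exI[of _ \<phi>])
qed

lemma reach_approx_iterated_brackets:
  fixes F :: "('a::euclidean_space \<Rightarrow> 'a) set"
  assumes "\<And>X. X \<in> F \<Longrightarrow> test_map X" "Z \<in> iterated_brackets F"
  shows "test_map Z \<and> (\<exists>\<phi>. is_flow Z \<phi> \<and> reach_approx ((attain_step F UNIV)\<^sup>*) \<phi>)"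
  using assms(2)
proof induction
  case (field X)
  then show ?case using assms(1) flow_exists reach_approx_flow by metis
next
  case (bracket X Y)
  then obtain \<phi> \<psi> where *: "test_map X" "is_flow X \<phi>" "reach_approx ((attain_step F UNIV)\<^sup>*) \<phi>"
    "test_map Y" "is_flow Y \<psi>" "reach_approx ((attain_step F UNIV)\<^sup>*) \<psi>" by blast
  obtain \<zeta> where "is_flow (lie_bracket X Y) \<zeta>"
    using flow_exists[OF test_map_lie_bracket[OF *(1,4)]] .
  then show ?case
    using reach_approx_lie_bracket[OF refl_rtrancl trans_rtrancl *] test_map_lie_bracket[OF *(1,4)] by blast
qed

lemma chow_compact_support:
  fixes F :: "('a::euclidean_space \<Rightarrow> 'a) set"
  assumes "\<And>X. X \<in> F \<Longrightarrow> test_map X" "span {Z x0 | Z. Z \<in> iterated_brackets F} = UNIV"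
  shows "\<exists>r>0. ball x0 r \<subseteq> (attain_step F UNIV)\<^sup>* `` {x0}"
proof (rule attainable_neighbourhood[OF refl_rtrancl trans_rtrancl])
  show "span ((\<lambda>Z. Z x0) ` iterated_brackets F) = UNIV"
    using assms(2) by (simp add: setcompr_eq_image)
qed (use reach_approx_iterated_brackets[OF assms(1)] in auto)

section \<open>Chow's theorem\<close>

text \<open>The time change \<open>d\<tau> = \<psi> (w t) dt\<close> turns a trajectory of the cut-off field into one of the field.\<close>

lemma attain_step_cutoff:
  fixes X :: "'a::euclidean_space \<Rightarrow> 'a"
  assumes \<psi>: "smooth \<psi>" "\<And>x. \<psi> x > 0 \<longleftrightarrow> x \<in> ball a R" "\<And>x. x \<notin> ball a R \<Longrightarrow> \<psi> x = 0"
    and X: "smooth X" "X \<in> F" and p: "p \<in> ball a R" and "0 \<le> T" and y: "y 0 = p" "y T = q"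
      "\<And>t. t \<in> {0..T} \<Longrightarrow> (y has_vector_derivative c *\<^sub>R \<psi> (y t) *\<^sub>R X (y t)) (at t within {0..T})"
  shows "(p, q) \<in> attain_step F (ball a R) \<and> q \<in> ball a R"
proof -
  define V where "V x = \<psi> x *\<^sub>R (c *\<^sub>R X x)" for x
  have V: "test_map V"
    unfolding V_def
    by (rule test_map_cutoff[OF \<psi>(1,3)])
       (auto intro!: smooth_compose_linear[OF bounded_linear_scaleR_right] X)
  obtain \<zeta> where \<zeta>: "is_flow V \<zeta>" using flow_exists[OF V] .
  define w where "w t = \<zeta> t p" for t
  have w: "(w has_vector_derivative V (w t)) (at t)" for t
    unfolding w_def using is_flow_deriv[OF \<zeta>] .
  have w0: "w 0 = p" by (simp add: w_def is_flow_0[OF \<zeta>])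
  have wT: "w T = q"
  proof -
    obtain L where L: "\<And>x y. norm (V x - V y) \<le> L * norm (x - y)"
      using test_map_lipschitz[OF V] by blast
    have "norm (w T - y T) \<le> exp (L * T) * norm (w 0 - y 0)"
    proof (rule gronwall_dist[where S=UNIV, OF \<open>0 \<le> T\<close> L])
      show "(w has_vector_derivative V (w t)) (at t within {0..T})" for t
        by (rule has_vector_derivative_at_within[OF w])
      show "(y has_vector_derivative V (y t)) (at t within {0..T})" if "t \<in> {0..T}" for t
        using y(3)[OF that] by (simp add: V_def mult.commute)
    qed auto
    then show ?thesis using w0 y by simp
  qed
  \<comment> \<open>Outside the ball the cut-off field vanishes, so a point there is an equilibrium;
    by uniqueness the trajectory through it is constant and cannot have started at
    \<open>p\<close>.\<close>
  have wball: "w t \<in> ball a R" for t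
  proof (rule ccontr)
    assume out: "w t \<notin> ball a R"
    then have "V (w t) = 0" by (simp add: V_def \<psi>(3))
    then have "((\<lambda>s. w t) has_vector_derivative V (w t)) (at s)" for s by simp
    from flow_unique[OF V \<zeta> this, of "- t"] have "w t = \<zeta> (- t) (w t)" .
    also have "\<dots> = p" unfolding w_def by (rule flow_inverse[OF V \<zeta>])
    finally show False using out p by simp
  qed
  define \<tau> where "\<tau> = antideriv (\<lambda>t. \<psi> (w t))"
  have wc: "continuous_on UNIV w"
    using w by (meson continuous_at_imp_continuous_on has_vector_derivative_continuous)
  have \<tau>: "(\<tau> has_real_derivative \<psi> (w t)) (at t)" for t
    unfolding \<tau>_def has_real_derivative_iff_has_vector_derivative
    by (rule antideriv_deriv[OF continuous_on_compose2[OF smooth_continuous[OF \<psi>(1)] wc]]) auto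
  have pos: "\<psi> (w t) > 0" for t using \<psi>(2) wball by blast
  have mono: "\<tau> s < \<tau> t" if "s < t" for s t
    by (rule DERIV_pos_imp_increasing[OF that]) (use \<tau> pos in blast)
  have \<tau>c: "continuous_on UNIV \<tau>"
    using \<tau> DERIV_isCont continuous_at_imp_continuous_on by blast
  have inj: "inj \<tau>" by (rule injI) (metis mono less_irrefl linorder_neqE)
  define g where "g = inv \<tau>"
  have g\<tau>: "g (\<tau> t) = t" for t by (simp add: g_def inj)
  \<comment> \<open>The clock \<open>\<tau>\<close> has the positive derivative
    \<open>\<psi> (w t)\<close>, so its inverse has the reciprocal derivative, which cancels the
    cutoff factor in the velocity.\<close>
  have gd: "(g has_vector_derivative inverse (\<psi> (w t))) (at (\<tau> t))" for t
    unfolding has_vector_derivative_def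
    by (rule has_derivative_inverse_strong[of UNIV t \<tau> g, OF _ _ \<tau>c g\<tau> \<tau>[unfolded has_field_derivative_def]])
       (use pos[of t] in \<open>auto simp: fun_eq_iff\<close>)
  define v where "v s = w (g s)" for s
  have \<tau>0: "\<tau> 0 = 0" by (simp add: \<tau>_def)
  have \<tau>T: "0 \<le> \<tau> T" using mono[of 0 T] \<tau>0 \<open>0 \<le> T\<close> by (cases "T = 0") auto
  have v: "(v has_vector_derivative c *\<^sub>R X (v (\<tau> t))) (at (\<tau> t))" for t
  proof -
    have "(w has_vector_derivative V (w t)) (at (g (\<tau> t)))" by (simp add: g\<tau> w)
    from vector_diff_chain_at[OF gd this]
    have "(v has_vector_derivative inverse (\<psi> (w t)) *\<^sub>R V (w t)) (at (\<tau> t))"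
      by (simp add: v_def[abs_def] o_def)
    moreover have "inverse (\<psi> (w t)) *\<^sub>R V (w t) = c *\<^sub>R X (w t)"
      using pos[of t] by (simp add: V_def mult.assoc[symmetric])
    ultimately show ?thesis by (simp add: v_def g\<tau>)
  qed
  have "(p, q) \<in> attain_step F (ball a R)"
    unfolding attain_step_def
  proof (rule CollectI, rule case_prodI, rule bexI[of _ X], rule exI[of _ c],
      rule exI[of _ "\<tau> T"], rule exI[of _ v], intro conjI ballI)
    show "v 0 = p" using g\<tau>[of 0] \<tau>0 w0 by (simp add: v_def)
    show "v (\<tau> T) = q" using g\<tau>[of T] wT by (simp add: v_def)
    fix s assume s: "s \<in> {0..\<tau> T}"
    show "v s \<in> ball a R" using wball by (simp add: v_def)
    obtain t where "\<tau> t = s"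
      using IVT'[of \<tau> 0 s T] s \<tau>0 \<open>0 \<le> T\<close> continuous_on_subset[OF \<tau>c] by auto
    then show "(v has_vector_derivative c *\<^sub>R X (v s)) (at s within {0..\<tau> T})"
      using v[of t] has_vector_derivative_at_within by metis
  qed (use X \<tau>T in auto)
  then show ?thesis using wball wT by metis
qed

text \<open>The cutoff is 1 on a smaller ball and brackets are local, so the span condition at
  \<open>a\<close> is inherited by the cut-off fields. Their vanishing outside the larger ball is
  what confines the paths to it.\<close>

lemma chow_local:
  fixes F :: "('a::euclidean_space \<Rightarrow> 'a) set"
  assumes F: "\<And>X. X \<in> F \<Longrightarrow> smooth X" "chow_hypothesis F" and "\<rho> > 0"
  shows "\<exists>r>0. ball a r \<subseteq> (attain_step F (ball a \<rho>))\<^sup>* `` {a}"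
proof -
  obtain \<psi> :: "'a \<Rightarrow> real" where \<psi>: "smooth \<psi>" "\<And>x. x \<in> ball a (\<rho> / 2) \<Longrightarrow> \<psi> x = 1"
    "\<And>x. \<psi> x > 0 \<longleftrightarrow> x \<in> ball a \<rho>" "\<And>x. x \<notin> ball a \<rho> \<Longrightarrow> \<psi> x = 0"
    using smooth_cutoff_exists[of "\<rho> / 2" \<rho> a] \<open>\<rho> > 0\<close> by auto
  define F' where "F' = (\<lambda>X x. \<psi> x *\<^sub>R X x) ` F"
  have tm: "test_map X" if "X \<in> F'" for X
    using that F(1) test_map_cutoff[OF \<psi>(1,4)] by (auto simp: F'_def)
  have br: "\<exists>Z'\<in>iterated_brackets F'. \<forall>x\<in>ball a (\<rho> / 2). Z x = Z' x" if "Z \<in> iterated_brackets F" for Z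
    using that
  proof induction
    case (field X)
    then have "(\<lambda>x. \<psi> x *\<^sub>R X x) \<in> iterated_brackets F'"
      by (intro iterated_brackets.field) (simp add: F'_def)
    then show ?case using \<psi>(2) by (intro bexI) auto
  next
    case (bracket X Y)
    then obtain X' Y' where *: "X' \<in> iterated_brackets F'" "\<forall>x\<in>ball a (\<rho> / 2). X x = X' x"
      "Y' \<in> iterated_brackets F'" "\<forall>x\<in>ball a (\<rho> / 2). Y x = Y' x" by blast
    have "lie_bracket X Y x = lie_bracket X' Y' x" if "x \<in> ball a (\<rho> / 2)" for x
      by (rule lie_bracket_cong_open[OF open_ball that]) (use * in auto)
    then show ?case using iterated_brackets.bracket[OF *(1,3)] by blast
  qed
  have "{Z a |Z. Z \<in> iterated_brackets F} \<subseteq> {Z a |Z. Z \<in> iterated_brackets F'}"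
    using br \<open>\<rho> > 0\<close> by fastforce
  from span_mono[OF this] have "span {Z a |Z. Z \<in> iterated_brackets F'} = UNIV"
    using F(2) by (auto simp: chow_hypothesis_def)
  then obtain r where r: "r > 0" "ball a r \<subseteq> (attain_step F' UNIV)\<^sup>* `` {a}"
    using chow_compact_support[of F' a] tm by blast
  have "(a, q) \<in> (attain_step F (ball a \<rho>))\<^sup>* \<and> q \<in> ball a \<rho>" if "(a, q) \<in> (attain_step F' UNIV)\<^sup>*" for q
    using that
  proof induction
    case base
    then show ?case using \<open>\<rho> > 0\<close> by simp
  next
    case (step p q)
    from step(2) obtain X c T y where *: "X \<in> F" "0 \<le> T" "y 0 = p" "y T = q"
     "\<And>t. t \<in> {0..T} \<Longrightarrow> (y has_vector_derivative c *\<^sub>R \<psi> (y t) *\<^sub>R X (y t)) (at t within {0..T})"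
      unfolding attain_step_def F'_def by fastforce
    have "(p, q) \<in> attain_step F (ball a \<rho>) \<and> q \<in> ball a \<rho>"
      using attain_step_cutoff[OF \<psi>(1,3,4) F(1)[OF *(1)] *(1)] * step.IH by blast
    with step.IH show ?case by (meson rtrancl.rtrancl_into_rtrancl)
  qed
  with r show ?thesis by blast
qed

lemma attain_step_mono: "V \<subseteq> W \<Longrightarrow> attain_step F V \<subseteq> attain_step F W"
  unfolding attain_step_def by blast

lemma attain_step_rtrancl_sym: "(p, q) \<in> (attain_step F W)\<^sup>* \<Longrightarrow> (q, p) \<in> (attain_step F W)\<^sup>*"
  by (meson attain_step_sym symD sym_rtrancl symI)

text \<open>By symmetry attainability within \<open>W\<close> is an equivalence relation, and by the
  local result its classes are open; a connected set has only one class.\<close>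

theorem chow_connected:
  fixes F :: "('a::euclidean_space \<Rightarrow> 'a) set"
  assumes F: "\<And>X. X \<in> F \<Longrightarrow> smooth X" "chow_hypothesis F"
    and W: "open W" "connected W" "p \<in> W" "q \<in> W"
  shows "(p, q) \<in> (attain_step F W)\<^sup>*"
proof (rule connected_equivalence_relation[OF W(2-4)])
  fix a assume "a \<in> W"
  then obtain \<rho> where \<rho>: "\<rho> > 0" "ball a \<rho> \<subseteq> W" using W(1) openE by blast
  obtain r where r: "r > 0" "ball a r \<subseteq> (attain_step F (ball a \<rho>))\<^sup>* `` {a}"
    using chow_local[OF F \<rho>(1)] by blast
  have "(attain_step F (ball a \<rho>))\<^sup>* \<subseteq> (attain_step F W)\<^sup>*"
    by (intro rtrancl_mono attain_step_mono \<rho>)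
  with r have "\<forall>x\<in>ball a r \<inter> W. (a, x) \<in> (attain_step F W)\<^sup>*" by blast
  moreover have "openin (top_of_set W) (ball a r \<inter> W)"
    by (simp add: Int_commute openin_open_Int)
  ultimately show "\<exists>T. openin (top_of_set W) T \<and> a \<in> T \<and> (\<forall>x\<in>T. (a, x) \<in> (attain_step F W)\<^sup>*)"
    using r(1) \<open>a \<in> W\<close> by (intro exI[of _ "ball a r \<inter> W"]) auto
qed (auto intro: attain_step_rtrancl_sym rtrancl_trans)

text \<open>At \<open>a\<close> itself all fields may be tangent to the hyperplane, with only a
  bracket transversal, so the point is sought elsewhere on the hyperplane within \<open>W\<close>.
  If there were none, tangency would pass to all brackets and contradict the span at
  \<open>a\<close>.\<close>

lemma chow_transversal_point:
  fixes F :: "('a::euclidean_space \<Rightarrow> 'a) set"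
  assumes F: "\<And>X. X \<in> F \<Longrightarrow> smooth X" "chow_hypothesis F"
    and W: "open W" "a \<in> W" "a \<bullet> \<nu> = d" and "\<nu> \<noteq> 0"
  obtains x X where "x \<in> W" "x \<bullet> \<nu> = d" "X \<in> F" "X x \<bullet> \<nu> \<noteq> 0"
proof (rule ccontr)
  assume "\<not> thesis"
  then have tang: "X x \<bullet> \<nu> = 0" if "X \<in> F" "x \<in> W" "x \<bullet> \<nu> = d" for X x
    using that \<open>\<And>x X. x \<in> W \<Longrightarrow> x \<bullet> \<nu> = d \<Longrightarrow> X \<in> F \<Longrightarrow> X x \<bullet> \<nu> \<noteq> 0 \<Longrightarrow> thesis\<close> by blast
  have "smooth Z \<and> (\<forall>x\<in>W. x \<bullet> \<nu> = d \<longrightarrow> Z x \<bullet> \<nu> = 0)" if "Z \<in> iterated_brackets F" for Z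
    using that
  proof induction
    case (field X)
    then show ?case using F(1) tang by blast
  next
    case (bracket X Y)
    \<comment> \<open>The line from \<open>x\<close> in the tangent direction \<open>X x\<close>
      stays in the hyperplane, where \<open>Y\<close> has no normal component; hence the derivative
      of that component in this direction is 0.\<close>
    have lie0: "lie_deriv X Y x \<bullet> \<nu> = 0"
      if "smooth Y" and X: "\<forall>x\<in>W. x \<bullet> \<nu> = d \<longrightarrow> X x \<bullet> \<nu> = 0" and Y: "\<forall>x\<in>W. x \<bullet> \<nu> = d \<longrightarrow> Y x \<bullet> \<nu> = 0"
        and x: "x \<in> W" "x \<bullet> \<nu> = d" for X Y :: "'a \<Rightarrow> 'a" and x
    proof -
      let ?l = "\<lambda>s. x + s *\<^sub>R X x"
      have "(?l has_derivative (\<lambda>s. s *\<^sub>R X x)) (at 0)"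
        by (auto intro!: derivative_eq_intros)
      moreover have "(Y has_derivative frechet_derivative Y (at x)) (at (?l 0))"
        using smooth_has_derivative[OF \<open>smooth Y\<close>] by simp
      ultimately have "((\<lambda>s. Y (?l s)) has_derivative (\<lambda>s. frechet_derivative Y (at x) (s *\<^sub>R X x))) (at 0)"
        by (rule has_derivative_compose)
      then have d1: "((\<lambda>s. Y (?l s) \<bullet> \<nu>) has_derivative (\<lambda>s. frechet_derivative Y (at x) (s *\<^sub>R X x) \<bullet> \<nu>)) (at 0)"
        by (rule has_derivative_inner_left)
      have "isCont ?l 0" by (intro continuous_intros)
      then have "\<forall>\<^sub>F s in at 0. ?l s \<in> W"
        by (simp add: isCont_def W(1) x(1) topological_tendstoD)
      then obtain e where e: "e > 0" "\<And>s. s \<noteq> 0 \<Longrightarrow> dist s 0 < e \<Longrightarrow> ?l s \<in> W"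
        unfolding eventually_at by auto
      have zero: "Y (?l s) \<bullet> \<nu> = 0" if "s \<in> ball 0 e" for s
      proof -
        have "?l s \<in> W" using e(2)[of s] that x(1) by (cases "s = 0") (auto simp: dist_commute)
        moreover have "?l s \<bullet> \<nu> = d" using X x by (simp add: inner_add_left)
        ultimately show ?thesis using Y by blast
      qed
      have "((\<lambda>s. 0::real) has_derivative (\<lambda>s. 0)) (at 0)" by simp
      then have d2: "((\<lambda>s. Y (?l s) \<bullet> \<nu>) has_derivative (\<lambda>s. 0)) (at 0)"
        by (rule has_derivative_transform_within_open[where s="ball 0 e"]) (use e(1) zero in auto)
      from fun_cong[OF has_derivative_unique[OF d1 d2], of 1] show ?thesis
        by (simp add: lie_deriv_def)
    qed
    have "\<forall>x\<in>W. x \<bullet> \<nu> = d \<longrightarrow> lie_bracket X Y x \<bullet> \<nu> = 0"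
      using lie0[of Y X] lie0[of X Y] bracket.IH by (simp add: lie_bracket_lie_deriv inner_diff_left)
    then show ?case using bracket.IH smooth_lie_bracket by blast
  qed
  then have "{Z a |Z. Z \<in> iterated_brackets F} \<subseteq> {v. \<nu> \<bullet> v = 0}"
    using W(2,3) by (auto simp: inner_commute)
  then have "span {Z a |Z. Z \<in> iterated_brackets F} \<subseteq> {v. \<nu> \<bullet> v = 0}"
    by (rule span_minimal[OF _ subspace_hyperplane])
  then have "\<nu> \<bullet> \<nu> = 0" using F(2) unfolding chow_hypothesis_def by blast
  then show False using \<open>\<nu> \<noteq> 0\<close> by simp
qed

section \<open>Local existence and uniqueness\<close>

text \<open>The flow of a cut-off field is restricted to times spent where the cutoff is 1. The
  solution is two-sided in time because crossing a face requires the approach to a point as well as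
  the departure.\<close>

lemma smooth_local_solution:
  fixes V :: "'a::euclidean_space \<Rightarrow> 'a"
  assumes "smooth V"
  obtains y d where "d > 0" "y 0 = p"
    "\<And>t. t \<in> {-d..d} \<Longrightarrow> (y has_vector_derivative V (y t)) (at t)"
proof -
  obtain \<psi> :: "'a \<Rightarrow> real" where \<psi>: "smooth \<psi>" "\<And>x. x \<in> ball p 1 \<Longrightarrow> \<psi> x = 1"
    "\<And>x. x \<notin> ball p 2 \<Longrightarrow> \<psi> x = 0"
    by (rule smooth_cutoff_exists[of 1 2 p]) auto
  have tm: "test_map (\<lambda>x. \<psi> x *\<^sub>R V x)" by (rule test_map_cutoff[OF \<psi>(1,3) assms])
  obtain \<zeta> where \<zeta>: "is_flow (\<lambda>x. \<psi> x *\<^sub>R V x) \<zeta>" using flow_exists[OF tm] .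
  have "isCont (\<lambda>t. \<zeta> t p) 0"
    using has_vector_derivative_continuous[OF is_flow_deriv[OF \<zeta>]] .
  then have "((\<lambda>t. \<zeta> t p) \<longlongrightarrow> p) (at 0)"
    by (simp add: isCont_def is_flow_0[OF \<zeta>])
  from topological_tendstoD[OF this open_ball, of p 1]
  have "\<forall>\<^sub>F t in at 0. \<zeta> t p \<in> ball p 1" by simp
  then obtain e where e: "e > 0" "\<And>t. t \<noteq> 0 \<Longrightarrow> dist t 0 < e \<Longrightarrow> \<zeta> t p \<in> ball p 1"
    unfolding eventually_at by auto
  have "\<zeta> t p \<in> ball p 1" if "t \<in> {- (e / 2)..e / 2}" for t
    using e that is_flow_0[OF \<zeta>] by (cases "t = 0") (auto simp: abs_le_iff)
  then have "((\<lambda>t. \<zeta> t p) has_vector_derivative V (\<zeta> t p)) (at t)" if "t \<in> {- (e / 2)..e / 2}" for t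
    using is_flow_deriv[OF \<zeta>, of p t] \<psi>(2) that by simp
  then show ?thesis
    using that[of "e / 2" "\<lambda>t. \<zeta> t p"] e(1) is_flow_0[OF \<zeta>] by auto
qed

lemma eventually_at_right_solution_in_open:
  assumes "0 < T" "open S" "y 0 \<in> S" and y: "\<And>t. t \<in> {0..T} \<Longrightarrow> (y has_vector_derivative y' t) (at t within {0..T})"
  shows "\<forall>\<^sub>F s in at_right 0. y s \<in> S"
proof -
  have "(y \<longlongrightarrow> y 0) (at 0 within {0..T})"
    using has_vector_derivative_continuous[OF y[of 0]] assms(1) by (simp add: continuous_within)
  then have "\<forall>\<^sub>F s in at 0 within {0..T}. y s \<in> S"
    using assms topological_tendstoD by blast
  then show ?thesis using assms(1) by (simp add: at_within_Icc_at_right)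
qed

text \<open>The relay rule tests some trajectory of unspecified duration; agreement of right germs
  makes the outcome independent of the choice.\<close>

lemma smooth_solution_unique_right:
  fixes V :: "'a::euclidean_space \<Rightarrow> 'a"
  assumes "smooth V" "0 < T" "0 < T'" "y 0 = z 0"
    and y: "\<And>t. t \<in> {0..T} \<Longrightarrow> (y has_vector_derivative V (y t)) (at t within {0..T})"
    and z: "\<And>t. t \<in> {0..T'} \<Longrightarrow> (z has_vector_derivative V (z t)) (at t within {0..T'})"
  shows "\<forall>\<^sub>F s in at_right 0. y s = z s"
proof -
  define p where "p = y 0"
  obtain \<psi> :: "'a \<Rightarrow> real" where \<psi>: "smooth \<psi>" "\<And>x. x \<in> ball p 1 \<Longrightarrow> \<psi> x = 1"
    "\<And>x. x \<notin> ball p 2 \<Longrightarrow> \<psi> x = 0"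
    by (rule smooth_cutoff_exists[of 1 2 p]) auto
  have tm: "test_map (\<lambda>x. \<psi> x *\<^sub>R V x)" by (rule test_map_cutoff[OF \<psi>(1,3) assms(1)])
  obtain L where "\<And>x x'. norm (\<psi> x *\<^sub>R V x - \<psi> x' *\<^sub>R V x') \<le> L * norm (x - x')"
    using test_map_lipschitz[OF tm] by blast
  then have L: "norm (V x - V x') \<le> L * norm (x - x')" if "x \<in> ball p 1" "x' \<in> ball p 1" for x x'
    using \<psi>(2) that by (metis scaleR_one)
  have "\<forall>\<^sub>F s in at_right 0. y s \<in> ball p 1" "\<forall>\<^sub>F s in at_right 0. z s \<in> ball p 1"
    using eventually_at_right_solution_in_open[OF assms(2) open_ball _ y, of p 1]
      eventually_at_right_solution_in_open[OF assms(3) open_ball _ z, of p 1] assms(4)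
    by (auto simp: p_def)
  moreover have "\<forall>\<^sub>F s in at_right 0. s < min T T'"
    using assms(2,3) by (intro eventually_at_right_real eventually_at_rightI[of 0 "min T T'"]) auto
  ultimately have "\<forall>\<^sub>F s in at_right 0. y s \<in> ball p 1 \<and> z s \<in> ball p 1 \<and> s < min T T'"
    by (auto simp: eventually_conj_iff)
  then obtain d where d: "d > 0" "\<And>s. 0 < s \<Longrightarrow> s < d \<Longrightarrow> y s \<in> ball p 1 \<and> z s \<in> ball p 1 \<and> s < min T T'"
    unfolding eventually_at_right_field by auto
  have "y s = z s" if s: "0 < s" "s < d" for s
  proof -
    have sT: "s < T" "s < T'" using d(2)[OF s] by auto
    have "norm (y s - z s) \<le> exp (L * s) * norm (y 0 - z 0)"
    proof (rule gronwall_dist[where S="ball p 1" and X=V])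
      fix t assume t: "t \<in> {0..s}"
      have "t = 0 \<or> 0 < t \<and> t < d" using t s by auto
      then show "y t \<in> ball p 1" "z t \<in> ball p 1"
        using d(2)[of t] assms(4) by (auto simp: p_def)
      show "(y has_vector_derivative V (y t)) (at t within {0..s})"
        by (rule has_vector_derivative_within_subset[OF y]) (use t sT in auto)
      show "(z has_vector_derivative V (z t)) (at t within {0..s})"
        by (rule has_vector_derivative_within_subset[OF z]) (use t sT in auto)
    qed (use s L in auto)
    then show ?thesis using assms(4) by simp
  qed
  then show ?thesis unfolding eventually_at_right_field using d(1) by blast
qed

section \<open>Trajectories of the relay system\<close>

lemma lipschitz_imp_abs_continuous:
  fixes f :: "real \<Rightarrow> 'a::real_normed_vector"
  assumes "L-lipschitz_on {a..b} f" shows "abs_continuous_on a b f"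
  unfolding abs_continuous_on_def
proof (intro allI impI)
  fix \<epsilon> :: real assume \<epsilon>: "\<epsilon> > 0"
  have L: "L \<ge> 0" using assms lipschitz_on_nonneg by blast
  show "\<exists>\<delta>>0. \<forall>D. D division_of \<Union>D \<and> \<Union>D \<subseteq> {a..b} \<and> (\<Sum>I\<in>D. Sup I - Inf I) < \<delta>
        \<longrightarrow> (\<Sum>I\<in>D. norm (f (Sup I) - f (Inf I))) < \<epsilon>"
  proof (intro exI[of _ "\<epsilon> / (L + 1)"] conjI allI impI)
    show "\<epsilon> / (L + 1) > 0" using \<epsilon> L by simp
    fix D assume D: "D division_of \<Union>D \<and> \<Union>D \<subseteq> {a..b} \<and> (\<Sum>I\<in>D. Sup I - Inf I) < \<epsilon> / (L + 1)"
    have *: "norm (f (Sup I) - f (Inf I)) \<le> L * (Sup I - Inf I) \<and> Inf I \<le> Sup I" if ID: "I \<in> D" for I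
    proof -
      obtain c d where I: "I = {c..d}" "I \<noteq> {}"
        using division_ofD(3,4)[OF conjunct1[OF D] ID] by (metis interval_cbox)
      then have cd: "c \<le> d" by simp
      then have "Sup I = d" "Inf I = c" using I by auto
      moreover have "{c..d} \<subseteq> {a..b}" using D ID I(1) by blast
      then have "c \<in> {a..b}" "d \<in> {a..b}" using cd by auto
      ultimately show ?thesis
        using lipschitz_onD[OF assms, of d c] cd by (simp add: dist_norm)
    qed
    have "(\<Sum>I\<in>D. norm (f (Sup I) - f (Inf I))) \<le> (\<Sum>I\<in>D. L * (Sup I - Inf I))"
      using * by (intro sum_mono) blast
    also have "\<dots> = L * (\<Sum>I\<in>D. Sup I - Inf I)" by (simp add: sum_distrib_left)
    also have "\<dots> \<le> (L + 1) * (\<Sum>I\<in>D. Sup I - Inf I)"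
      using * by (intro mult_right_mono sum_nonneg) (auto simp: diff_ge_0_iff_ge)
    also have "\<dots> < \<epsilon>" using D L by (simp add: pos_less_divide_eq mult.commute)
    finally show "(\<Sum>I\<in>D. norm (f (Sup I) - f (Inf I))) < \<epsilon>" .
  qed
qed

lemma piecewise_constant_on_const: "piecewise_constant_on a b (\<lambda>t. c)"
  unfolding piecewise_constant_on_def by (auto simp: constant_on_def)

lemma piecewise_constant_on_extend:
  assumes "piecewise_constant_on 0 T f" "\<And>t. t < T \<Longrightarrow> f' t = f t"
    "\<And>t. T < t \<Longrightarrow> f' t = c"
  shows "piecewise_constant_on 0 T' f'"
proof -
  obtain S where S: "finite S" "\<And>c d. {c<..<d} \<subseteq> {0..T} - S \<Longrightarrow> f constant_on {c<..<d}"
    using assms(1) unfolding piecewise_constant_on_def by blast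
  have "f' constant_on {l<..<r}" if lr: "{l<..<r} \<subseteq> {0..T'} - insert T S" for l r
  proof -
    have "T \<notin> {l<..<r}" using lr by blast
    then consider "r \<le> l" | "r \<le> T" | "T \<le> l" by force
    then show ?thesis
    proof cases
      case 1
      then show ?thesis by (simp add: constant_on_def)
    next
      case 2
      then have "{l<..<r} \<subseteq> {0..T} - S" using lr by auto
      then have "f constant_on {l<..<r}" by (rule S(2))
      then show ?thesis using 2 assms(2) by (auto simp: constant_on_def)
    next
      case 3
      then show ?thesis using assms(3) by (auto simp: constant_on_def)
    qed
  qed
  then show ?thesis unfolding piecewise_constant_on_def using S(1) by (metis finite_insert)
qed

lemma has_vector_derivative_shift_within:
  fixes y :: "real \<Rightarrow> 'a::real_normed_vector"
  assumes "(y has_vector_derivative d) (at (t + s) within S)" "(\<lambda>t. t + s) ` S' \<subseteq> S"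
  shows "((\<lambda>t. y (t + s)) has_vector_derivative d) (at t within S')"
proof -
  have "((\<lambda>t. t + s) has_vector_derivative 1) (at t within S')"
    by (auto intro!: derivative_eq_intros)
  moreover have "(y has_vector_derivative d) (at (t + s) within (\<lambda>t. t + s) ` S')"
    using has_vector_derivative_within_subset[OF assms] .
  ultimately show ?thesis
    using vector_diff_chain_within[of "\<lambda>t. t + s" 1 t S' y d] by (simp add: o_def)
qed

locale relay_system =
  fixes g :: "'m::finite \<Rightarrow> real \<Rightarrow> 'a::euclidean_space \<Rightarrow> 'a" and \<xi> :: "'m \<Rightarrow> 'a" and k :: nat
  assumes inj: "inj \<xi>" and indep: "independent (range \<xi>)"
    and smooth_g: "\<And>j w. w \<in> {-1..1} \<Longrightarrow> smooth (g j w)"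
    and chow_g: "\<And>w. (\<forall>j. w j \<in> {-1..1}) \<Longrightarrow> chow_hypothesis (range (\<lambda>j. g j (w j)))"
    and k: "k \<ge> 1"
begin

definition valid_mode :: "'m mode \<Rightarrow> bool" where
  "valid_mode \<sigma> \<longleftrightarrow> (\<forall>j. \<forall>i\<in>{1..k}. \<sigma> j i = 1 \<or> \<sigma> j i = -1)"

text \<open>The relevant threshold of relay \<open>i\<close> with output \<open>s\<close> is \<open>-1 + i/k\<close> for \<open>s = 1\<close> and \<open>i/k\<close> for
  \<open>s = -1\<close>.\<close>

definition threshold :: "real \<Rightarrow> nat \<Rightarrow> real" where
  "threshold s i = real i / real k - (1 + s) / 2"

text \<open>The sign \<open>\<sigma> j i\<close> lets one inequality, nonnegativity, express
  compatibility for either output; the points compatible with a valid mode then form a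
  polyhedron.\<close>

definition slack :: "'m mode \<Rightarrow> 'm \<Rightarrow> nat \<Rightarrow> 'a \<Rightarrow> real" where
  "slack \<sigma> j i x = \<sigma> j i * (x \<bullet> \<xi> j - threshold (\<sigma> j i) i)"

definition inner_region :: "'m mode \<Rightarrow> 'a set" where
  "inner_region \<sigma> = {x. \<forall>j. \<forall>i\<in>{1..k}. 0 < slack \<sigma> j i x}"

definition active :: "'m mode \<Rightarrow> 'a \<Rightarrow> ('m \<times> nat) set" where
  "active \<sigma> x = {(j, i). i \<in> {1..k} \<and> slack \<sigma> j i x = 0}"

definition fields :: "'m mode \<Rightarrow> ('a \<Rightarrow> 'a) set" where
  "fields \<sigma> = range (\<lambda>j. g j (relay_mean k (\<sigma> j)))"

lemma mode_compatible_slack: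
  "mode_compatible \<xi> k \<sigma> x \<longleftrightarrow> valid_mode \<sigma> \<and> (\<forall>j. \<forall>i\<in>{1..k}. 0 \<le> slack \<sigma> j i x)"
proof -
  have "relay_compatible (-1 + c) c s \<zeta> \<longleftrightarrow> (s = 1 \<or> s = -1) \<and> 0 \<le> s * (\<zeta> - (c - (1 + s) / 2))" for c s \<zeta>
    by (auto simp: relay_compatible_def)
  then show ?thesis
    unfolding mode_compatible_def valid_mode_def slack_def threshold_def by blast
qed

lemma valid_modeD: "valid_mode \<sigma> \<Longrightarrow> i \<in> {1..k} \<Longrightarrow> \<sigma> j i = 1 \<or> \<sigma> j i = -1"
  by (simp add: valid_mode_def)

lemma compatible_slack_nonneg: "mode_compatible \<xi> k \<sigma> x \<Longrightarrow> i \<in> {1..k} \<Longrightarrow> 0 \<le> slack \<sigma> j i x"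
  by (simp add: mode_compatible_slack)

lemma inner_region_compatible: "valid_mode \<sigma> \<Longrightarrow> x \<in> inner_region \<sigma> \<Longrightarrow> mode_compatible \<xi> k \<sigma> x"
  by (simp add: mode_compatible_slack inner_region_def less_imp_le)

lemma finite_active [simp]: "finite (active \<sigma> x)"
  by (rule finite_subset[of _ "UNIV \<times> {1..k}"]) (auto simp: active_def)

lemma continuous_on_slack: "continuous_on S (slack \<sigma> j i)"
  unfolding slack_def by (intro continuous_intros)

lemma open_slack: "open {x. 0 < slack \<sigma> j i x}"
  by (rule open_Collect_less[OF continuous_on_const continuous_on_slack])

lemma open_finite_slack:
  assumes "A \<subseteq> UNIV \<times> {1..k}" shows "open {x. \<forall>(j, i)\<in>A. 0 < slack \<sigma> j i x}"
proof -
  have "finite A" by (rule finite_subset[OF assms]) simp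
  moreover have "{x. \<forall>(j, i)\<in>A. 0 < slack \<sigma> j i x} = (\<Inter>p\<in>A. {x. 0 < slack \<sigma> (fst p) (snd p) x})"
    by force
  ultimately show ?thesis by (auto intro!: open_INT open_slack)
qed

lemma open_inner_region: "open (inner_region \<sigma>)"
  using open_finite_slack[of "UNIV \<times> {1..k}" \<sigma>] by (simp add: inner_region_def)

lemma convex_inner_region: "convex (inner_region \<sigma>)"
proof -
  have "slack \<sigma> j i ((1 - u) *\<^sub>R x + u *\<^sub>R y) = (1 - u) * slack \<sigma> j i x + u * slack \<sigma> j i y"
    for j i u and x y :: 'a
    unfolding slack_def by (simp add: inner_add_left algebra_simps)
  moreover have "0 < (1 - u) * a + u * b" if "0 \<le> u" "u \<le> 1" "0 < a" "0 < b" for u a b :: real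
    using that by (cases "u = 0") (auto intro: add_nonneg_pos)
  ultimately show ?thesis
    unfolding convex_alt inner_region_def by simp
qed

lemma relay_mean_bounds: "valid_mode \<sigma> \<Longrightarrow> relay_mean k (\<sigma> j) \<in> {-1..1}"
proof -
  assume *: "valid_mode \<sigma>"
  have "\<bar>\<sigma> j i\<bar> = 1" if "i \<in> {1..k}" for i
    using valid_modeD[OF * that, of j] by auto
  moreover have "\<bar>\<Sum>i=1..k. \<sigma> j i\<bar> \<le> (\<Sum>i=1..k. \<bar>\<sigma> j i\<bar>)" by (rule sum_abs)
  ultimately have "\<bar>\<Sum>i=1..k. \<sigma> j i\<bar> \<le> real k" by simp
  then show ?thesis using k unfolding relay_mean_def by (auto simp: field_simps abs_le_iff)
qed

lemma smooth_fields: "valid_mode \<sigma> \<Longrightarrow> X \<in> fields \<sigma> \<Longrightarrow> smooth X"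
  using smooth_g[OF relay_mean_bounds] by (auto simp: fields_def)

lemma chow_fields: "valid_mode \<sigma> \<Longrightarrow> chow_hypothesis (fields \<sigma>)"
  unfolding fields_def using relay_mean_bounds by (intro chow_g) auto

lemma smooth_mode_field: "valid_mode \<sigma> \<Longrightarrow> smooth (mode_field g k \<sigma> v)"
  unfolding mode_field_def
  by (intro smooth_sum smooth_compose_linear[OF bounded_linear_scaleR_right] smooth_g relay_mean_bounds)

lemma mode_field_single:
  "mode_field g k \<sigma> (\<lambda>l. if l = j then c else 0) x = c *\<^sub>R g j (relay_mean k (\<sigma> j)) x"
  unfolding mode_field_def
  by (subst sum.remove[of _ j]) (auto intro!: sum.neutral)

lemma control_for_field:
  assumes "X \<in> fields \<sigma>" obtains v where "\<And>x. mode_field g k \<sigma> v x = c *\<^sub>R X x"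
  using assms that[of "\<lambda>l. if l = _ then c else 0"] mode_field_single unfolding fields_def by fastforce

subsection \<open>Switching\<close>

definition trajectory :: "'m mode \<Rightarrow> ('m \<Rightarrow> real) \<Rightarrow> real \<Rightarrow> (real \<Rightarrow> 'a) \<Rightarrow> bool" where
  "trajectory \<sigma> v \<tau> y \<longleftrightarrow>
     (\<forall>s\<in>{0..\<tau>}. (y has_vector_derivative mode_field g k \<sigma> v (y s)) (at s within {0..\<tau>}))"

lemma trajectory_subinterval:
  assumes "trajectory \<sigma> v \<tau> y" "0 \<le> s" "s + \<tau>' \<le> \<tau>"
  shows "trajectory \<sigma> v \<tau>' (\<lambda>t. y (t + s))"
  unfolding trajectory_def
proof
  fix t assume "t \<in> {0..\<tau>'}"
  then show "((\<lambda>t. y (t + s)) has_vector_derivative mode_field g k \<sigma> v (y (t + s))) (at t within {0..\<tau>'})"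
    by (intro has_vector_derivative_shift_within[where S="{0..\<tau>}"])
       (use assms in \<open>auto simp: trajectory_def\<close>)
qed

lemma trajectory_prefix: "trajectory \<sigma> v \<tau> y \<Longrightarrow> \<tau>' \<le> \<tau> \<Longrightarrow> trajectory \<sigma> v \<tau>' y"
  using trajectory_subinterval[of \<sigma> v \<tau> y 0 \<tau>'] by simp

lemma trajectory_exists:
  assumes "valid_mode \<sigma>" obtains y \<tau> where "\<tau> > 0" "y 0 = x" "trajectory \<sigma> v \<tau> y"
proof -
  obtain y d where "d > 0" "y 0 = x"
    "\<And>t. t \<in> {-d..d} \<Longrightarrow> (y has_vector_derivative mode_field g k \<sigma> v (y t)) (at t)"
    using smooth_local_solution[OF smooth_mode_field[OF assms]] by blast
  then show ?thesis
    using that[of d y] has_vector_derivative_at_within[of y _ _ "{0..d}"] by (simp add: trajectory_def)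
qed

lemma trajectory_eventually:
  assumes "trajectory \<sigma> v \<tau> y" "\<tau> > 0" "open S" "y 0 \<in> S"
  shows "\<forall>\<^sub>F s in at_right 0. y s \<in> S"
  by (rule eventually_at_right_solution_in_open[where y=y and y'="\<lambda>s. mode_field g k \<sigma> v (y s)", OF assms(2-4)])
     (use assms(1) in \<open>auto simp: trajectory_def\<close>)

text \<open>Uniqueness replaces the existentially quantified trajectory of the definition by any
  given one. The test stays a \<open>frequently\<close> condition, since a smooth trajectory can
  cross a threshold infinitely often near the starting time.\<close>

lemma forced_crossing_iff:
  assumes "valid_mode \<sigma>" "i \<in> {1..k}" and y: "trajectory \<sigma> v \<tau> y" "\<tau> > 0"
  shows "forced_crossing g \<xi> k v (y 0) \<sigma> j i \<longleftrightarrow> (\<exists>\<^sub>F s in at_right 0. slack \<sigma> j i (y s) < 0)"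
proof -
  have viol: "(\<sigma> j i = 1 \<and> p \<bullet> \<xi> j < -1 + real i / real k \<or> \<sigma> j i = -1 \<and> p \<bullet> \<xi> j > real i / real k)
      \<longleftrightarrow> slack \<sigma> j i p < 0" for p
    using valid_modeD[OF assms(1,2), of j] by (auto simp: slack_def threshold_def)
  have "(\<exists>\<^sub>F s in at_right 0. slack \<sigma> j i (z s) < 0) \<longleftrightarrow> (\<exists>\<^sub>F s in at_right 0. slack \<sigma> j i (y s) < 0)"
    if z: "trajectory \<sigma> v \<delta> z" "\<delta> > 0" "z 0 = y 0" for z \<delta>
  proof -
    have "\<forall>\<^sub>F s in at_right 0. z s = y s"
      by (rule smooth_solution_unique_right[where y=z and z=y, OF smooth_mode_field[OF assms(1)] z(2) y(2) z(3)])
         (use z y in \<open>auto simp: trajectory_def\<close>)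
    then show ?thesis by (intro frequently_cong) (auto elim: eventually_mono)
  qed
  then show ?thesis
    unfolding forced_crossing_def viol trajectory_def[symmetric] using y by blast
qed

lemma forced_crossing_slack:
  assumes "mode_compatible \<xi> k \<sigma> x" "i \<in> {1..k}" "forced_crossing g \<xi> k v x \<sigma> j i"
  shows "slack \<sigma> j i x = 0"
proof (rule ccontr)
  assume "slack \<sigma> j i x \<noteq> 0"
  then have pos: "0 < slack \<sigma> j i x" using compatible_slack_nonneg[OF assms(1,2), of j] by simp
  have valid: "valid_mode \<sigma>" using assms by (simp add: mode_compatible_slack)
  obtain y \<tau> where y: "\<tau> > 0" "y 0 = x" "trajectory \<sigma> v \<tau> y" using trajectory_exists[OF valid] .
  have "\<forall>\<^sub>F s in at_right 0. y s \<in> {x. 0 < slack \<sigma> j i x}"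
    by (rule trajectory_eventually[OF y(3,1) open_slack]) (use y pos in auto)
  then have "\<forall>\<^sub>F s in at_right 0. \<not> slack \<sigma> j i (y s) < 0" by (auto elim: eventually_mono)
  then show False
    using forced_crossing_iff[OF valid assms(2) y(3,1), of j] assms(3) y(2)
    by (simp add: frequently_def)
qed

text \<open>The two thresholds of a relay are exactly 1 apart, so a relay that switches at one of
  them has slack 1 with respect to the other.\<close>

lemma slack_flip:
  assumes "\<sigma> j i = 1 \<or> \<sigma> j i = -1" "slack \<sigma> j i x = 0" "\<sigma>' j i = - \<sigma> j i"
  shows "slack \<sigma>' j i x = 1"
  using assms by (auto simp: slack_def threshold_def)

lemma slack_cong: "\<sigma>' j i = \<sigma> j i \<Longrightarrow> slack \<sigma>' j i x = slack \<sigma> j i x"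
  by (simp add: slack_def)

text \<open>Only relays with slack 0 can switch, and they leave with slack 1 while the others keep
  theirs; so compatibility persists and every genuine switch shrinks the active set.\<close>

lemma switch_mode_step:
  fixes v :: "'m \<Rightarrow> real"
  assumes "mode_compatible \<xi> k \<sigma> x"
  defines "\<sigma>' \<equiv> switch_mode g \<xi> k v x \<sigma>"
  shows "mode_compatible \<xi> k \<sigma>' x" "\<sigma>' \<noteq> \<sigma> \<Longrightarrow> active \<sigma>' x \<subset> active \<sigma> x"
proof -
  have valid: "valid_mode \<sigma>" using assms by (simp add: mode_compatible_slack)
  have cases: "(\<sigma>' j i = \<sigma> j i \<and> slack \<sigma>' j i x = slack \<sigma> j i x) \<or>
      (\<sigma>' j i = - \<sigma> j i \<and> slack \<sigma> j i x = 0 \<and> slack \<sigma>' j i x = 1)" if i: "i \<in> {1..k}" for j i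
  proof (cases "forced_crossing g \<xi> k v x \<sigma> j i")
    case True
    then have "\<sigma>' j i = - \<sigma> j i" using i by (simp add: \<sigma>'_def switch_mode_def)
    moreover have "slack \<sigma> j i x = 0" using forced_crossing_slack[OF assms(1) i True] .
    moreover have "\<sigma> j i = 1 \<or> \<sigma> j i = -1" using valid_modeD[OF valid i] .
    ultimately show ?thesis using slack_flip[of \<sigma> j i x \<sigma>'] by blast
  next
    case False
    then have "\<sigma>' j i = \<sigma> j i" by (simp add: \<sigma>'_def switch_mode_def)
    then show ?thesis using slack_cong by blast
  qed
  have "valid_mode \<sigma>'" unfolding valid_mode_def
  proof (intro allI ballI)
    fix j i assume i: "i \<in> {1..k}"
    then have "\<sigma> j i = 1 \<or> \<sigma> j i = -1" using valid by (simp add: valid_mode_def)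
    then show "\<sigma>' j i = 1 \<or> \<sigma>' j i = -1" using cases[OF i, of j] by auto
  qed
  then show "mode_compatible \<xi> k \<sigma>' x"
    using cases assms(1) unfolding mode_compatible_slack by (metis zero_le_one)
  assume "\<sigma>' \<noteq> \<sigma>"
  then obtain j i where "\<sigma>' j i \<noteq> \<sigma> j i" by (meson ext)
  then have i: "i \<in> {1..k}" by (auto simp: \<sigma>'_def switch_mode_def split: if_splits)
  have "(j, i) \<in> active \<sigma> x" "(j, i) \<notin> active \<sigma>' x"
    using cases[OF i, of j] \<open>\<sigma>' j i \<noteq> \<sigma> j i\<close> i by (auto simp: active_def)
  moreover have "active \<sigma>' x \<subseteq> active \<sigma> x"
  proof
    fix p assume "p \<in> active \<sigma>' x"
    then obtain j i where p: "p = (j, i)" "i \<in> {1..k}" "slack \<sigma>' j i x = 0"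
      by (auto simp: active_def)
    then show "p \<in> active \<sigma> x" using cases[OF p(2), of j] by (auto simp: active_def)
  qed
  ultimately show "active \<sigma>' x \<subset> active \<sigma> x" by blast
qed

text \<open>The shrinking finite active set bounds the cascade of simultaneous switches. The final
  alternative records the shrinking for the later descent on active constraints.\<close>

lemma switching_stabilises:
  assumes "mode_compatible \<xi> k \<sigma> x"
  shows "\<exists>N \<sigma>'. \<sigma>' = (switch_mode g \<xi> k v x ^^ N) \<sigma> \<and> switch_mode g \<xi> k v x \<sigma>' = \<sigma>' \<and>
    mode_compatible \<xi> k \<sigma>' x \<and> (\<sigma>' = \<sigma> \<or> active \<sigma>' x \<subset> active \<sigma> x)"
  using assms
proof (induction "card (active \<sigma> x)" arbitrary: \<sigma> rule: less_induct)
  case less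
  let ?sw = "switch_mode g \<xi> k v x"
  show ?case
  proof (cases "?sw \<sigma> = \<sigma>")
    case True
    then show ?thesis using less.prems by (intro exI[of _ 0] exI[of _ \<sigma>]) auto
  next
    case False
    have sub: "active (?sw \<sigma>) x \<subset> active \<sigma> x"
      using switch_mode_step(2)[OF less.prems False] .
    then have "card (active (?sw \<sigma>) x) < card (active \<sigma> x)" by (intro psubset_card_mono) auto
    from less.hyps[OF this switch_mode_step(1)[OF less.prems]] obtain N \<sigma>' where
      *: "\<sigma>' = (?sw ^^ N) (?sw \<sigma>)" "?sw \<sigma>' = \<sigma>'" "mode_compatible \<xi> k \<sigma>' x"
        "\<sigma>' = ?sw \<sigma> \<or> active \<sigma>' x \<subset> active (?sw \<sigma>) x" by blast
    have "\<sigma>' = (?sw ^^ Suc N) \<sigma>" using *(1) by (simp add: funpow_swap1)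
    moreover have "active \<sigma>' x \<subset> active \<sigma> x" using *(4) sub by auto
    ultimately show ?thesis using * by blast
  qed
qed

lemma no_switch_if_compatible:
  assumes "trajectory \<sigma> v \<tau> y" "\<tau> > 0" "\<And>t. t \<in> {0..\<tau>} \<Longrightarrow> mode_compatible \<xi> k \<sigma> (y t)"
  shows "switch_mode g \<xi> k v (y 0) \<sigma> = \<sigma>"
proof -
  have valid: "valid_mode \<sigma>" using assms(2) assms(3)[of 0] by (simp add: mode_compatible_slack)
  have "\<not> forced_crossing g \<xi> k v (y 0) \<sigma> j i" if i: "i \<in> {1..k}" for j i
  proof -
    have "0 \<le> slack \<sigma> j i (y s)" if "0 < s" "s < \<tau>" for s
      by (rule compatible_slack_nonneg[OF assms(3) i]) (use that in auto)
    then have "\<forall>\<^sub>F s in at_right 0. \<not> slack \<sigma> j i (y s) < 0"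
      unfolding eventually_at_right_field using assms(2) by (auto simp: not_less)
    then show ?thesis
      using forced_crossing_iff[OF valid i assms(1,2), of j] by (simp add: frequently_def)
  qed
  then show ?thesis by (auto simp: switch_mode_def fun_eq_iff)
qed

text \<open>Absence of a forced crossing means eventually nonnegative slack; the finitely many
  relays share one time interval, and time 0 is covered by the compatibility assumed there.\<close>

lemma compatible_if_no_switch:
  assumes "trajectory \<sigma> v \<tau> y" "\<tau> > 0" "mode_compatible \<xi> k \<sigma> (y 0)"
    and "switch_mode g \<xi> k v (y 0) \<sigma> = \<sigma>"
  shows "\<forall>\<^sub>F s in at_right 0. \<forall>t\<in>{0..s}. mode_compatible \<xi> k \<sigma> (y t)"
proof -
  have valid: "valid_mode \<sigma>" using assms(3) by (simp add: mode_compatible_slack)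
  have "\<forall>\<^sub>F s in at_right 0. 0 \<le> slack \<sigma> j i (y s)" if i: "i \<in> {1..k}" for j i
  proof -
    have "\<sigma> j i \<noteq> - \<sigma> j i" using valid_modeD[OF valid i, of j] by auto
    moreover have "switch_mode g \<xi> k v (y 0) \<sigma> j i = \<sigma> j i" using assms(4) by simp
    ultimately have "\<not> forced_crossing g \<xi> k v (y 0) \<sigma> j i"
      using i by (auto simp: switch_mode_def split: if_splits)
    then show ?thesis
      using forced_crossing_iff[OF valid i assms(1,2), of j] by (simp add: frequently_def not_less)
  qed
  then have "\<forall>\<^sub>F s in at_right 0. \<forall>p\<in>UNIV \<times> {1..k}. 0 \<le> slack \<sigma> (fst p) (snd p) (y s)"
    by (intro eventually_ball_finite) auto
  then obtain d where d: "d > 0" "\<And>s. 0 < s \<Longrightarrow> s < d \<Longrightarrow> \<forall>p\<in>UNIV \<times> {1..k}. 0 \<le> slack \<sigma> (fst p) (snd p) (y s)"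
    unfolding eventually_at_right_field by auto
  have "mode_compatible \<xi> k \<sigma> (y t)" if "0 \<le> t" "t < d" for t
    using d(2)[of t] that assms(3) valid by (cases "t = 0") (auto simp: mode_compatible_slack)
  then show ?thesis
    unfolding eventually_at_right_field using d(1) by (intro exI[of _ d]) auto
qed

subsection \<open>Concatenation\<close>

text \<open>The Lipschitz bound is carried along because it passes easily to concatenations and
  implies absolute continuity. The final mode is recorded so that a further piece can start from
  it.\<close>

definition steers_to :: "'a \<Rightarrow> 'm mode \<Rightarrow> 'a \<Rightarrow> 'm mode \<Rightarrow> bool" where
  "steers_to A \<sigma>\<^sub>0 x \<sigma> \<longleftrightarrow> (\<exists>T>0. \<exists>u z h. (\<forall>j. piecewise_constant_on 0 T (u j)) \<and>
     relay_solution g \<xi> k T u z h \<and> (\<exists>L. L-lipschitz_on {0..T} z) \<and>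
     z 0 = A \<and> h 0 = \<sigma>\<^sub>0 \<and> z T = x \<and> h T = \<sigma>)"

lemma steers_to_compatible: "steers_to A \<sigma>\<^sub>0 x \<sigma> \<Longrightarrow> mode_compatible \<xi> k \<sigma> x"
  unfolding steers_to_def relay_solution_def by (metis atLeastAtMost_iff less_imp_le order_refl)

text \<open>The duration has to be positive, so the system waits at \<open>A\<close> under zero
  control, where no relay is forced to switch.\<close>

lemma steers_to_start:
  assumes "mode_compatible \<xi> k \<sigma>\<^sub>0 A" shows "steers_to A \<sigma>\<^sub>0 A \<sigma>\<^sub>0"
proof -
  have mf: "mode_field g k \<sigma>\<^sub>0 (\<lambda>j. 0) x = 0" for x by (simp add: mode_field_def)
  have "trajectory \<sigma>\<^sub>0 (\<lambda>j. 0) 1 (\<lambda>t. A)" by (simp add: trajectory_def mf)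
  from no_switch_if_compatible[OF this] assms
  have sw: "switch_mode g \<xi> k (\<lambda>j. 0) A \<sigma>\<^sub>0 = \<sigma>\<^sub>0" by simp

  have lip: "0-lipschitz_on {0..1} (\<lambda>t. A)" by (simp add: lipschitz_on_def)
  have "relay_solution g \<xi> k 1 (\<lambda>j t. 0) (\<lambda>t. A) (\<lambda>t. \<sigma>\<^sub>0)"
    unfolding relay_solution_def
  proof (intro conjI allI ballI impI)
    fix t :: real and v assume "\<forall>\<^sub>F s in at_right t. (\<lambda>j::'m. 0::real) = v"
    then have "v = (\<lambda>j. 0)" by (simp add: eventually_const_iff)
    then show "\<exists>N \<sigma>. \<sigma> = (switch_mode g \<xi> k v A ^^ N) \<sigma>\<^sub>0 \<and> switch_mode g \<xi> k v A \<sigma> = \<sigma> \<and>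
        (\<forall>\<^sub>F s in at_right t. \<sigma>\<^sub>0 = \<sigma>)"
      using sw by (intro exI[of _ 0] exI[of _ \<sigma>\<^sub>0]) auto
  qed (use assms piecewise_constant_on_const lipschitz_imp_abs_continuous[OF lip] mf in auto)
  moreover have "\<exists>L. L-lipschitz_on {0..1} (\<lambda>t. A)" using lip by blast
  ultimately show ?thesis
    unfolding steers_to_def
    by (rule_tac exI[of _ 1], intro conjI, simp, rule_tac exI[of _ "\<lambda>j t. 0"],
        rule_tac exI[of _ "\<lambda>t. A"], rule_tac exI[of _ "\<lambda>t. \<sigma>\<^sub>0"])
      (simp add: piecewise_constant_on_const)
qed

text \<open>At the junction the control gets a value different from \<open>v\<close>, so that no interval on which the
  control is constant crosses the junction.\<close>

lemma steers_to_append: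
  assumes st: "steers_to A \<sigma>\<^sub>0 x \<sigma>" and "\<tau> > 0" and y: "trajectory \<sigma>' v \<tau> y" "y 0 = x"
    and \<sigma>': "\<sigma>' = (switch_mode g \<xi> k v x ^^ N) \<sigma>"
    and comp: "\<And>t. t \<in> {0..\<tau>} \<Longrightarrow> mode_compatible \<xi> k \<sigma>' (y t)"
  shows "steers_to A \<sigma>\<^sub>0 (y \<tau>) \<sigma>'"
proof -
  obtain T u z h L where T: "T > 0" and pu: "\<And>j. piecewise_constant_on 0 T (u j)"
    and sol: "relay_solution g \<xi> k T u z h" and lip: "L-lipschitz_on {0..T} z"
    and ends: "z 0 = A" "h 0 = \<sigma>\<^sub>0" "z T = x" "h T = \<sigma>"
    using st unfolding steers_to_def by blast
  have sol_pc: "piecewise_constant_on 0 T h"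
    and sol_left: "\<And>t. t \<in> {0<..T} \<Longrightarrow> \<forall>\<^sub>F s in at_left t. h s = h t"
    and sol_comp: "\<And>t. t \<in> {0..T} \<Longrightarrow> mode_compatible \<xi> k (h t) (z t)"
    and sol_ode: "\<And>c d t. {c<..<d} \<subseteq> {0..T} \<Longrightarrow> h constant_on {c<..<d} \<Longrightarrow>
      \<forall>j. u j constant_on {c<..<d} \<Longrightarrow> t \<in> {c<..<d} \<Longrightarrow>
      (z has_vector_derivative mode_field g k (h t) (\<lambda>j. u j t) (z t)) (at t)"
    and sol_switch: "\<And>t v. t \<in> {0..<T} \<Longrightarrow> \<forall>\<^sub>F s in at_right t. (\<lambda>j. u j s) = v \<Longrightarrow>
        (\<exists>N \<sigma>. \<sigma> = (switch_mode g \<xi> k v (z t) ^^ N) (h t) \<and>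
               switch_mode g \<xi> k v (z t) \<sigma> = \<sigma> \<and> (\<forall>\<^sub>F s in at_right t. h s = \<sigma>))"
    using sol unfolding relay_solution_def by blast+
  define T' where "T' = T + \<tau>"
  define u' where "u' j t = (if t < T then u j t else if t = T then v j + 1 else v j)" for j t
  define z' where "z' t = (if t \<le> T then z t else y (t - T))" for t
  define h' where "h' t = (if t \<le> T then h t else \<sigma>')" for t
  have valid: "valid_mode \<sigma>'"
    using comp[of 0] \<open>\<tau> > 0\<close> by (simp add: mode_compatible_slack)
  have noswitch: "switch_mode g \<xi> k v (y t) \<sigma>' = \<sigma>'" if "t \<in> {0..<\<tau>}" for t
    using no_switch_if_compatible[OF trajectory_subinterval[OF y(1), of t "\<tau> - t"]] that comp by simp
  have ycont: "continuous_on {0..\<tau>} y"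
    using y(1) unfolding trajectory_def
    by (meson continuous_on_eq_continuous_within has_vector_derivative_continuous)
  have "\<exists>M. M-lipschitz_on {T..T'} (\<lambda>t. y (t - T))"
  proof -
    have "compact ((\<lambda>t. mode_field g k \<sigma>' v (y t)) ` {0..\<tau>})"
      by (intro compact_continuous_image
          continuous_on_compose2[OF smooth_continuous[OF smooth_mode_field[OF valid]] ycont]) auto
    from compact_imp_bounded[OF this] obtain M
      where M: "\<And>t. t \<in> {0..\<tau>} \<Longrightarrow> norm (mode_field g k \<sigma>' v (y t)) \<le> M"
      unfolding bounded_iff by blast
    have ylip: "norm (y s - y t) \<le> M * norm (s - t)" if "s \<in> {0..\<tau>}" "t \<in> {0..\<tau>}" for s t
    proof (rule differentiable_bound[OF convex_real_interval(5) _ _ that])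
      fix r assume r: "r \<in> {0..\<tau>}"
      show "(y has_derivative (\<lambda>l. l *\<^sub>R mode_field g k \<sigma>' v (y r))) (at r within {0..\<tau>})"
        using y(1) r unfolding trajectory_def has_vector_derivative_def by blast
      show "onorm (\<lambda>l. l *\<^sub>R mode_field g k \<sigma>' v (y r)) \<le> M"
        by (rule onorm_le) (use M[OF r] in \<open>simp add: mult.commute[of M] mult_left_mono\<close>)
    qed
    have "0 \<le> M" using order_trans[OF norm_ge_zero M[of 0]] \<open>\<tau> > 0\<close> by simp
    then have "M-lipschitz_on {T..T'} (\<lambda>t. y (t - T))"
      using ylip[of "_ - T" "_ - T"] by (intro lipschitz_onI) (auto simp: dist_norm T'_def)
    then show ?thesis ..
  qed
  then obtain M where "M-lipschitz_on {T..T'} (\<lambda>t. y (t - T))" ..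
  from lipschitz_on_concat_max[OF lip this] ends y(2)
  have lip': "(max L M)-lipschitz_on {0..T'} z'" by (simp add: z'_def[abs_def])
  have pu': "piecewise_constant_on 0 T' (u' j)" for j
    by (rule piecewise_constant_on_extend[OF pu[of j], of _ "v j"]) (auto simp: u'_def)
  have right: "\<forall>\<^sub>F s in at_right t. t < s \<and> s < e" if "t < e" for t e :: real
    unfolding eventually_at_right_field using that by blast
  have sol': "relay_solution g \<xi> k T' u' z' h'"
    unfolding relay_solution_def
  proof (intro conjI allI ballI impI)
    show "abs_continuous_on 0 T' z'" by (rule lipschitz_imp_abs_continuous[OF lip'])
    show "piecewise_constant_on 0 T' h'"
      by (rule piecewise_constant_on_extend[OF sol_pc, of _ \<sigma>']) (auto simp: h'_def)
  next
    fix t assume t: "t \<in> {0<..T'}"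
    show "\<forall>\<^sub>F s in at_left t. h' s = h' t"
    proof (cases "t \<le> T")
      case True
      then have "\<forall>\<^sub>F s in at_left t. h s = h t" using sol_left[of t] t by simp
      moreover have "\<forall>\<^sub>F s in at_left t. s < t" by (simp add: eventually_at_filter)
      ultimately show ?thesis
        by eventually_elim (use True in \<open>simp add: h'_def\<close>)
    next
      case False
      then show ?thesis
        unfolding eventually_at_left_field by (intro exI[of _ T]) (auto simp: h'_def)
    qed
  next
    fix t assume t: "t \<in> {0..T'}"
    show "mode_compatible \<xi> k (h' t) (z' t)"
      using sol_comp[of t] comp[of "t - T"] t by (auto simp: h'_def z'_def T'_def)
  next
    fix c d t
    assume H: "{c<..<d} \<subseteq> {0..T'} \<and> h' constant_on {c<..<d} \<and> (\<forall>j. u' j constant_on {c<..<d})"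
      and t: "t \<in> {c<..<d}"
    have "T \<notin> {c<..<d}"
    proof
      assume Tin: "T \<in> {c<..<d}"
      then obtain s where s: "T < s" "s < d" using dense by auto
      obtain w where "\<And>s. s \<in> {c<..<d} \<Longrightarrow> u' undefined s = w"
        using H unfolding constant_on_def by blast
      from this[of T] this[of s] Tin s show False by (simp add: u'_def)
    qed
    then consider "d \<le> T" | "T \<le> c" by force
    then show "(z' has_vector_derivative mode_field g k (h' t) (\<lambda>j. u' j t) (z' t)) (at t)"
    proof cases
      case 1
      have "(z has_vector_derivative mode_field g k (h t) (\<lambda>j. u j t) (z t)) (at t)"
      proof (rule sol_ode[OF _ _ _ t])
        show "{c<..<d} \<subseteq> {0..T}" using H 1 by auto
        show "h constant_on {c<..<d}" using H 1 by (auto simp: constant_on_def h'_def)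
        show "\<forall>j. u j constant_on {c<..<d}" using H 1 by (auto simp: constant_on_def u'_def)
      qed
      moreover have "h t = h' t" "(\<lambda>j. u j t) = (\<lambda>j. u' j t)" "z t = z' t"
        using 1 t by (auto simp: h'_def u'_def z'_def)
      ultimately have "(z has_vector_derivative mode_field g k (h' t) (\<lambda>j. u' j t) (z' t)) (at t)" by simp
      then show ?thesis
        by (rule has_vector_derivative_transform_within_open[where S="{c<..<d}"])
           (use 1 t in \<open>auto simp: z'_def\<close>)
    next
      case 2
      \<comment> \<open>A point of the interval beyond \<open>t\<close> forces
        \<open>t < T'\<close>, so the derivative of \<open>y\<close> at \<open>t - T\<close> within
        its domain is two-sided.\<close>
      obtain e where e: "t < e" "e < d" using t dense by auto
      then have "e \<le> T'" using H t by (auto simp: subset_iff)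
      with 2 t e have tT: "0 < t - T" "t - T < \<tau>" by (auto simp: T'_def)
      then have "(y has_vector_derivative mode_field g k \<sigma>' v (y (t - T))) (at (t - T))"
        using bspec[OF y(1)[unfolded trajectory_def], of "t - T"] at_within_Icc_at[OF tT] by simp
      then have "((\<lambda>s. y (s - T)) has_vector_derivative mode_field g k \<sigma>' v (y (t - T))) (at t)"
        using has_vector_derivative_affine[of y "mode_field g k \<sigma>' v (y (t - T))" 1 t "- T"] by simp
      moreover have "\<sigma>' = h' t" "v = (\<lambda>j. u' j t)" "y (t - T) = z' t"
        using tT by (auto simp: h'_def u'_def z'_def)
      ultimately have "((\<lambda>s. y (s - T)) has_vector_derivative mode_field g k (h' t) (\<lambda>j. u' j t) (z' t)) (at t)"
        by simp
      then show ?thesis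
        by (rule has_vector_derivative_transform_within_open[where S="{c<..<d}"])
           (use 2 t in \<open>auto simp: z'_def\<close>)
    qed
  next
    fix t w assume t: "t \<in> {0..<T'}" and w: "\<forall>\<^sub>F s in at_right t. (\<lambda>j. u' j s) = w"
    show "\<exists>N \<sigma>. \<sigma> = (switch_mode g \<xi> k w (z' t) ^^ N) (h' t) \<and>
               switch_mode g \<xi> k w (z' t) \<sigma> = \<sigma> \<and> (\<forall>\<^sub>F s in at_right t. h' s = \<sigma>)"
    proof (cases "t < T")
      case True
      have "\<forall>\<^sub>F s in at_right t. (\<lambda>j. u j s) = w"
        using eventually_conj[OF w right[OF True]] by (auto simp: u'_def elim!: eventually_mono)
      then obtain N \<sigma> where *: "\<sigma> = (switch_mode g \<xi> k w (z t) ^^ N) (h t)"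
        "switch_mode g \<xi> k w (z t) \<sigma> = \<sigma>" "\<forall>\<^sub>F s in at_right t. h s = \<sigma>"
        using sol_switch[of t w] t True by auto
      have "\<forall>\<^sub>F s in at_right t. h' s = \<sigma>"
        using eventually_conj[OF *(3) right[OF True]] by (auto simp: h'_def elim!: eventually_mono)
      with * True show ?thesis by (intro exI[of _ N] exI[of _ \<sigma>]) (simp add: z'_def h'_def)
    next
      case False
      have "\<forall>\<^sub>F s in at_right t. t < s \<and> s < T'" by (rule right) (use t in auto)
      then have "\<forall>\<^sub>F s in at_right t. v = w \<and> h' s = \<sigma>'"
        using w by eventually_elim (use False in \<open>auto simp: u'_def h'_def\<close>)
      then have vw: "v = w" and h: "\<forall>\<^sub>F s in at_right t. h' s = \<sigma>'"
        by (auto simp: eventually_conj_iff eventually_const_iff)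
      show ?thesis
      proof (cases "t = T")
        case True
        then have "z' t = x" "h' t = \<sigma>" using ends by (auto simp: z'_def h'_def)
        moreover have "switch_mode g \<xi> k v x \<sigma>' = \<sigma>'" using noswitch[of 0] \<open>\<tau> > 0\<close> y(2) by simp
        ultimately show ?thesis
          using \<sigma>' h vw by (intro exI[of _ N] exI[of _ \<sigma>']) simp
      next
        case tT: False
        then have "z' t = y (t - T)" "h' t = \<sigma>'" using False by (auto simp: z'_def h'_def)
        moreover have "switch_mode g \<xi> k v (y (t - T)) \<sigma>' = \<sigma>'"
          using noswitch[of "t - T"] t False by (simp add: T'_def)
        ultimately show ?thesis
          using h vw by (intro exI[of _ 0] exI[of _ \<sigma>']) simp
      qed
    qed
  qed
  have "T' > 0" "z' 0 = A" "h' 0 = \<sigma>\<^sub>0" "z' T' = y \<tau>" "h' T' = \<sigma>'"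
    using T \<open>\<tau> > 0\<close> ends by (auto simp: T'_def z'_def h'_def)
  then show ?thesis
    unfolding steers_to_def using pu' sol' lip' by blast
qed

lemma steers_to_run:
  assumes "steers_to A \<sigma>\<^sub>0 x \<sigma>" "trajectory \<sigma> v \<tau> y" "\<tau> \<ge> 0" "y 0 = x"
    and "\<And>t. t \<in> {0..\<tau>} \<Longrightarrow> mode_compatible \<xi> k \<sigma> (y t)"
  shows "steers_to A \<sigma>\<^sub>0 (y \<tau>) \<sigma>"
proof (cases "\<tau> = 0")
  case True
  then show ?thesis using assms by simp
next
  case False
  then show ?thesis
    using steers_to_append[OF assms(1) _ assms(2,4), of 0] assms by simp
qed

subsection \<open>Motion inside and across the region of a mode\<close>

lemma attain_step_trajectory:
  assumes "(p, q) \<in> attain_step (fields \<sigma>) W"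
  obtains v \<tau> y where "\<tau> \<ge> 0" "trajectory \<sigma> v \<tau> y" "y 0 = p" "y \<tau> = q" "\<And>t. t \<in> {0..\<tau>} \<Longrightarrow> y t \<in> W"
proof -
  obtain X c \<tau> y where X: "X \<in> fields \<sigma>" and *: "0 \<le> \<tau>" "y 0 = p" "y \<tau> = q"
     "\<And>t. t \<in> {0..\<tau>} \<Longrightarrow> y t \<in> W"
     "\<And>t. t \<in> {0..\<tau>} \<Longrightarrow> (y has_vector_derivative c *\<^sub>R X (y t)) (at t within {0..\<tau>})"
    using assms unfolding attain_step_def by fastforce
  obtain v where "\<And>x. mode_field g k \<sigma> v x = c *\<^sub>R X x" using control_for_field[OF X, where c=c] by blast
  then have "trajectory \<sigma> v \<tau> y" using *(5) by (simp add: trajectory_def)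
  then show ?thesis using that * by blast
qed

lemma steers_to_inner_region:
  assumes "steers_to A \<sigma>\<^sub>0 x \<sigma>" "x \<in> inner_region \<sigma>" "q \<in> inner_region \<sigma>"
  shows "steers_to A \<sigma>\<^sub>0 q \<sigma>"
proof -
  have valid: "valid_mode \<sigma>"
    using steers_to_compatible[OF assms(1)] by (simp add: mode_compatible_slack)
  have "(x, q) \<in> (attain_step (fields \<sigma>) (inner_region \<sigma>))\<^sup>*"
    by (rule chow_connected[OF smooth_fields[OF valid] chow_fields[OF valid] open_inner_region
          convex_connected[OF convex_inner_region] assms(2,3)])
  then show ?thesis
  proof induction
    case base
    then show ?case using assms(1) .
  next
    case (step p q)
    obtain v \<tau> y where *: "\<tau> \<ge> 0" "trajectory \<sigma> v \<tau> y" "y 0 = p" "y \<tau> = q"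
      "\<And>t. t \<in> {0..\<tau>} \<Longrightarrow> y t \<in> inner_region \<sigma>"
      using attain_step_trajectory[OF step(2)] by blast
    show ?case
      using steers_to_run[OF step.IH *(2,1,3)] inner_region_compatible[OF valid *(5)] *(4) by simp
  qed
qed

lemma steers_to_after_switching:
  assumes st: "steers_to A \<sigma>\<^sub>0 x \<sigma>"
    and \<sigma>': "\<sigma>' = (switch_mode g \<xi> k v x ^^ N) \<sigma>" "switch_mode g \<xi> k v x \<sigma>' = \<sigma>'" "mode_compatible \<xi> k \<sigma>' x"
    and y: "trajectory \<sigma>' v \<tau> y" "\<tau> > 0" "y 0 = x"
  shows "\<forall>\<^sub>F s in at_right 0. steers_to A \<sigma>\<^sub>0 (y s) \<sigma>'"
proof -
  have "\<forall>\<^sub>F s in at_right 0. \<forall>t\<in>{0..s}. mode_compatible \<xi> k \<sigma>' (y t)"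
    by (rule compatible_if_no_switch[OF y(1,2)]) (use \<sigma>' y(3) in auto)
  moreover have "\<forall>\<^sub>F s in at_right 0. 0 < s \<and> s \<le> \<tau>"
    unfolding eventually_at_right_field using y(2) by (intro exI[of _ \<tau>]) auto
  ultimately show ?thesis
  proof eventually_elim
    case (elim s)
    then show ?case
      using steers_to_append[OF st _ trajectory_prefix[OF y(1)] y(3) \<sigma>'(1), of s] by simp
  qed
qed

lemma slack_gradient: "slack \<sigma> j i (x + e *\<^sub>R \<xi> j) = slack \<sigma> j i x + \<sigma> j i * e * (\<xi> j \<bullet> \<xi> j)"
  by (simp add: slack_def inner_add_left algebra_simps)

lemma xi_nonzero: "\<xi> j \<noteq> 0"
  using indep dependent_zero by (metis rangeI)

lemma active_subset:
  assumes "\<forall>(j, i)\<in>UNIV \<times> {1..k} - S. 0 < slack \<sigma> j i p" shows "active \<sigma> p \<subseteq> S"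
proof
  fix q assume "q \<in> active \<sigma> p"
  then obtain j i where q: "q = (j, i)" "i \<in> {1..k}" "slack \<sigma> j i p = 0" by (auto simp: active_def)
  then show "q \<in> S" using assms by (cases "(j, i) \<in> S") force+
qed

text \<open>A trajectory of the current mode leaves the face on which the constraints active at \<open>x\<close> hold with
  equality; at the exit either a relay switches, which makes its constraint inactive, or the
  constraints remain satisfied and one of them becomes strict.\<close>

lemma reduce_active:
  assumes st: "steers_to A \<sigma>\<^sub>0 x \<sigma>" and ne: "active \<sigma> x \<noteq> {}"
  shows "\<exists>x' \<sigma>'. steers_to A \<sigma>\<^sub>0 x' \<sigma>' \<and> card (active \<sigma>' x') < card (active \<sigma> x)"
proof (rule ccontr)
  assume contra: "\<not> ?thesis"
  define Act where "Act = active \<sigma> x"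
  \<comment> \<open>By the assumption for contradiction no reachable state has an active set
    properly inside \<open>Act\<close>; this is what confines every Chow path from \<open>x\<close>
    to the face \<open>E\<close>.\<close>
  have no: False if "steers_to A \<sigma>\<^sub>0 x' \<sigma>'" "active \<sigma>' x' \<subset> Act" for x' \<sigma>'
    using contra that psubset_card_mono[OF finite_active, of "active \<sigma>' x'" \<sigma> x] unfolding Act_def by blast
  have comp: "mode_compatible \<xi> k \<sigma> x" using steers_to_compatible[OF st] .
  then have valid: "valid_mode \<sigma>" by (simp add: mode_compatible_slack)
  define E where "E = {p. \<forall>(j, i)\<in>Act. slack \<sigma> j i p = 0}"
  define U where "U = {p. \<forall>(j, i)\<in>UNIV \<times> {1..k} - Act. 0 < slack \<sigma> j i p}"
  have E_D: "slack \<sigma> j i p = 0" if "p \<in> E" "(j, i) \<in> Act" for p j i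
    using that unfolding E_def by blast
  have U_D: "0 < slack \<sigma> j i p" if "p \<in> U" "i \<in> {1..k}" "(j, i) \<notin> Act" for p j i
    using that unfolding U_def by blast
  have xE: "x \<in> E" by (auto simp: E_def Act_def active_def)
  have xU: "x \<in> U"
    using compatible_slack_nonneg[OF comp] by (force simp: U_def Act_def active_def less_le)
  have "open U" unfolding U_def by (rule open_finite_slack) auto
  then obtain \<rho> where \<rho>: "\<rho> > 0" "ball x \<rho> \<subseteq> U" using xU openE by blast
  obtain r where r: "r > 0" "ball x r \<subseteq> (attain_step (fields \<sigma>) (ball x \<rho>))\<^sup>* `` {x}"
    using chow_local[OF smooth_fields[OF valid] chow_fields[OF valid] \<rho>(1)] by blast
  have EU_comp: "mode_compatible \<xi> k \<sigma> p" if "p \<in> E" "p \<in> U" for p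
  proof -
    have "0 \<le> slack \<sigma> j i p" if "i \<in> {1..k}" for j i
      using E_D[OF \<open>p \<in> E\<close>, of j i] U_D[OF \<open>p \<in> U\<close> that, of j] by (cases "(j, i) \<in> Act") auto
    then show ?thesis using valid by (simp add: mode_compatible_slack)
  qed
  have act_U: "active \<sigma> p \<subseteq> Act" if "p \<in> U" for p
    using active_subset that by (simp add: U_def)
  have act_E: "active \<sigma> p \<subset> Act" if p: "p \<in> U" "p \<notin> E" for p
  proof -
    from p(2) obtain j i where "(j, i) \<in> Act" "slack \<sigma> j i p \<noteq> 0" by (auto simp: E_def)
    then have "(j, i) \<in> Act - active \<sigma> p" by (simp add: active_def)
    with act_U[OF p(1)] show ?thesis by blast
  qed
  have closedE: "closed E"
  proof -
    have "E = (\<Inter>p\<in>Act. {q. slack \<sigma> (fst p) (snd p) q = 0})" by (force simp: E_def)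
    moreover have "closed {q. slack \<sigma> j i q = 0}" for j i
      by (rule closed_Collect_eq[OF continuous_on_slack continuous_on_const])
    ultimately show ?thesis by auto
  qed
  have inE: "steers_to A \<sigma>\<^sub>0 p \<sigma> \<and> p \<in> E" if "(x, p) \<in> (attain_step (fields \<sigma>) (ball x \<rho>))\<^sup>*" for p
    using that
  proof induction
    case base
    then show ?case using st xE by simp
  next
    case (step p q)
    obtain v \<tau> y where *: "\<tau> \<ge> 0" and y: "trajectory \<sigma> v \<tau> y" "y 0 = p" "y \<tau> = q"
      and yU: "\<And>t. t \<in> {0..\<tau>} \<Longrightarrow> y t \<in> U"
      using attain_step_trajectory[OF step(2)] \<rho>(2) by (metis subsetD)
    have ycont: "continuous_on {0..\<tau>} y"
      using y(1) unfolding trajectory_def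
      by (meson continuous_on_eq_continuous_within has_vector_derivative_continuous)
    have run: "steers_to A \<sigma>\<^sub>0 (y t) \<sigma>" if "t \<in> {0..\<tau>}" "\<And>s. s \<in> {0..t} \<Longrightarrow> y s \<in> E" for t
      by (rule steers_to_run[OF conjunct1[OF step.IH] trajectory_prefix[OF y(1)] _ y(2)])
         (use that EU_comp yU in auto)
    have allE: "y t \<in> E" if t: "t \<in> {0..\<tau>}" for t
    proof (rule ccontr)
      assume tE: "y t \<notin> E"
      define B where "B = {s \<in> {0..\<tau>}. y s \<notin> E}"
      have B: "t \<in> B" "bdd_below B" using t tE by (auto simp: B_def bdd_below_def)
      \<comment> \<open>Infimum of the times off the face. As \<open>E\<close> is closed, the
        trajectory is still on it at \<open>t0\<close>, and exits occur at times arbitrarily close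
        after \<open>t0\<close>.\<close>
      define t0 where "t0 = Inf B"
      have t0: "0 \<le> t0" "t0 \<le> t"
        unfolding t0_def using B by (auto intro!: cInf_greatest cInf_lower simp: B_def)
      have before: "y s \<in> E" if "0 \<le> s" "s < t0" for s
      proof (rule ccontr)
        assume "y s \<notin> E"
        then have "s \<in> B" using that t0 t by (auto simp: B_def)
        then show False using cInf_lower[OF _ B(2)] that unfolding t0_def by fastforce
      qed
      have at0: "y t0 \<in> E"
      proof (cases "t0 = 0")
        case True
        then show ?thesis using step.IH y(2) by simp
      next
        case False
        have "y ` closure {0..<t0} \<subseteq> E"
        proof (rule image_closure_subset[OF _ closedE])
          show "continuous_on (closure {0..<t0}) y"
            by (rule continuous_on_subset[OF ycont]) (use False t0 t in auto)
        qed (use before in auto)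
        then show ?thesis using False t0 by auto
      qed
      then have "t0 \<noteq> t" using tE by auto
      with t0 have tt: "t0 < t" "t0 \<in> {0..\<tau>}" using t by auto
      have st0: "steers_to A \<sigma>\<^sub>0 (y t0) \<sigma>"
        by (rule run[OF tt(2)]) (use before at0 in \<open>force simp: le_less\<close>)
      have comp0: "mode_compatible \<xi> k \<sigma> (y t0)" using steers_to_compatible[OF st0] .
      obtain N \<sigma>' where \<sigma>': "\<sigma>' = (switch_mode g \<xi> k v (y t0) ^^ N) \<sigma>"
        "switch_mode g \<xi> k v (y t0) \<sigma>' = \<sigma>'" "mode_compatible \<xi> k \<sigma>' (y t0)"
        "\<sigma>' = \<sigma> \<or> active \<sigma>' (y t0) \<subset> active \<sigma> (y t0)"
        using switching_stabilises[OF comp0] by blast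
      show False
      proof (cases "\<sigma>' = \<sigma>")
        case True
        let ?z = "\<lambda>s. y (s + t0)"
        have "trajectory \<sigma> v (\<tau> - t0) ?z" by (rule trajectory_subinterval[OF y(1) t0(1)]) simp
        then have "\<forall>\<^sub>F s in at_right 0. steers_to A \<sigma>\<^sub>0 (?z s) \<sigma>'"
          using steers_to_after_switching[OF st0 \<sigma>'(1-3), of "\<tau> - t0" ?z] tt t True by simp
        then obtain d where d: "d > 0" "\<And>s. 0 < s \<Longrightarrow> s < d \<Longrightarrow> steers_to A \<sigma>\<^sub>0 (?z s) \<sigma>'"
          unfolding eventually_at_right_field by blast
        \<comment> \<open>There is an exit time \<open>b\<close> within the interval on which the
          unswitched mode remains admissible, so \<open>y b\<close> is reachable and off the
          face.\<close>
        have "Inf B < t0 + d" using d(1) by (simp add: t0_def)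
        then obtain b where b: "b \<in> B" "b < t0 + d" using cInf_lessD[of B] B(1) by blast
        have "t0 \<le> b" unfolding t0_def by (rule cInf_lower[OF b(1) B(2)])
        moreover have "b \<noteq> t0" using b(1) at0 by (auto simp: B_def)
        ultimately have "steers_to A \<sigma>\<^sub>0 (y b) \<sigma>" using d(2)[of "b - t0"] b(2) True by simp
        moreover have "y b \<in> U" "y b \<notin> E" using b(1) yU by (auto simp: B_def)
        ultimately show False using no act_E by blast
      next
        case False
        then have less: "active \<sigma>' (y t0) \<subset> Act"
          using \<sigma>'(4) act_U[OF yU[OF tt(2)]] by blast
        have "valid_mode \<sigma>'" using \<sigma>'(3) by (simp add: mode_compatible_slack)
        then obtain z \<delta> where z: "\<delta> > 0" "z 0 = y t0" "trajectory \<sigma>' v \<delta> z"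
          using trajectory_exists by blast
        \<comment> \<open>Constraints strict at the switching point stay strict for a short time in
          the new mode, so the active set along \<open>z\<close> does not exceed the one at that
          point.\<close>
        let ?V = "{p. \<forall>(j, i)\<in>UNIV \<times> {1..k} - active \<sigma>' (y t0). 0 < slack \<sigma>' j i p}"
        have "\<forall>\<^sub>F s in at_right 0. z s \<in> ?V"
        proof (rule trajectory_eventually[OF z(3,1)])
          show "open ?V" by (rule open_finite_slack) auto
          show "z 0 \<in> ?V"
            using compatible_slack_nonneg[OF \<sigma>'(3)] unfolding z(2) by (force simp: active_def less_le)
        qed
        moreover have "\<forall>\<^sub>F s in at_right 0. steers_to A \<sigma>\<^sub>0 (z s) \<sigma>'"
          by (rule steers_to_after_switching[OF st0 \<sigma>'(1-3) z(3,1,2)])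
        ultimately have "\<forall>\<^sub>F s in at_right (0::real). False"
        proof eventually_elim
          case (elim s)
          then have "active \<sigma>' (z s) \<subseteq> active \<sigma>' (y t0)" by (intro active_subset) simp
          then show ?case using no[OF elim(2)] less by blast
        qed
        then show False by simp
      qed
    qed
    have "steers_to A \<sigma>\<^sub>0 (y \<tau>) \<sigma>" "y \<tau> \<in> E" using run[of \<tau>] allE \<open>\<tau> \<ge> 0\<close> by auto
    then show ?case using y(3) by simp
  qed
  \<comment> \<open>Attainable points fill a ball around \<open>x\<close>, yet a small step along
    \<open>\<xi> j\<close> for an active relay leaves the face, so the confinement is
    impossible.\<close>
  obtain j i where ji: "(j, i) \<in> Act" using ne unfolding Act_def by auto
  define e where "e = r / (2 * norm (\<xi> j))"
  have nz: "norm (\<xi> j) > 0" using xi_nonzero by simp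
  have "x + e *\<^sub>R \<xi> j \<in> ball x r" using r(1) nz by (simp add: dist_norm e_def)
  then have "x + e *\<^sub>R \<xi> j \<in> E" using r(2) inE by blast
  then have "slack \<sigma> j i (x + e *\<^sub>R \<xi> j) = 0" using ji by (auto simp: E_def)
  moreover have "slack \<sigma> j i x = 0" "i \<in> {1..k}" using ji by (auto simp: Act_def active_def)
  moreover have "e > 0" using r(1) nz by (simp add: e_def)
  ultimately show False
    using valid_modeD[OF valid, of i j] xi_nonzero[of j] by (auto simp: slack_gradient)
qed

lemma steers_to_interior:
  assumes "steers_to A \<sigma>\<^sub>0 x \<sigma>"
  shows "\<exists>x' \<sigma>'. steers_to A \<sigma>\<^sub>0 x' \<sigma>' \<and> x' \<in> inner_region \<sigma>'"
  using assms
proof (induction "card (active \<sigma> x)" arbitrary: x \<sigma> rule: less_induct)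
  case less
  show ?case
  proof (cases "active \<sigma> x = {}")
    case True
    have "0 < slack \<sigma> j i x" if i: "i \<in> {1..k}" for j i
    proof -
      have "(j, i) \<notin> active \<sigma> x" using True by simp
      then have "slack \<sigma> j i x \<noteq> 0" using i by (simp add: active_def)
      then show ?thesis
        using compatible_slack_nonneg[OF steers_to_compatible[OF less.prems] i, of j] by simp
    qed
    then have "x \<in> inner_region \<sigma>" by (simp add: inner_region_def)
    then show ?thesis using less.prems by blast
  next
    case False
    then show ?thesis using reduce_active[OF less.prems] less.hyps by blast
  qed
qed

section \<open>Flipping single relays and reaching the region of the target\<close>

lemma point_with_inner_products: "\<exists>x. \<forall>j. x \<bullet> \<xi> j = c j"
proof -
  \<comment> \<open>Linear independence allows a linear functional with arbitrary values on the
    \<open>\<xi> j\<close>; its Riesz vector is the required point.\<close>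
  obtain f :: "'a \<Rightarrow> real" where f: "linear f" "\<forall>p\<in>range \<xi>. f p = c (inv \<xi> p)"
    using linear_independent_extend[OF indep, of "\<lambda>p. c (inv \<xi> p)"] by blast
  have "(\<Sum>b\<in>Basis. f b *\<^sub>R b) \<bullet> p = f p" for p
  proof -
    have "f p = f (\<Sum>b\<in>Basis. (p \<bullet> b) *\<^sub>R b)" by (simp add: euclidean_representation)
    also have "\<dots> = (\<Sum>b\<in>Basis. (p \<bullet> b) * f b)" by (simp add: linear_sum[OF f(1)] linear_cmul[OF f(1)])
    finally show ?thesis by (simp add: inner_sum_left inner_commute[of p] mult.commute)
  qed
  then show ?thesis using f(2) inj by (intro exI[of _ "\<Sum>b\<in>Basis. f b *\<^sub>R b"]) simp
qed

text \<open>The relay is the one of input \<open>j\<close> with output \<open>-s\<close> whose threshold is met first.\<close>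

lemma first_relay_face:
  assumes valid: "valid_mode \<sigma>" and s: "s = 1 \<or> s = -1" and ex: "i0 \<in> {1..k}" "\<sigma> j i0 = - s"
  obtains i p where "i \<in> {1..k}" "\<sigma> j i = - s" "slack \<sigma> j i p = 0"
    "\<And>j' i'. i' \<in> {1..k} \<Longrightarrow> (j', i') \<noteq> (j, i) \<Longrightarrow> 0 < slack \<sigma> j' i' p"
proof -
  let ?M = "{i \<in> {1..k}. \<sigma> j i = - s}"
  have "finite ?M" "?M \<noteq> {}" using ex by auto
  \<comment> \<open>Minimising \<open>s * real i\<close> selects the lowest upper threshold when
    outputs are to become 1, and the highest lower threshold when they are to become -1.\<close>
  then obtain i where "is_arg_min (\<lambda>i. s * real i) (\<lambda>i. i \<in> ?M) i"
    using ex_is_arg_min_if_finite by blast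
  then have i: "i \<in> {1..k}" "\<sigma> j i = - s" and
    min: "\<And>i'. i' \<in> {1..k} \<Longrightarrow> \<sigma> j i' = - s \<Longrightarrow> s * real i \<le> s * real i'"
    by (auto simp: is_arg_min_linorder)
  \<comment> \<open>For the other inputs the value \<open>1 / (2 * real k)\<close> is strictly
    admissible with either output: lower thresholds are at most 0 and upper ones at least
    \<open>1 / k\<close>.\<close>
  obtain p where p: "\<And>j'. p \<bullet> \<xi> j' = (if j' = j then threshold (- s) i else 1 / (2 * real k))"
    using point_with_inner_products[of "\<lambda>j'. if j' = j then threshold (- s) i else 1 / (2 * real k)"] by blast
  have k0: "real k > 0" using k by simp
  show ?thesis
  proof (rule that[OF i])
    show "slack \<sigma> j i p = 0" by (simp add: slack_def p i(2))
    fix j' i' assume i': "i' \<in> {1..k}" and ne: "(j', i') \<noteq> (j, i)"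
    have b: "1 / real k \<le> real i' / real k" "real i' / real k \<le> 1"
      using i' k0 by (auto simp: divide_right_mono)
    have sg: "\<sigma> j' i' = 1 \<or> \<sigma> j' i' = -1" using valid_modeD[OF valid i'] .
    show "0 < slack \<sigma> j' i' p"
    proof (cases "j' = j")
      case False
      define a e where "a = real i' / real k" and "e = 1 / (2 * real k)"
      have "0 < e" "2 * e \<le> a" "a \<le> 1" using k0 b by (auto simp: a_def e_def)
      moreover have "slack \<sigma> j' i' p = \<sigma> j' i' * (e - (a - (1 + \<sigma> j' i') / 2))"
        using False by (simp add: slack_def p threshold_def a_def e_def)
      ultimately show ?thesis using sg by auto
    next
      case True
      then have "i' \<noteq> i" using ne by simp
      show ?thesis
      proof (cases "\<sigma> j i' = - s")
        case eq: True
        have "s * real i < s * real i'" using min[OF i' eq] \<open>i' \<noteq> i\<close> s by auto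
        then have "s * real i / real k < s * real i' / real k" using k0 by (simp add: divide_strict_right_mono)
        then show ?thesis using s by (auto simp: slack_def p True eq threshold_def algebra_simps)
      next
        case neq: False
        then have eq: "\<sigma> j i' = s" using sg s True by auto
        \<comment> \<open>Relays on this input that already have output \<open>s\<close> use the
          opposite kind of threshold, a full unit away, while a change of index shifts a threshold
          by less than 1.\<close>
        have "\<bar>real i - real i'\<bar> < real k" using i(1) i' by auto
        then have "\<bar>real i / real k - real i' / real k\<bar> < 1"
          using k0 by (simp add: diff_divide_distrib[symmetric] abs_divide)
        then show ?thesis using s by (auto simp: slack_def p True eq threshold_def)
      qed
    qed
  qed
qed

text \<open>The relay that flips may differ from \<open>i0\<close>: it is one whose threshold can be
  met while all other slacks are positive. Transversality makes its slack change sign strictly, so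
  the approach runs inside the region, the switch is forced at the contact, and no other relay
  reacts. In the new mode the contact point is interior.\<close>

lemma cross_face:
  assumes st: "steers_to A \<sigma>\<^sub>0 x \<sigma>" "x \<in> inner_region \<sigma>"
    and s: "s = 1 \<or> s = -1" and ex: "i0 \<in> {1..k}" "\<sigma> j i0 = - s"
  shows "\<exists>x' i. i \<in> {1..k} \<and> \<sigma> j i = - s \<and> steers_to A \<sigma>\<^sub>0 x' (\<sigma>(j := (\<sigma> j)(i := s))) \<and>
    x' \<in> inner_region (\<sigma>(j := (\<sigma> j)(i := s)))"
proof -
  have valid: "valid_mode \<sigma>"
    using steers_to_compatible[OF st(1)] by (simp add: mode_compatible_slack)
  obtain i p0 where i: "i \<in> {1..k}" "\<sigma> j i = - s" and p0: "slack \<sigma> j i p0 = 0"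
    "\<And>j' i'. i' \<in> {1..k} \<Longrightarrow> (j', i') \<noteq> (j, i) \<Longrightarrow> 0 < slack \<sigma> j' i' p0"
    using first_relay_face[OF valid s ex] by blast
  define W where "W = {p. \<forall>(j', i')\<in>UNIV \<times> {1..k} - {(j, i)}. 0 < slack \<sigma> j' i' p}"
  have oW: "open W" unfolding W_def by (rule open_finite_slack) auto
  have "p0 \<in> W" unfolding W_def
  proof (rule CollectI, rule ballI)
    fix q assume "q \<in> UNIV \<times> {1..k} - {(j, i)}"
    then show "case q of (j', i') \<Rightarrow> 0 < slack \<sigma> j' i' p0"
      using p0(2)[of "snd q" "fst q"] by (cases q) simp
  qed
  have W_D: "0 < slack \<sigma> j' i' q" if "q \<in> W" "i' \<in> {1..k}" "(j', i') \<noteq> (j, i)" for q j' i'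
    using that unfolding W_def by blast
  have face: "slack \<sigma> j i p = 0 \<longleftrightarrow> p \<bullet> \<xi> j = threshold (- s) i" for p
    using s i(2) by (auto simp: slack_def)
  with \<open>p0 \<in> W\<close> obtain p X where p: "p \<in> W" "slack \<sigma> j i p = 0" and X: "X \<in> fields \<sigma>" "X p \<bullet> \<xi> j \<noteq> 0"
    using chow_transversal_point[OF smooth_fields[OF valid] chow_fields[OF valid] oW, of p0 "\<xi> j" "threshold (- s) i"]
      p0(1) xi_nonzero by metis
  \<comment> \<open>The slack of relay \<open>(j, i)\<close> is \<open>- s\<close> times the input
    up to a constant; this sign of the control makes it strictly decreasing at
    \<open>p\<close>.\<close>
  obtain v where v: "\<And>q. mode_field g k \<sigma> v q = (s * sgn (X p \<bullet> \<xi> j)) *\<^sub>R X q"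
    using control_for_field[OF X(1), where c="s * sgn (X p \<bullet> \<xi> j)"] by blast
  obtain y d where d: "d > 0" and y: "y 0 = p"
    "\<And>t. t \<in> {-d..d} \<Longrightarrow> (y has_vector_derivative mode_field g k \<sigma> v (y t)) (at t)"
    using smooth_local_solution[OF smooth_mode_field[OF valid]] by blast
  define f where "f t = slack \<sigma> j i (y t)" for t
  have "(f has_real_derivative - s * (mode_field g k \<sigma> v (y 0) \<bullet> \<xi> j)) (at 0)"
  proof -
    have "((\<lambda>t. y t \<bullet> \<xi> j) has_real_derivative mode_field g k \<sigma> v (y 0) \<bullet> \<xi> j) (at 0)"
      using bounded_linear.has_vector_derivative[OF bounded_linear_inner_left y(2)[of 0]] d
      by (simp add: has_real_derivative_iff_has_vector_derivative)
    from DERIV_cmult[OF DERIV_diff[OF this DERIV_const[of "threshold (- s) i"]], of "- s"]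
    show ?thesis unfolding f_def[abs_def] slack_def i(2) by simp
  qed
  moreover have "- s * (mode_field g k \<sigma> v (y 0) \<bullet> \<xi> j) < 0"
    using s X(2) unfolding v y(1) by (auto simp: sgn_if)
  ultimately obtain d1 d2 where d1: "d1 > 0" "\<And>h. 0 < h \<Longrightarrow> h < d1 \<Longrightarrow> f 0 < f (0 - h)"
    and d2: "d2 > 0" "\<And>h. 0 < h \<Longrightarrow> h < d2 \<Longrightarrow> f 0 > f (0 + h)"
    using DERIV_neg_dec_left DERIV_neg_dec_right by metis
  have f0: "f 0 = 0" using p(2) y(1) by (simp add: f_def)
  have "isCont y 0" using y(2)[of 0] d has_vector_derivative_continuous by force
  then have "\<forall>\<^sub>F t in at 0. y t \<in> W"
    using topological_tendstoD[OF _ oW] p(1) y(1) by (simp add: isCont_def)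
  then obtain d3 where d3: "d3 > 0" "\<And>t. t \<noteq> 0 \<Longrightarrow> dist t 0 < d3 \<Longrightarrow> y t \<in> W"
    unfolding eventually_at by auto
  define e where "e = min (min d d1) d3 / 2"
  have e: "e > 0" "e < d" "e < d1" "e < d3" using d d1(1) d3(1) by (auto simp: e_def)
  have before: "y t \<in> inner_region \<sigma>" if "- e \<le> t" "t < 0" for t
  proof -
    have "y t \<in> W" using d3(2)[of t] that e by simp
    moreover have "0 < slack \<sigma> j i (y t)" using d1(2)[of "- t"] that e f0 by (simp add: f_def)
    ultimately have "0 < slack \<sigma> j' i' (y t)" if "i' \<in> {1..k}" for j' i'
      using W_D[OF _ that, of "y t" j'] by (cases "(j', i') = (j, i)") auto
    then show ?thesis by (simp add: inner_region_def)
  qed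
  have "slack \<sigma> j' i' p \<ge> 0" if "i' \<in> {1..k}" for j' i'
    using p(2) W_D[OF p(1) that, of j'] by (cases "(j', i') = (j, i)") auto
  then have comp_p: "mode_compatible \<xi> k \<sigma> p" using valid by (simp add: mode_compatible_slack)
  have st_p: "steers_to A \<sigma>\<^sub>0 p \<sigma>"
  proof -
    let ?w = "\<lambda>t. y (t + (- e))"
    have "steers_to A \<sigma>\<^sub>0 (y (- e)) \<sigma>"
      using steers_to_inner_region[OF st before[of "- e"]] e(1) by simp
    moreover have "trajectory \<sigma> v e ?w"
      unfolding trajectory_def
    proof
      fix t assume "t \<in> {0..e}"
      then have "(y has_vector_derivative mode_field g k \<sigma> v (y (t + - e))) (at (t + - e))"
        using y(2)[of "t + - e"] e by simp
      from has_vector_derivative_shift_within[OF this]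
      show "(?w has_vector_derivative mode_field g k \<sigma> v (?w t)) (at t within {0..e})" by simp
    qed
    moreover have "mode_compatible \<xi> k \<sigma> (?w t)" if "t \<in> {0..e}" for t
    proof (cases "t = e")
      case True
      then show ?thesis using comp_p y(1) by simp
    next
      case False
      then show ?thesis using inner_region_compatible[OF valid before] that by simp
    qed
    ultimately have "steers_to A \<sigma>\<^sub>0 (?w e) \<sigma>"
      using steers_to_run[of A \<sigma>\<^sub>0 "y (- e)" \<sigma> v e ?w] e(1) by simp
    then show ?thesis using y(1) by simp
  qed
  define \<sigma>' where "\<sigma>' = \<sigma>(j := (\<sigma> j)(i := s))"
  have traj: "trajectory \<sigma> v d y"
    using y(2) d has_vector_derivative_at_within[of y _ _ "{0..d}"] by (simp add: trajectory_def)
  have forced: "forced_crossing g \<xi> k v p \<sigma> j' i' \<longleftrightarrow> (j', i') = (j, i)" if i': "i' \<in> {1..k}" for j' i'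
  proof (cases "(j', i') = (j, i)")
    case True
    have "\<forall>\<^sub>F t in at_right 0. slack \<sigma> j i (y t) < 0"
      unfolding eventually_at_right_field using d2 f0 by (intro exI[of _ d2]) (auto simp: f_def)
    then have "\<exists>\<^sub>F t in at_right 0. slack \<sigma> j i (y t) < 0"
      by (intro eventually_frequently) auto
    then have "forced_crossing g \<xi> k v p \<sigma> j i"
      using forced_crossing_iff[OF valid i(1) traj d, of j] unfolding y(1) by (rule iffD2[rotated])
    then show ?thesis using True by simp
  next
    case False
    have "0 < slack \<sigma> j' i' p" by (rule W_D[OF p(1) i' False])
    have "\<not> forced_crossing g \<xi> k v p \<sigma> j' i'"
    proof
      assume "forced_crossing g \<xi> k v p \<sigma> j' i'"
      from forced_crossing_slack[OF comp_p i' this] \<open>0 < slack \<sigma> j' i' p\<close> show False by simp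
    qed
    then show ?thesis using False by blast
  qed
  have sw: "switch_mode g \<xi> k v p \<sigma> = \<sigma>'"
  proof (intro ext)
    fix j' i'
    show "switch_mode g \<xi> k v p \<sigma> j' i' = \<sigma>' j' i'"
      using forced[of i' j'] i by (auto simp: switch_mode_def \<sigma>'_def)
  qed
  have "valid_mode \<sigma>'" using valid s by (auto simp: valid_mode_def \<sigma>'_def)
  have pos': "0 < slack \<sigma>' j' i' p" if i': "i' \<in> {1..k}" for j' i'
  proof (cases "(j', i') = (j, i)")
    case True
    then show ?thesis
      using slack_flip[of \<sigma> j i p \<sigma>'] p(2) s i(2) by (auto simp: \<sigma>'_def)
  next
    case False
    then have "slack \<sigma>' j' i' p = slack \<sigma> j' i' p" by (intro slack_cong) (auto simp: \<sigma>'_def)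
    then show ?thesis using W_D[OF p(1) i', of j'] False by simp
  qed
  then have p_in: "p \<in> inner_region \<sigma>'" by (simp add: inner_region_def)
  have comp': "mode_compatible \<xi> k \<sigma>' p" using inner_region_compatible[OF \<open>valid_mode \<sigma>'\<close> p_in] .
  obtain w \<delta> where w: "\<delta> > 0" "w 0 = p" "trajectory \<sigma>' v \<delta> w"
    using trajectory_exists[OF \<open>valid_mode \<sigma>'\<close>] by blast
  have "switch_mode g \<xi> k v p \<sigma>' = \<sigma>'"
  proof -
    have "\<not> forced_crossing g \<xi> k v p \<sigma>' j' i'" if "i' \<in> {1..k}" for j' i'
    proof
      assume "forced_crossing g \<xi> k v p \<sigma>' j' i'"
      from forced_crossing_slack[OF comp' that this] pos'[OF that, of j'] show False by simp
    qed
    then show ?thesis by (auto simp: switch_mode_def fun_eq_iff)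
  qed
  then have "\<forall>\<^sub>F t in at_right 0. steers_to A \<sigma>\<^sub>0 (w t) \<sigma>'"
    using steers_to_after_switching[OF st_p, where N=1 and \<sigma>'=\<sigma>' and v=v and y=w] sw comp' w by simp
  moreover have "\<forall>\<^sub>F t in at_right 0. w t \<in> inner_region \<sigma>'"
    by (rule trajectory_eventually[OF w(3,1) open_inner_region]) (use w p_in in simp)
  ultimately have "\<forall>\<^sub>F t in at_right (0::real). steers_to A \<sigma>\<^sub>0 (w t) \<sigma>' \<and> w t \<in> inner_region \<sigma>'"
    by (rule eventually_conj)
  then obtain t where "steers_to A \<sigma>\<^sub>0 (w t) \<sigma>'" "w t \<in> inner_region \<sigma>'"
    using eventually_happens'[OF trivial_limit_at_right_real] by blast
  then show ?thesis using i unfolding \<sigma>'_def by blast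
qed

text \<open>Each crossing corrects one wrong relay and alters no other, so the number of wrong
  relays decreases whichever of them is crossed.\<close>

lemma steers_to_uniform_mode:
  assumes "steers_to A \<sigma>\<^sub>0 x \<sigma>" "x \<in> inner_region \<sigma>" and s: "\<And>j. s j = 1 \<or> s j = -1"
  shows "\<exists>x' \<sigma>'. steers_to A \<sigma>\<^sub>0 x' \<sigma>' \<and> x' \<in> inner_region \<sigma>' \<and> (\<forall>j. \<forall>i\<in>{1..k}. \<sigma>' j i = s j)"
  using assms(1,2)
proof (induction "card {(j, i). i \<in> {1..k} \<and> \<sigma> j i \<noteq> s j}" arbitrary: x \<sigma> rule: less_induct)
  case less
  let ?mis = "\<lambda>\<sigma>. {(j, i). i \<in> {1..k} \<and> \<sigma> j i \<noteq> s j}"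
  show ?case
  proof (cases "?mis \<sigma> = {}")
    case True
    then have "\<forall>j. \<forall>i\<in>{1..k}. \<sigma> j i = s j" by auto
    then show ?thesis using less.prems by blast
  next
    case False
    then obtain j i0 where i0: "i0 \<in> {1..k}" "\<sigma> j i0 \<noteq> s j" by auto
    have "valid_mode \<sigma>"
      using steers_to_compatible[OF less.prems(1)] by (simp add: mode_compatible_slack)
    from valid_modeD[OF this i0(1), of j] have "\<sigma> j i0 = - s j" using i0(2) s[of j] by auto
    from cross_face[OF less.prems s i0(1) this] obtain x' i where
      i: "i \<in> {1..k}" "\<sigma> j i = - s j" and st: "steers_to A \<sigma>\<^sub>0 x' (\<sigma>(j := (\<sigma> j)(i := s j)))"
      "x' \<in> inner_region (\<sigma>(j := (\<sigma> j)(i := s j)))" by blast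
    have "finite (?mis \<sigma>)" by (rule finite_subset[of _ "UNIV \<times> {1..k}"]) auto
    moreover have "?mis (\<sigma>(j := (\<sigma> j)(i := s j))) \<subset> ?mis \<sigma>"
    proof
      show "?mis (\<sigma>(j := (\<sigma> j)(i := s j))) \<subseteq> ?mis \<sigma>" by (auto split: if_splits)
      have "- s j \<noteq> s j" using s[of j] by auto
      then have "(j, i) \<in> ?mis \<sigma>" "(j, i) \<notin> ?mis (\<sigma>(j := (\<sigma> j)(i := s j)))" using i by auto
      then show "?mis (\<sigma>(j := (\<sigma> j)(i := s j))) \<noteq> ?mis \<sigma>" by blast
    qed
    ultimately have "card (?mis (\<sigma>(j := (\<sigma> j)(i := s j)))) < card (?mis \<sigma>)"
      by (rule psubset_card_mono)
    from less.hyps[OF this st] show ?thesis .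
  qed
qed

lemma exactly_controllable:
  assumes "mode_compatible \<xi> k \<sigma>\<^sub>0 A" shows "\<exists>\<sigma>. steers_to A \<sigma>\<^sub>0 B \<sigma>"
proof -
  \<comment> \<open>Thresholds for output 1 are at most 0 and those for output -1 are positive. An
    input 0 at \<open>B\<close> has to get output -1, since the lower threshold of the relay with
    \<open>i = k\<close> is exactly 0 and the slack must be strict.\<close>
  define s where "s j = (if B \<bullet> \<xi> j > 0 then 1 else -1 :: real)" for j
  obtain x \<sigma> where "steers_to A \<sigma>\<^sub>0 x \<sigma>" "x \<in> inner_region \<sigma>"
    using steers_to_interior[OF steers_to_start[OF assms]] by blast
  moreover have "s j = 1 \<or> s j = -1" for j by (simp add: s_def)
  ultimately obtain x' \<sigma>' where st: "steers_to A \<sigma>\<^sub>0 x' \<sigma>'" "x' \<in> inner_region \<sigma>'"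
    and \<sigma>': "\<forall>j. \<forall>i\<in>{1..k}. \<sigma>' j i = s j"
    using steers_to_uniform_mode[of A \<sigma>\<^sub>0 x \<sigma> s] by blast
  have "0 < slack \<sigma>' j i B" if i: "i \<in> {1..k}" for j i
  proof -
    have "0 < real i / real k" "real i / real k \<le> 1" using i k by auto
    moreover have "\<sigma>' j i = s j" using \<sigma>' i by blast
    ultimately show ?thesis by (auto simp: slack_def threshold_def s_def)
  qed
  then have "B \<in> inner_region \<sigma>'" by (simp add: inner_region_def)
  then show ?thesis using steers_to_inner_region[OF st] by blast
qed

end

theorem theorem3p5:
  fixes \<xi> :: "'m::finite \<Rightarrow> real ^ 'n"
    and g :: "'m \<Rightarrow> real \<Rightarrow> real ^ 'n \<Rightarrow> real ^ 'n"
    and k :: nat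
  assumes "inj \<xi>" and "independent (range \<xi>)"
    and "\<And>j. norm (\<xi> j) = 1"
    and "\<And>j w. w \<in> {-1..1} \<Longrightarrow> smooth (g j w)"
    and "\<And>w. (\<forall>j. w j \<in> {-1..1}) \<Longrightarrow> chow_hypothesis (range (\<lambda>j. g j (w j)))"
    and "k \<ge> 1"
  shows "\<forall>A B \<sigma>\<^sub>0. mode_compatible \<xi> k \<sigma>\<^sub>0 A \<longrightarrow>
    (\<exists>T>0. \<exists>u. (\<forall>j. piecewise_constant_on 0 T (u j)) \<and>
       (\<exists>z h. relay_solution g \<xi> k T u z h \<and> z 0 = A \<and> h 0 = \<sigma>\<^sub>0 \<and> z T = B))"
proof (intro allI impI)
  fix A B \<sigma>\<^sub>0 assume comp: "mode_compatible \<xi> k \<sigma>\<^sub>0 A"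
  interpret relay_system g \<xi> k
    using assms by unfold_locales auto
  obtain \<sigma> where "steers_to A \<sigma>\<^sub>0 B \<sigma>" using exactly_controllable[OF comp] by blast
  then show "\<exists>T>0. \<exists>u. (\<forall>j. piecewise_constant_on 0 T (u j)) \<and>
       (\<exists>z h. relay_solution g \<xi> k T u z h \<and> z 0 = A \<and> h 0 = \<sigma>\<^sub>0 \<and> z T = B)"
    unfolding steers_to_def by blast
qed

end
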